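(* Let $\beta\in\{1,2,4\}$, $n\ge m\ge1$, $\mathbf\Sigma\in\mathfrak P_m^\beta$ and $\mathbf\Theta\in\mathfrak P_n^\beta$. Let $\mathbf X$ be an $n\times m$ random matrix over $\mathfrak F$ and define $\mathbf{S}=\mathbf{X}^{*}\mathbf{\Theta}^{-1}\mathbf{X}\in\mathfrak{P}_{m}^{\beta}$. Densities of $\mathbf X$ and $\mathbf S$ are with respect to Lebesgue measure on $\mathfrak F^{n\times m}$ and on $\mathfrak S_m^\beta$ (supported on $\mathfrak P_m^\beta$), respectively. 1. If $\mathbf{X}\sim\mathcal{SSE}_{n\times m}^{\beta}(\boldsymbol{0},\mathbf{\Sigma},\mathbf{\Theta},h)$, i.e. $\mathbf X$ has density $d^\beta(m,n)|\mathbf\Sigma|^{-\beta n/2}|\mathbf\Theta|^{-\beta m/2}h(\lambda(\mathbf\Sigma^{-1}\mathbf X^*\mathbf\Theta^{-1}\mathbf X))$, then the density of $\mathbf{S}$ is $$\frac{d^{\beta}(m,n)\,\pi^{\beta mn/2}}{\Gamma_{m}^{\beta}[\beta n/2]\,|\mathbf{\Sigma}|^{\beta n/2}}\,|\mathbf{S}|^{\beta(n-m+1)/2-1}\,h(\lambda(\mathbf{\Sigma}^{-1}\mathbf{S})).$$ 2. If $\mathbf{X}\sim\mathcal{VSE}_{n\times m}^{\beta}(\boldsymbol{0},\mathbf{\Sigma},\mathbf{\Theta},h)$, i.e. $\mathbf X$ has density $c^\beta(m,n)|\mathbf\Sigma|^{-\beta n/2}|\mathbf\Theta|^{-\beta m/2}h(\operatorname{tr}(\mathbf\Sigma^{-1}\mathbf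 X^*\mathbf\Theta^{-1}\mathbf X))$, then the density of $\mathbf{S}$ is $$\frac{c^{\beta}(m,n)\,\pi^{\beta mn/2}}{\Gamma_{m}^{\beta}[\beta n/2]\,|\mathbf{\Sigma}|^{\beta n/2}}\,|\mathbf{S}|^{\beta(n-m+1)/2-1}\,h(\operatorname{tr}(\mathbf{\Sigma}^{-1}\mathbf{S})).$$ Here, in part 1, $h$ is a nonnegative measurable function depending on its argument only through the eigenvalues and $d^\beta(m,n)$ is the normalising constant, $d^\beta(m,n)\int_{\mathfrak F^{n\times m}}h(\lambda(\mathbf Z^*\mathbf Z))(d\mathbf Z)=1$; in part 2, $h:[0,\infty)\to[0,\infty)$ is measurable and $$c^{\beta}(m,n)=\frac{\Gamma[\beta mn/2]}{2\pi^{\beta mn/2}}\left\{\int_0^\infty u^{\beta mn-1}h(u^{2})\,du\right\}^{-1};$$ in both cases the integral appearing in the normalising constant is assumed positive and finite.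
   Context: $\mathfrak F$ is the real normed division algebra of real dimension $\beta$: the reals ($\beta=1$), complex numbers ($\beta=2$), quaternions ($\beta=4$). $\mathbf A^*$ is the conjugate transpose. $\mathfrak S_m^\beta$ is the real vector space of $m\times m$ Hermitian matrices ($\mathbf S=\mathbf S^*$) over $\mathfrak F$, and $\mathfrak P_m^\beta\subset\mathfrak S_m^\beta$ the open cone of positive definite ones. Lebesgue measure on $\mathfrak F^{n\times m}$ is the product of the Lebesgue measures of all $\beta mn$ real components of the entries; on $\mathfrak S_m^\beta$ it is $(d\mathbf S)=\prod_i ds_{ii}\prod_{i<j}\prod_{k=1}^\beta ds_{ij}^{(k)}$, with $s_{ij}^{(k)}$ the real components of $s_{ij}$. For Hermitian $\mathbf S$, eigenvalues are the real numbers in its spectral decomposition $\mathbf S=\mathbf W\mathbf\Lambda\mathbf W^*$, $\mathbf W^*\mathbf W=\mathbf I_m$, collected as $\lambda(\mathbf S)=\operatorname{diag}(\lambda_1,\dots,\lambda_m)$ ($h$ is symmetric in them), and $|\mathbf S|$ is their product. For $\mathbf\Sigma\in\mathfrak P_m^\beta$ and $\mathbf M$ Hermitian, $\lambda(\mathbf\Sigma^{-1}\mathbf M)$ and $\operatorname{tr}(\mathbf\Sigma^{-1}\mathbf M)$ mean the eigenvalues and trace of $\mathbf\Sigma^{-1/2}\mathbf M\mathbf\Sigma^{-1/2}$, with $\mathbf\Sigma^{1/2}$ the Hermitian positive definite square root. The multivariate gamma function is $\Gamma_m^\beta[a]=\pi^{m(m-1)\beta/4}\prod_{i=1}^m\Gamma[a-(i-1)\beta/2]$.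 The distributions of $\mathbf S$ are called spherical-generalised-Wishart (part 1) and vector-spherical-generalised-Wishart (part 2). *)

theory Defs
  imports "HOL-Probability.Probability"
begin

section \<open>Real normed division algebras\<close>

text \<open>
  The coefficient algebra is a type \<open>'a\<close> of sort
  \<open>{real_normed_div_algebra, euclidean_space}\<close>: a finite-dimensional associative real division
  algebra with a multiplicative norm, where the norm comes from an inner product. By Frobenius'
  theorem its instances are, up to isometric isomorphism, the reals, the complex numbers and the
  quaternions. The real dimension \<open>\<beta>\<close> is \<open>DIM('a)\<close>. The library
  has the first two instances; the type of quaternions below is the third.
\<close>

codatatype quat = Quat (qRe: real) (qIm1: real) (qIm2: real) (qIm3: real)

lemma quat_eq_iff:
  "x = y \<longleftrightarrow> qRe x = qRe y \<and> qIm1 x = qIm1 y \<and> qIm2 x = qIm2 y \<and> qIm3 x = qIm3 y"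
  by (auto intro: quat.expand)

instantiation quat :: ab_group_add
begin

primcorec zero_quat where
  "qRe 0 = 0" | "qIm1 0 = 0" | "qIm2 0 = 0" | "qIm3 0 = 0"

primcorec plus_quat where
  "qRe (x + y) = qRe x + qRe y"
| "qIm1 (x + y) = qIm1 x + qIm1 y"
| "qIm2 (x + y) = qIm2 x + qIm2 y"
| "qIm3 (x + y) = qIm3 x + qIm3 y"

primcorec uminus_quat where
  "qRe (- x) = - qRe x"
| "qIm1 (- x) = - qIm1 x"
| "qIm2 (- x) = - qIm2 x"
| "qIm3 (- x) = - qIm3 x"

primcorec minus_quat where
  "qRe (x - y) = qRe x - qRe y"
| "qIm1 (x - y) = qIm1 x - qIm1 y"
| "qIm2 (x - y) = qIm2 x - qIm2 y"
| "qIm3 (x - y) = qIm3 x - qIm3 y"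

instance
  by standard (simp_all add: quat_eq_iff)

end

instantiation quat :: ring_1
begin

primcorec one_quat where
  "qRe 1 = 1" | "qIm1 1 = 0" | "qIm2 1 = 0" | "qIm3 1 = 0"

primcorec times_quat where
  "qRe (x * y) = qRe x * qRe y - qIm1 x * qIm1 y - qIm2 x * qIm2 y - qIm3 x * qIm3 y"
| "qIm1 (x * y) = qRe x * qIm1 y + qIm1 x * qRe y + qIm2 x * qIm3 y - qIm3 x * qIm2 y"
| "qIm2 (x * y) = qRe x * qIm2 y - qIm1 x * qIm3 y + qIm2 x * qRe y + qIm3 x * qIm1 y"
| "qIm3 (x * y) = qRe x * qIm3 y + qIm1 x * qIm2 y - qIm2 x * qIm1 y + qIm3 x * qRe y"

instance
  by standard (simp_all add: quat_eq_iff algebra_simps)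

end

instantiation quat :: real_algebra_1
begin

primcorec scaleR_quat where
  "qRe (scaleR r x) = r * qRe x"
| "qIm1 (scaleR r x) = r * qIm1 x"
| "qIm2 (scaleR r x) = r * qIm2 x"
| "qIm3 (scaleR r x) = r * qIm3 x"

instance
  by standard (simp_all add: quat_eq_iff algebra_simps)

end

definition quat_normsq :: "quat \<Rightarrow> real"
  where "quat_normsq x = (qRe x)\<^sup>2 + (qIm1 x)\<^sup>2 + (qIm2 x)\<^sup>2 + (qIm3 x)\<^sup>2"

lemma quat_normsq_eq_0_iff: "quat_normsq x = 0 \<longleftrightarrow> x = 0"
  by (simp add: quat_normsq_def quat_eq_iff add_nonneg_eq_0_iff)

instantiation quat :: real_div_algebra
begin

definition inverse_quat :: "quat \<Rightarrow> quat"
  where "inverse_quat x =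
    scaleR (1 / quat_normsq x) (Quat (qRe x) (- qIm1 x) (- qIm2 x) (- qIm3 x))"

definition divide_quat :: "quat \<Rightarrow> quat \<Rightarrow> quat"
  where "divide_quat x y = x * inverse y"

instance
proof
  fix x y :: quat
  show "x div y = x * inverse y"
    by (rule divide_quat_def)
  show "inverse 0 = (0 :: quat)"
    by (simp add: inverse_quat_def quat_eq_iff)
  assume "x \<noteq> 0"
  then have nz: "quat_normsq x \<noteq> 0"
    by (simp add: quat_normsq_eq_0_iff)
  define c where "c = Quat (qRe x) (- qIm1 x) (- qIm2 x) (- qIm3 x)"
  have "c * x = scaleR (quat_normsq x) 1" and "x * c = scaleR (quat_normsq x) 1"
    by (simp_all add: c_def quat_eq_iff quat_normsq_def power2_eq_square)
  then show "inverse x * x = 1" and "x * inverse x = 1"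
    using nz by (simp_all add: inverse_quat_def c_def)
qed

end

instantiation quat :: real_inner
begin

definition inner_quat :: "quat \<Rightarrow> quat \<Rightarrow> real"
  where "inner_quat x y = qRe x * qRe y + qIm1 x * qIm1 y + qIm2 x * qIm2 y + qIm3 x * qIm3 y"

definition norm_quat :: "quat \<Rightarrow> real"
  where "norm_quat x = sqrt (inner x x)"

definition sgn_quat :: "quat \<Rightarrow> quat"
  where "sgn_quat x = x /\<^sub>R norm x"

definition dist_quat :: "quat \<Rightarrow> quat \<Rightarrow> real"
  where "dist_quat x y = norm (x - y)"

definition uniformity_quat :: "(quat \<times> quat) filter"
  where "uniformity_quat = (INF e\<in>{0 <..}. principal {(x, y). dist x y < e})"

definition open_quat :: "quat set \<Rightarrow> bool"
  where "open_quat U \<longleftrightarrow> (\<forall>x\<in>U. eventually (\<lambda>(x', y). x' = x \<longrightarrow> y \<in> U) uniformity)"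

lemma inner_quat_self: "inner x x = quat_normsq x" for x :: quat
  by (simp add: inner_quat_def quat_normsq_def power2_eq_square)

instance
proof
  fix x y z :: quat and r :: real and U :: "quat set"
  show "dist x y = norm (x - y)"
    by (rule dist_quat_def)
  show "sgn x = x /\<^sub>R norm x"
    by (rule sgn_quat_def)
  show "uniformity = (INF e\<in>{0 <..}. principal {(x :: quat, y). dist x y < e})"
    by (rule uniformity_quat_def)
  show "open U \<longleftrightarrow> (\<forall>x\<in>U. eventually (\<lambda>(x', y). x' = x \<longrightarrow> y \<in> U) uniformity)"
    by (rule open_quat_def)
  show "inner x y = inner y x"
    by (simp add: inner_quat_def mult.commute)
  show "inner (x + y) z = inner x z + inner y z"
    by (simp add: inner_quat_def algebra_simps)
  show "inner (scaleR r x) y = r * inner x y"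
    by (simp add: inner_quat_def algebra_simps)
  show "0 \<le> inner x x"
    by (simp add: inner_quat_def)
  show "inner x x = 0 \<longleftrightarrow> x = 0"
    by (simp add: inner_quat_self quat_normsq_eq_0_iff)
  show "norm x = sqrt (inner x x)"
    by (rule norm_quat_def)
qed

end

lemma four_square_identity:
  fixes a b c d e f g h :: real
  shows "(a*e - b*f - c*g - d*h) * (a*e - b*f - c*g - d*h)
       + (a*f + b*e + c*h - d*g) * (a*f + b*e + c*h - d*g)
       + (a*g - b*h + c*e + d*f) * (a*g - b*h + c*e + d*f)
       + (a*h + b*g - c*f + d*e) * (a*h + b*g - c*f + d*e)
       = (a*a + b*b + c*c + d*d) * (e*e + f*f + g*g + h*h)"
  by algebra

instance quat :: real_normed_div_algebra
proof
  fix x y :: quat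
  have "inner (x * y) (x * y) = inner x x * inner y y"
    unfolding inner_quat_def times_quat.sel by (rule four_square_identity)
  then show "norm (x * y) = norm x * norm y"
    unfolding norm_quat_def by (simp only: real_sqrt_mult)
qed

instantiation quat :: euclidean_space
begin

definition Basis_quat :: "quat set"
  where "Basis_quat = {1, Quat 0 1 0 0, Quat 0 0 1 0, Quat 0 0 0 1}"

instance
proof
  show "finite (Basis :: quat set)" and "(Basis :: quat set) \<noteq> {}"
    by (simp_all add: Basis_quat_def)
  show "inner u v = (if u = v then 1 else 0)" if "u \<in> Basis" "v \<in> Basis" for u v :: quat
    using that by (auto simp: Basis_quat_def inner_quat_def quat_eq_iff)
  show "(\<forall>u\<in>Basis. inner x u = 0) \<longleftrightarrow> x = 0" for x :: quat
    by (simp add: Basis_quat_def inner_quat_def quat_eq_iff[of x 0])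
qed

end

lemma DIM_quat [simp]: "DIM(quat) = 4"
  by (simp add: Basis_quat_def quat_eq_iff)


subsection \<open>Real part and conjugation\<close>

definition re_part :: "'a::{real_normed_div_algebra, euclidean_space} \<Rightarrow> real"
  where "re_part x = x \<bullet> 1"

text \<open>Conjugation fixes the real line and negates its orthogonal complement.\<close>

definition conjugate :: "'a::{real_normed_div_algebra, euclidean_space} \<Rightarrow> 'a"
  where "conjugate x = 2 * of_real (re_part x) - x"

lemma re_part_real: "re_part (x::real) = x"
  and re_part_complex: "re_part z = Re z"
  and re_part_quat: "re_part q = qRe q"
  by (simp_all add: re_part_def inner_complex_def inner_quat_def)

lemma conjugate_real: "conjugate (x::real) = x"
  by (simp add: conjugate_def re_part_real)

lemma conjugate_complex: "conjugate z = cnj z"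
  by (simp add: conjugate_def re_part_complex complex_eq_iff)

lemma conjugate_quat: "conjugate q = Quat (qRe q) (- qIm1 q) (- qIm2 q) (- qIm3 q)"
proof -
  have "2 * of_real r = scaleR (2 * r) (1 :: quat)" for r
    by (metis of_real_def of_real_mult of_real_numeral)
  then show ?thesis
    by (simp add: conjugate_def re_part_quat quat_eq_iff)
qed


section \<open>Hermitian matrices\<close>

definition ctranspose :: "'a::{real_normed_div_algebra, euclidean_space}^'m^'n \<Rightarrow> 'a^'n^'m"
  where "ctranspose A = (\<chi> i j. conjugate (A $ j $ i))"

definition hermitian :: "'a::{real_normed_div_algebra, euclidean_space}^'m^'m \<Rightarrow> bool"
  where "hermitian S \<longleftrightarrow> ctranspose S = S"

text \<open>The quadratic form of a Hermitian matrix is real-valued, so taking its real part loses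
  nothing.\<close>

definition pos_def :: "'a::{real_normed_div_algebra, euclidean_space}^'m^'m \<Rightarrow> bool"
  where "pos_def S \<longleftrightarrow>
    hermitian S \<and> (\<forall>x. x \<noteq> 0 \<longrightarrow> re_part (\<Sum>i\<in>UNIV. conjugate (x $ i) * (S *v x) $ i) > 0)"

definition real_diag :: "real^'m \<Rightarrow> 'a::{real_normed_div_algebra, euclidean_space}^'m^'m"
  where "real_diag l = (\<chi> i j. if i = j then of_real (l $ i) else 0)"

definition is_spectrum :: "'a::{real_normed_div_algebra, euclidean_space}^'m^'m \<Rightarrow> real^'m \<Rightarrow> bool"
  where "is_spectrum S l \<longleftrightarrow>
    (\<exists>W. ctranspose W ** W = mat 1 \<and> S = W ** real_diag l ** ctranspose W)"

text \<open>The eigenvalues are determined only up to their order, and \<open>eigvals\<close> fixes an unspecified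
  one; it is meaningful only under symmetric functions, and only for Hermitian matrices.\<close>

definition eigvals :: "'a::{real_normed_div_algebra, euclidean_space}^'m^'m \<Rightarrow> real^'m"
  where "eigvals S = (SOME l. is_spectrum S l)"

definition hdet :: "'a::{real_normed_div_algebra, euclidean_space}^'m^'m \<Rightarrow> real"
  where "hdet S = (\<Prod>i\<in>UNIV. eigvals S $ i)"

text \<open>Diagonal entries of Hermitian matrices are real, so this is the ordinary trace.\<close>

definition htrace :: "'a::{real_normed_div_algebra, euclidean_space}^'m^'m \<Rightarrow> real"
  where "htrace S = re_part (trace S)"

definition pd_sqrt ::
    "'a::{real_normed_div_algebra, euclidean_space}^'m^'m \<Rightarrow> 'a^'m^'m"
  where "pd_sqrt V = (THE R. pos_def R \<and> R ** R = V)"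

text \<open>\<open>whiten V A\<close> is \<open>V\<close> to the power \<open>-1/2\<close>, times \<open>A\<close>, times \<open>V\<close> to the power \<open>-1/2\<close>.\<close>

definition whiten ::
    "'a::{real_normed_div_algebra, euclidean_space}^'m^'m \<Rightarrow> 'a^'m^'m \<Rightarrow> 'a^'m^'m"
  where "whiten V A = matrix_inv (pd_sqrt V) ** A ** matrix_inv (pd_sqrt V)"


section \<open>Lebesgue measure on Hermitian matrices\<close>

text \<open>A Hermitian matrix is built from its real diagonal \<open>d\<close> and its strictly upper triangular
  entries \<open>u\<close>. The enumeration \<open>to_nat\<close> of the finite index type only serves to name one of the two
  entries in each conjugate pair; the measure does not depend on it.\<close>

definition herm_of ::
    "('m::finite \<Rightarrow> real) \<times> ('m \<times> 'm \<Rightarrow> 'a) \<Rightarrow>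
     'a::{real_normed_div_algebra, euclidean_space}^'m^'m"
  where "herm_of = (\<lambda>(d, u). \<chi> i j.
    if i = j then of_real (d i) else if to_nat i < to_nat j then u (i, j) else conjugate (u (j, i)))"

text \<open>The measure lives on the type of all square matrices and is concentrated on the Hermitian
  ones.\<close>

definition lborel_herm ::
    "('a::{real_normed_div_algebra, euclidean_space}^'m^'m) measure"
  where "lborel_herm =
    distr ((\<Pi>\<^sub>M i\<in>(UNIV :: 'm set). (lborel :: real measure)) \<Otimes>\<^sub>M
           (\<Pi>\<^sub>M p\<in>{(i, j). to_nat i < to_nat (j::'m)}. (lborel :: 'a measure)))
      borel herm_of"

lemma conjugate_borel_measurable [measurable]:
  "(conjugate :: 'a::{real_normed_div_algebra, euclidean_space} \<Rightarrow> 'a) \<in> borel_measurable borel"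
  unfolding conjugate_def re_part_def
  by (intro borel_measurable_continuous_onI continuous_intros)

lemma herm_of_measurable:
  "(herm_of :: _ \<Rightarrow> 'a::{real_normed_div_algebra, euclidean_space}^'m^'m)
   \<in> borel_measurable ((\<Pi>\<^sub>M i\<in>(UNIV :: 'm set). (lborel :: real measure)) \<Otimes>\<^sub>M
           (\<Pi>\<^sub>M p\<in>{(i, j). to_nat i < to_nat (j::'m)}. (lborel :: 'a measure)))"
  (is "_ \<in> borel_measurable ?M")
proof -
  have entry: "(\<lambda>x. herm_of x $ i $ j :: 'a) \<in> borel_measurable ?M" for i j :: 'm
  proof -
    consider "i = j" | "to_nat i < to_nat j" | "to_nat j < to_nat i"
      using linorder_less_linear[of "to_nat i" "to_nat j"] by (auto simp only: to_nat_split)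
    then show ?thesis
    proof cases
      case 1
      have "(\<lambda>x. of_real (fst x i) :: 'a) \<in> borel_measurable ?M"
        by measurable
      moreover have "(\<lambda>x. herm_of x $ i $ j :: 'a) = (\<lambda>x. of_real (fst x i))"
        using 1 by (auto simp: herm_of_def split_beta fun_eq_iff)
      ultimately show ?thesis
        by (simp only:)
    next
      case 2
      have "(\<lambda>x. snd x (i, j) :: 'a) \<in> borel_measurable ?M"
        by (measurable, use 2 in auto)
      moreover have "(\<lambda>x. herm_of x $ i $ j :: 'a) = (\<lambda>x. snd x (i, j))"
        using 2 by (auto simp: herm_of_def split_beta fun_eq_iff)
      ultimately show ?thesis
        by (simp only:)
    next
      case 3
      have "(\<lambda>x. conjugate (snd x (j, i)) :: 'a) \<in> borel_measurable ?M"
        by (measurable, use 3 in auto)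
      moreover have "(\<lambda>x. herm_of x $ i $ j :: 'a) = (\<lambda>x. conjugate (snd x (j, i)))"
        using 3 by (auto simp: herm_of_def split_beta fun_eq_iff)
      ultimately show ?thesis
        by (simp only:)
    qed
  qed
  show ?thesis
  proof (rule borel_measurable_euclidean_space[THEN iffD2], intro ballI)
    fix b :: "'a^'m^'m"
    assume "b \<in> Basis"
    then obtain i j c where b: "b = axis i (axis j c)"
      by (auto simp: Basis_vec_def)
    have "(\<lambda>x. (herm_of x $ i $ j :: 'a) \<bullet> c) \<in> borel_measurable ?M"
      by (intro borel_measurable_inner entry borel_measurable_const)
    then show "(\<lambda>x. (herm_of x :: 'a^'m^'m) \<bullet> b) \<in> borel_measurable ?M"
      by (simp only: b inner_axis)
  qed
qed


section \<open>Multivariate gamma function and symmetric functions\<close>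

definition mv_gamma :: "real \<Rightarrow> nat \<Rightarrow> real \<Rightarrow> real"
  where "mv_gamma \<beta> m a =
    pi powr (real m * (real m - 1) * \<beta> / 4) * (\<Prod>i=1..m. Gamma (a - (real i - 1) * \<beta> / 2))"

definition nonneg_vecs :: "(real^'m) set"
  where "nonneg_vecs = {l. \<forall>i. 0 \<le> l $ i}"

definition symmetric_on_nonneg :: "(real^'m \<Rightarrow> real) \<Rightarrow> bool"
  where "symmetric_on_nonneg h \<longleftrightarrow>
    (\<forall>l\<in>nonneg_vecs. \<forall>p. bij p \<longrightarrow> h (\<chi> i. l $ p i) = h l)"

end

theory Submission
  imports Defs
begin

text \<open>
  Both densities have the form \<open>c g(X\<^sup>* \<Theta>\<^sup>-\<^sup>1 X)\<close>, so a change of variables \<open>X = A Y\<close> with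
  \<open>\<Theta> = A A\<^sup>*\<close> reduces everything to the image of Lebesgue measure under \<open>Y \<mapsto> Y\<^sup>* Y\<close>. That image
  is computed by induction on the number of columns. A unitary map rotates the first column to
  \<open>\<surd>t e\<^sub>l\<close>, where \<open>t\<close> is its squared length and has a gamma-type density. Row \<open>l\<close> of the remaining
  columns then gives the rest of the first row of \<open>S = Y\<^sup>* Y\<close>, and the other rows give its Schur
  complement, to which the induction hypothesis applies; the determinants multiply by
  \<open>|S| = t |S / t|\<close>. For noncommutative scalars this last identity is read off from the Jacobians of
  left multiplications.
\<close>

section \<open>Algebra of conjugation\<close>

text \<open>Two obstacles shape the proof. Scalars need not commute, so no characteristic polynomial
  is at hand and eigenvectors have to come from maximizing the real quadratic form. Moreover matrix
  dimensions are types, so an induction on columns cannot pass to smaller matrices. It runs over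
  index sets \<open>J\<close> of columns and \<open>K\<close> of rows inside fixed types, with
  Lebesgue measure on the matrices supported there and the identity added outside \<open>J\<close>
  whenever a determinant is taken.

  The exponents meet as follows. For a pivot \<open>t\<close> of \<open>S\<close>, the rest of its
  row is \<open>sqrt t\<close> times a row of \<open>Y\<close>; with p columns left this scaling has
  Jacobian t^(\<beta>(p-1)/2). The determinant contributes t^e with e = \<beta>(n-p+1)/2 - 1, and
  the product is t^(\<beta>n/2-1), the density of the squared length of a column with n entries. The
  constants pi^(\<beta>k/2) / Gamma(\<beta>k/2) of these densities, for k = n, ..., n-m+1, multiply
  to the quotient of pi^(\<beta>mn/2) and the multivariate gamma function.\<close>

lemma inner_mult_mult_left: "(x * a) \<bullet> (x * b) = (norm x)\<^sup>2 * (a \<bullet> b)"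
  for x a b :: "'a::{real_normed_div_algebra, euclidean_space}"
proof -
  have "(x * a) \<bullet> (x * b) = ((norm (x * (a + b)))\<^sup>2 - (norm (x * a))\<^sup>2 - (norm (x * b))\<^sup>2) / 2"
    by (simp only: distrib_left dot_norm)
  also have "\<dots> = ((norm x * norm (a + b))\<^sup>2 - (norm x * norm a)\<^sup>2 - (norm x * norm b)\<^sup>2) / 2"
    by (simp only: norm_mult)
  also have "\<dots> = (norm x)\<^sup>2 * (((norm (a + b))\<^sup>2 - (norm a)\<^sup>2 - (norm b)\<^sup>2) / 2)"
    by (simp add: power_mult_distrib right_diff_distrib diff_divide_distrib)
  finally show ?thesis by (simp add: dot_norm)
qed

lemma conjugate_altdef: "conjugate x = (2 * (x \<bullet> 1)) *\<^sub>R 1 - x"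
  for x :: "'a::{real_normed_div_algebra, euclidean_space}"
  by (simp add: conjugate_def re_part_def scaleR_conv_of_real)

text \<open>Conjugation is the adjoint of left multiplication. Multiplicativity of the norm forces
  this: compare \<open>inner_mult_mult_left\<close> for \<open>x\<close> and for
  \<open>x + 1\<close>. All three algebras are thereby treated at once.\<close>

lemma inner_mult_left_conjugate: "(x * a) \<bullet> b = a \<bullet> (conjugate x * b)"
  for x a b :: "'a::{real_normed_div_algebra, euclidean_space}"
proof -
  have "((x + 1) * a) \<bullet> ((x + 1) * b) = (norm (x + 1))\<^sup>2 * (a \<bullet> b)"
    by (rule inner_mult_mult_left)
  moreover have "(norm (x + 1))\<^sup>2 = (norm x)\<^sup>2 + 2 * re_part x + 1"
    using dot_norm[of x 1] by (simp add: re_part_def field_simps)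
  ultimately have "(x * a) \<bullet> (x * b) + (x * a) \<bullet> b + a \<bullet> (x * b) + a \<bullet> b
      = ((norm x)\<^sup>2 + 2 * re_part x + 1) * (a \<bullet> b)"
    by (simp add: distrib_right inner_add_left inner_add_right algebra_simps)
  then have "(x * a) \<bullet> b = 2 * re_part x * (a \<bullet> b) - a \<bullet> (x * b)"
    by (simp add: inner_mult_mult_left algebra_simps)
  also have "\<dots> = a \<bullet> (conjugate x * b)"
    by (simp add: conjugate_altdef re_part_def left_diff_distrib inner_diff_right)
  finally show ?thesis .
qed

text \<open>Adjoints are unique and reverse the order of composition.\<close>

lemma conjugate_mult: "conjugate (x * y) = conjugate y * conjugate x"
  for x y :: "'a::{real_normed_div_algebra, euclidean_space}"
proof -
  have "a \<bullet> (conjugate (x * y) * 1) = a \<bullet> (conjugate y * conjugate x * 1)" for a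
    using inner_mult_left_conjugate[of "x * y" a 1] inner_mult_left_conjugate[of x "y * a" 1]
      inner_mult_left_conjugate[of y a "conjugate x * 1"]
    by (simp only: mult.assoc)
  then show ?thesis
    unfolding mult_1_right using vector_eq_ldot by blast
qed

lemma conjugate_add [simp]: "conjugate (x + y) = conjugate x + conjugate y"
  for x y :: "'a::{real_normed_div_algebra, euclidean_space}"
  by (simp add: conjugate_altdef inner_add_left algebra_simps)

lemma conjugate_scaleR [simp]: "conjugate (r *\<^sub>R x) = r *\<^sub>R conjugate x"
  for x :: "'a::{real_normed_div_algebra, euclidean_space}"
  by (simp add: conjugate_altdef scaleR_right_diff_distrib mult.left_commute)

lemma linear_conjugate: "linear (conjugate :: 'a::{real_normed_div_algebra, euclidean_space} \<Rightarrow> 'a)"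
  by (simp add: linear_iff)

lemma conjugate_0 [simp]: "conjugate (0::'a::{real_normed_div_algebra, euclidean_space}) = 0"
  using linear_0[OF linear_conjugate] .

lemma conjugate_diff [simp]: "conjugate (x - y) = conjugate x - conjugate y"
  for x y :: "'a::{real_normed_div_algebra, euclidean_space}"
  using linear_diff[OF linear_conjugate] .

lemma conjugate_sum: "conjugate (sum f A) = (\<Sum>i\<in>A. conjugate (f i))"
  for f :: "'b \<Rightarrow> 'a::{real_normed_div_algebra, euclidean_space}"
  using linear_sum[OF linear_conjugate] .

lemma re_part_of_real [simp]: "re_part (of_real r :: 'a::{real_normed_div_algebra, euclidean_space}) = r"
  by (simp add: re_part_def of_real_def dot_square_norm)

lemma conjugate_of_real [simp]: "conjugate (of_real r :: 'a::{real_normed_div_algebra, euclidean_space}) = of_real r"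
  by (simp add: conjugate_def mult_2)

lemma conjugate_1 [simp]: "conjugate (1 :: 'a::{real_normed_div_algebra, euclidean_space}) = 1"
  using conjugate_of_real[of 1] by simp

lemma re_part_conjugate [simp]: "re_part (conjugate x) = re_part x"
  for x :: "'a::{real_normed_div_algebra, euclidean_space}"
proof -
  have "conjugate x = of_real (2 * re_part x) - x"
    by (simp add: conjugate_def)
  then show ?thesis
    using re_part_of_real[of "2 * re_part x"] by (simp add: re_part_def inner_diff_left)
qed

lemma conjugate_conjugate [simp]: "conjugate (conjugate x) = x"
  for x :: "'a::{real_normed_div_algebra, euclidean_space}"
  by (subst conjugate_def) (simp, simp add: conjugate_def)

lemma inner_eq_re_part: "x \<bullet> y = re_part (conjugate x * y)"
  for x y :: "'a::{real_normed_div_algebra, euclidean_space}"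
  using inner_mult_left_conjugate[of x 1 y] by (simp add: re_part_def inner_commute)

lemma conjugate_mult_self: "conjugate x * x = of_real ((norm x)\<^sup>2)"
  for x :: "'a::{real_normed_div_algebra, euclidean_space}"
proof -
  have "a \<bullet> (conjugate x * x) = a \<bullet> of_real ((norm x)\<^sup>2)" for a
    using inner_mult_left_conjugate[of x a "x * 1"] inner_mult_mult_left[of x a 1]
    by (simp add: of_real_def)
  then show ?thesis
    using vector_eq_ldot by blast
qed

lemma norm_conjugate [simp]: "norm (conjugate x) = norm x"
  for x :: "'a::{real_normed_div_algebra, euclidean_space}"
proof (cases "x = 0")
  case False
  have "norm (conjugate x) * norm x = norm x * norm x"
    unfolding norm_mult[symmetric] conjugate_mult_self
    by (simp add: norm_mult power2_eq_square)
  with False show ?thesis by simp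
qed simp

lemma mult_conjugate_self: "x * conjugate x = of_real ((norm x)\<^sup>2)"
  for x :: "'a::{real_normed_div_algebra, euclidean_space}"
  using conjugate_mult_self[of "conjugate x"] by simp

lemma conjugate_eq_self_iff: "conjugate x = x \<longleftrightarrow> x = of_real (re_part x)"
  for x :: "'a::{real_normed_div_algebra, euclidean_space}"
proof
  assume "conjugate x = x"
  then have "2 * x = 2 * of_real (re_part x)"
    by (simp add: conjugate_def mult_2 diff_eq_eq)
  then show "x = of_real (re_part x)" by simp
qed (metis conjugate_of_real)

section \<open>Matrices\<close>

lemma matrix_mul_nth: "(A ** B) $ i $ j = (\<Sum>k\<in>UNIV. A $ i $ k * B $ k $ j)"
  by (simp add: matrix_matrix_mult_def)

lemma ctranspose_nth [simp]: "ctranspose A $ i $ j = conjugate (A $ j $ i)"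
  by (simp add: ctranspose_def)

lemma ctranspose_ctranspose [simp]: "ctranspose (ctranspose A) = A"
  by (simp add: vec_eq_iff)

lemma ctranspose_mult: "ctranspose (A ** B) = ctranspose B ** ctranspose A"
  by (simp add: vec_eq_iff matrix_mul_nth conjugate_sum conjugate_mult)

lemma linear_ctranspose: "linear (ctranspose :: 'a::{real_normed_div_algebra, euclidean_space}^'m^'n \<Rightarrow> _)"
  by (simp add: linear_iff vec_eq_iff)

lemma ctranspose_add: "ctranspose (A + B) = ctranspose A + ctranspose B"
  by (rule linear_add[OF linear_ctranspose])

lemma ctranspose_scaleR: "ctranspose (r *\<^sub>R A) = r *\<^sub>R ctranspose A"
  by (rule linear_scale[OF linear_ctranspose])

lemma ctranspose_mat_1 [simp]: "ctranspose (mat 1) = mat 1"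
  by (simp add: vec_eq_iff mat_def)

lemma linear_matrix_mul_left:
  "linear (\<lambda>B :: 'a::{real_normed_div_algebra, euclidean_space}^'m^'k. A ** B)"
  by (simp add: linear_iff vec_eq_iff matrix_mul_nth distrib_left sum.distrib scaleR_sum_right)

lemma linear_matrix_mul_right:
  "linear (\<lambda>A :: 'a::{real_normed_div_algebra, euclidean_space}^'k^'n. A ** B)"
  by (simp add: linear_iff vec_eq_iff matrix_mul_nth distrib_right sum.distrib scaleR_sum_right)

lemma linear_matrix_vector_mult_left:
  "linear (\<lambda>x :: 'a::{real_normed_div_algebra, euclidean_space}^'m. A *v x)"
  by (simp add: linear_iff vec_eq_iff matrix_vector_mult_def distrib_left sum.distrib scaleR_sum_right)

lemma inner_matrix_vector_mult:
  fixes A :: "'a::{real_normed_div_algebra, euclidean_space}^'m^'n"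
  shows "(A *v x) \<bullet> y = x \<bullet> (ctranspose A *v y)"
proof -
  have "(A *v x) \<bullet> y = (\<Sum>i\<in>UNIV. \<Sum>j\<in>UNIV. (A $ i $ j * x $ j) \<bullet> y $ i)"
    by (simp add: inner_vec_def matrix_vector_mult_def inner_sum_left)
  also have "\<dots> = (\<Sum>j\<in>UNIV. \<Sum>i\<in>UNIV. x $ j \<bullet> (conjugate (A $ i $ j) * y $ i))"
    by (subst sum.swap) (simp add: inner_mult_left_conjugate)
  finally show ?thesis
    by (simp add: inner_vec_def matrix_vector_mult_def inner_sum_right)
qed

lemma re_part_sum: "re_part (sum f A) = (\<Sum>i\<in>A. re_part (f i))"
  by (simp add: re_part_def inner_sum_left)

lemma pos_def_iff:
  "pos_def S \<longleftrightarrow> hermitian S \<and> (\<forall>x. x \<noteq> 0 \<longrightarrow> x \<bullet> (S *v x) > 0)"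
proof -
  have "x \<bullet> (S *v x) = re_part (\<Sum>i\<in>UNIV. conjugate (x $ i) * (S *v x) $ i)" for x
    by (simp only: inner_vec_def inner_eq_re_part re_part_sum)
  then show ?thesis by (simp only: pos_def_def)
qed

lemma matrix_add_rdistrib': "(A + B) ** C = A ** C + B ** C"
  for A B :: "'a::{real_normed_div_algebra, euclidean_space}^'k^'n"
  by (rule linear_add[OF linear_matrix_mul_right])

lemma matrix_add_ldistrib': "A ** (B + C) = A ** B + A ** C"
  for B C :: "'a::{real_normed_div_algebra, euclidean_space}^'k^'n"
  by (rule linear_add[OF linear_matrix_mul_left])

section \<open>Inverses of square matrices\<close>

lemma matrix_vector_eqI:
  fixes A B :: "'a::{real_normed_div_algebra, euclidean_space}^'m^'n"
  assumes "\<And>x. A *v x = B *v x"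
  shows "A = B"
proof -
  have "A $ i $ j = B $ i $ j" for i j
  proof -
    have "(A *v axis j 1) $ i = (B *v axis j 1) $ i" by (simp add: assms)
    then show ?thesis
      by (simp add: matrix_vector_mult_def axis_def if_distrib[of "\<lambda>x. _ * x"] cong: if_cong)
  qed
  then show ?thesis by (simp add: vec_eq_iff)
qed

text \<open>Viewed as endomorphisms of a finite-dimensional real space, the matrices have two-sided
  inverses as soon as they have one-sided ones; this replaces a determinant argument.\<close>

lemma matrix_left_inverse_imp_right:
  fixes A B :: "'a::{real_normed_div_algebra, euclidean_space}^'m^'m"
  assumes "A ** B = mat 1"
  shows "B ** A = mat 1"
proof -
  have "(\<lambda>x. A *v x) \<circ> (\<lambda>x. B *v x) = id"
    using assms by (simp add: fun_eq_iff matrix_vector_mul_assoc)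
  then have "(\<lambda>x. B *v x) \<circ> (\<lambda>x. A *v x) = id"
    using linear_inverse_left[OF linear_matrix_vector_mult_left linear_matrix_vector_mult_left, of A B] by simp
  then show ?thesis
    by (intro matrix_vector_eqI) (simp add: fun_eq_iff matrix_vector_mul_assoc)
qed

lemma matrix_inv_eqI:
  fixes A B :: "'a::{real_normed_div_algebra, euclidean_space}^'m^'m"
  assumes "A ** B = mat 1"
  shows "matrix_inv A = B"
proof -
  have BA: "B ** A = mat 1" by (rule matrix_left_inverse_imp_right[OF assms])
  have "A ** matrix_inv A = mat 1 \<and> matrix_inv A ** A = mat 1"
    unfolding matrix_inv_def by (rule someI[of _ B]) (use assms BA in auto)
  then have "B ** (A ** matrix_inv A) = B"
    by simp
  then show ?thesis
    by (simp add: matrix_mul_assoc BA)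
qed

section \<open>Spectral decomposition\<close>

definition diag_mat :: "('m \<Rightarrow> 'a) \<Rightarrow> 'a::{real_normed_div_algebra, euclidean_space}^'m^'m"
  where "diag_mat d = (\<chi> i j. if i = j then d i else 0)"

lemma diag_mat_mult_nth: "(diag_mat d ** A) $ i $ j = d i * A $ i $ j"
  by (simp add: diag_mat_def matrix_mul_nth if_distrib[of "\<lambda>x. x * _"] cong: if_cong)

lemma mult_diag_mat_nth: "(A ** diag_mat d) $ i $ j = A $ i $ j * d j"
  by (simp add: diag_mat_def matrix_mul_nth if_distrib[of "\<lambda>x. _ * x"] cong: if_cong)

lemma diag_mat_mult: "diag_mat d ** diag_mat e = diag_mat (\<lambda>i. d i * e i)"
  by (simp add: vec_eq_iff diag_mat_mult_nth) (simp add: diag_mat_def)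

lemma ctranspose_diag_mat: "ctranspose (diag_mat d) = diag_mat (\<lambda>i. conjugate (d i))"
  by (simp add: vec_eq_iff diag_mat_def)

lemma diag_mat_1 [simp]: "diag_mat (\<lambda>_. 1) = mat 1"
  by (simp add: vec_eq_iff diag_mat_def mat_def)

lemma diag_mat_vector_nth: "(diag_mat d *v x) $ i = d i * x $ i"
  by (simp add: diag_mat_def matrix_vector_mult_def if_distrib[of "\<lambda>x. x * _"] cong: if_cong)

lemma real_diag_eq: "real_diag l = diag_mat (\<lambda>i. of_real (l $ i))"
  by (simp add: real_diag_def diag_mat_def)

section \<open>Unitary matrices that move a vector to a coordinate axis\<close>

lemma norm_axis: "norm (axis i a) = norm (a :: 'a::euclidean_space)"
  by (simp add: norm_eq_sqrt_inner inner_axis_axis)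

lemma exists_unit_phase:
  fixes a :: "'a::{real_normed_div_algebra, euclidean_space}"
  obtains q where "norm q = 1" "conjugate q * a = of_real (norm a)" "a = q * of_real (norm a)"
proof (cases "a = 0")
  case True
  with that[of 1] show ?thesis by simp
next
  case False
  let ?q = "(1 / norm a) *\<^sub>R a"
  show ?thesis
  proof (rule that[of ?q])
    show "norm ?q = 1" using False by simp
    show "conjugate ?q * a = of_real (norm a)"
      by (simp add: conjugate_mult_self power2_eq_square of_real_def)
    show "a = ?q * of_real (norm a)"
      using False by (simp add: of_real_def)
  qed
qed

lemma sum_conjugate_mult_self:
  "(\<Sum>i\<in>UNIV. conjugate (x $ i) * x $ i) = of_real ((norm x)\<^sup>2)"
  for x :: "'a::{real_normed_div_algebra, euclidean_space}^'n"
  by (simp add: conjugate_mult_self norm_vec_def L2_set_def sum_nonneg del: of_real_power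
      flip: of_real_sum)

text \<open>A Householder reflection \<open>H\<close> in the difference \<open>v\<close> of
  \<open>x\<close> and its target, followed by a diagonal phase correction \<open>D\<close>. The
  last conclusion confines the action to \<open>K\<close>, so that matrices whose nonzero rows lie
  in \<open>K\<close> keep this property.\<close>

lemma exists_unitary_to_axis:
  fixes x :: "'a::{real_normed_div_algebra, euclidean_space}^'n"
  assumes l: "l \<in> K" and x: "\<And>i. i \<notin> K \<Longrightarrow> x $ i = 0"
  obtains Q where "ctranspose Q ** Q = mat 1" "Q ** ctranspose Q = mat 1"
    "Q *v x = axis l (of_real (norm x))"
    "\<And>i j. i \<notin> K \<or> j \<notin> K \<Longrightarrow> Q $ i $ j = (if i = j then 1 else 0)"
proof -
  obtain q where q: "norm q = 1" "conjugate q * x $ l = of_real (norm (x $ l))"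
    "x $ l = q * of_real (norm (x $ l))"
    using exists_unit_phase .
  \<comment> \<open>The target has the phase of \<open>x $ l\<close>. Then
    \<open>conjugate a * x $ l\<close> is real, and so the scalar product of \<open>v\<close> with
    \<open>x\<close>, which lies in \<open>'a\<close>, is real too and equals half the squared
    length of \<open>v\<close>. The reflection formula depends on this.\<close>
  define a where "a = q * of_real (norm x)"
  define v where "v = x - axis l a"
  \<comment> \<open>For \<open>v = 0\<close> the quotient is \<open>0\<close> and \<open>H\<close>
    is the identity, which is the right map in that case.\<close>
  define H where "H = mat 1 - (2 / (norm v)\<^sup>2) *\<^sub>R (\<chi> i j. v $ i * conjugate (v $ j))"
  have v0: "v $ i = 0" if "i \<notin> K" for i
    using that l x by (auto simp: v_def axis_def)
  have aa: "conjugate a * x $ l = of_real (norm x * norm (x $ l))"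
    by (simp add: a_def conjugate_mult mult.assoc q(2))
  have s: "(\<Sum>j\<in>UNIV. conjugate (v $ j) * x $ j) = of_real ((norm v)\<^sup>2 / 2)"
  proof -
    have "(\<Sum>j\<in>UNIV. conjugate (v $ j) * x $ j)
        = (\<Sum>j\<in>UNIV. conjugate (x $ j) * x $ j) - (\<Sum>j\<in>UNIV. if j = l then conjugate a * x $ l else 0)"
      unfolding sum_subtractf[symmetric]
      by (intro sum.cong refl) (simp add: v_def axis_def left_diff_distrib)
    also have "\<dots> = of_real ((norm x)\<^sup>2 - norm x * norm (x $ l))"
      by (simp add: sum_conjugate_mult_self aa)
    also have "(norm x)\<^sup>2 - norm x * norm (x $ l) = (norm v)\<^sup>2 / 2"
    proof -
      have "x \<bullet> axis l a = a \<bullet> x $ l"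
        by (simp add: inner_axis inner_commute)
      also have "\<dots> = norm x * norm (x $ l)"
        by (simp add: inner_eq_re_part aa del: of_real_mult)
      finally have "x \<bullet> axis l a = norm x * norm (x $ l)" .
      moreover have "norm a = norm x" by (simp add: a_def norm_mult q)
      ultimately show ?thesis
        using dot_norm_neg[of x "axis l a"] by (simp add: v_def norm_axis field_simps power2_eq_square)
    qed
    finally show ?thesis .
  qed
  have Hx: "H *v x = axis l a"
  proof (cases "v = 0")
    case True
    then show ?thesis by (simp add: H_def v_def)
  next
    case False
    have "(H *v x) $ i = x $ i - v $ i" for i
    proof -
      have "(H *v x) $ i = (\<Sum>j\<in>UNIV. (if i = j then x $ j else 0)) -
          (2 / (norm v)\<^sup>2) *\<^sub>R (v $ i * (\<Sum>j\<in>UNIV. conjugate (v $ j) * x $ j))"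
        by (simp add: matrix_vector_mult_def H_def mat_def left_diff_distrib sum_subtractf
            sum_distrib_left scaleR_sum_right mult.assoc if_distrib[of "\<lambda>x. x * _"] cong: if_cong)
      also have "\<dots> = x $ i - v $ i"
        using False by (simp add: s of_real_def)
      finally show ?thesis .
    qed
    then show ?thesis by (simp add: vec_eq_iff v_def)
  qed
  have Hherm: "ctranspose H = H"
    by (simp add: H_def vec_eq_iff mat_def conjugate_mult)
  have HH: "H ** H = mat 1"
  proof (cases "v = 0")
    case True
    then show ?thesis by (simp add: H_def)
  next
    case False
    define P where "P = (\<chi> i j. v $ i * conjugate (v $ j))"
    define c where "c = 2 / (norm v)\<^sup>2"
    have PP: "P ** P = (norm v)\<^sup>2 *\<^sub>R P"
    proof -
      have "(P ** P) $ i $ j = v $ i * (\<Sum>k\<in>UNIV. conjugate (v $ k) * v $ k) * conjugate (v $ j)" for i j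
        by (simp add: P_def matrix_mul_nth sum_distrib_left sum_distrib_right mult.assoc)
      then show ?thesis
        by (simp add: vec_eq_iff sum_conjugate_mult_self P_def of_real_def del: of_real_power)
    qed
    have H: "H = mat 1 + (- c) *\<^sub>R P" by (simp add: H_def P_def c_def)
    have "H ** H = mat 1 + (- c) *\<^sub>R P + (- c) *\<^sub>R (P + (- c) *\<^sub>R ((norm v)\<^sup>2 *\<^sub>R P))"
      unfolding H
      by (simp only: matrix_add_rdistrib' matrix_add_ldistrib' linear_scale[OF linear_matrix_mul_left]
          linear_scale[OF linear_matrix_mul_right] matrix_mul_lid matrix_mul_rid PP)
    also have "\<dots> = mat 1 + ((c * c * (norm v)\<^sup>2) - 2 * c) *\<^sub>R P"
      by (simp add: algebra_simps flip: scaleR_2)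
    also have "c * c * (norm v)\<^sup>2 = 2 * c"
      using False by (simp add: c_def field_simps)
    finally show ?thesis by simp
  qed
  \<comment> \<open>The reflection leaves the phase \<open>q\<close> at position \<open>l\<close>;
    multiplying that row by \<open>conjugate q\<close> makes the entry real.\<close>
  define D where "D = diag_mat (\<lambda>i. if i = l then conjugate q else 1)"
  have qq: "q * conjugate q = 1" "conjugate q * q = 1"
    using q(1) by (simp_all add: mult_conjugate_self conjugate_mult_self)
  have DD: "ctranspose D ** D = mat 1" "D ** ctranspose D = mat 1"
    using qq by (simp_all add: D_def ctranspose_diag_mat diag_mat_mult if_distrib
        if_distribR cong: if_cong)
  show ?thesis
  proof (rule that[of "D ** H"])
    have "ctranspose (D ** H) ** (D ** H) = H ** (ctranspose D ** D) ** H"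
      by (simp only: ctranspose_mult Hherm matrix_mul_assoc)
    then show "ctranspose (D ** H) ** (D ** H) = mat 1"
      by (simp add: DD HH)
    have "(D ** H) ** ctranspose (D ** H) = D ** (H ** H) ** ctranspose D"
      by (simp only: ctranspose_mult Hherm matrix_mul_assoc)
    then show "(D ** H) ** ctranspose (D ** H) = mat 1"
      by (simp add: DD HH)
    have "conjugate q * a = of_real (norm x)"
      by (simp add: a_def qq flip: mult.assoc)
    then show "(D ** H) *v x = axis l (of_real (norm x))"
      by (simp add: Hx vec_eq_iff D_def diag_mat_vector_nth axis_def flip: matrix_vector_mul_assoc)
    show "(D ** H) $ i $ j = (if i = j then 1 else 0)" if "i \<notin> K \<or> j \<notin> K" for i j
      using that l by (auto simp: D_def diag_mat_mult_nth H_def mat_def v0)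
  qed
qed

section \<open>Diagonalization by maximizing the quadratic form\<close>

lemma real_eq_0_if_quadratic_nonneg:
  fixes a b :: real
  assumes "\<And>t. 0 \<le> - 2 * t * a + t\<^sup>2 * b" "a \<ge> 0"
  shows "a = 0"
proof (rule ccontr)
  assume "a \<noteq> 0"
  with assms(2) have a: "a > 0" by simp
  have "0 \<le> b" using assms(1)[of 1] a by simp
  \<comment> \<open>Small enough for the linear term to dominate; the summand \<open>1\<close>
    covers \<open>b = 0\<close>.\<close>
  define t where "t = a / (b + 1)"
  have t: "t > 0" "t * b < a" using a \<open>0 \<le> b\<close> by (simp_all add: t_def field_simps)
  have "t * (t * b - 2 * a) < 0"
    using t a by (intro mult_pos_neg) auto
  with assms(1)[of t] show False
    by (simp add: power2_eq_square algebra_simps)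
qed

lemma hermitian_mult: "hermitian A \<Longrightarrow> hermitian (ctranspose B ** A ** B)"
  by (simp add: hermitian_def ctranspose_mult matrix_mul_assoc)

text \<open>Induction on the set \<open>J\<close> of columns already cleared. The next eigenvector
  maximizes the quadratic form on the unit sphere of the vectors vanishing on \<open>J\<close>, a
  subspace that the current matrix leaves invariant; a unitary matrix acting only outside
  \<open>J\<close> then moves it to the axis \<open>l\<close>.\<close>

lemma hermitian_partial_diagonalization:
  fixes A :: "'a::{real_normed_div_algebra, euclidean_space}^'m^'m"
    and J :: "'m set"
  assumes "finite J" "hermitian A"
  shows "\<exists>W :: 'a^'m^'m. ctranspose W ** W = mat 1 \<and> W ** ctranspose W = mat 1 \<and>
    (\<forall>j\<in>J. \<forall>i. i \<noteq> j \<longrightarrow> (ctranspose W ** A ** W) $ i $ j = 0)"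
  using assms(1)
proof (induction J)
  case empty
  show ?case by (rule exI[of _ "mat 1"]) simp
next
  case (insert l J)
  then obtain W where W: "ctranspose W ** W = mat 1" "W ** ctranspose W = mat 1"
    and diag: "\<And>i j. j \<in> J \<Longrightarrow> i \<noteq> j \<Longrightarrow> (ctranspose W ** A ** W) $ i $ j = 0"
    by blast
  define B where "B = ctranspose W ** A ** W"
  have herm: "ctranspose B = B"
    using hermitian_mult[OF assms(2), of W] by (simp add: B_def hermitian_def)
  have diag1: "B $ i $ j = 0" if "j \<in> J" "i \<noteq> j" for i j
    using diag that by (simp add: B_def)
  have diag2: "B $ j $ i = 0" if "j \<in> J" "i \<noteq> j" for i j
    using diag1[OF that] by (subst herm[symmetric]) simp
  define U where "U = {x :: 'a^'m. \<forall>i\<in>J. x $ i = 0}"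
  have Bcont: "continuous_on S (\<lambda>x. x \<bullet> (B *v x))" for S
    by (intro continuous_intros linear_continuous_on linear_linear[THEN iffD2] linear_matrix_vector_mult_left)
  have "closed U"
  proof -
    have "U = (\<Inter>i\<in>J. {x. x $ i = 0})" by (auto simp: U_def)
    then show ?thesis by (auto intro!: closed_INT closed_Collect_eq continuous_intros)
  qed
  moreover have "axis l 1 \<in> U \<inter> sphere 0 1"
    using insert.hyps norm_axis[of l "1::'a"] by (auto simp: U_def axis_def)
  ultimately have "compact (U \<inter> sphere 0 1)" "U \<inter> sphere 0 1 \<noteq> {}"
    by (auto intro: closed_Int_compact)
  then obtain x where x': "x \<in> U \<inter> sphere 0 1" "\<forall>y \<in> U \<inter> sphere 0 1. y \<bullet> (B *v y) \<le> x \<bullet> (B *v x)"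
    using continuous_attains_sup[of "U \<inter> sphere 0 1", OF _ _ Bcont] by blast
  then have x: "x \<in> U" "norm x = 1"
    and max: "\<And>y. y \<in> U \<Longrightarrow> norm y = 1 \<Longrightarrow> y \<bullet> (B *v y) \<le> x \<bullet> (B *v x)"
    by auto
  define \<mu> where "\<mu> = x \<bullet> (B *v x)"
  have U_lin: "c *\<^sub>R y \<in> U" "y + z \<in> U" "y - z \<in> U" if "y \<in> U" "z \<in> U" for c y z
    using that by (auto simp: U_def)
  have B_lin: "B *v (y + z) = B *v y + B *v z" "B *v (c *\<^sub>R y) = c *\<^sub>R (B *v y)" for y z c
    by (simp_all add: linear_add[OF linear_matrix_vector_mult_left] linear_scale[OF linear_matrix_vector_mult_left])
  have B_sym: "(B *v y) \<bullet> z = y \<bullet> (B *v z)" for y z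
    by (simp add: inner_matrix_vector_mult herm)
  have BU: "B *v y \<in> U" if "y \<in> U" for y
    using that diag2 by (auto simp: U_def matrix_vector_mult_def intro!: sum.neutral) metis
  \<comment> \<open>Homogeneity extends maximality from the unit sphere to all of \<open>U\<close>.
    The defect is a nonnegative quadratic form that vanishes at \<open>x\<close>.\<close>
  have nonneg: "0 \<le> \<mu> * (norm y)\<^sup>2 - y \<bullet> (B *v y)" if "y \<in> U" for y
  proof (cases "y = 0")
    case False
    have "((1 / norm y) *\<^sub>R y) \<bullet> (B *v ((1 / norm y) *\<^sub>R y)) \<le> \<mu>"
      unfolding \<mu>_def by (rule max) (use U_lin(1)[OF that that] False in auto)
    then show ?thesis
      using False by (simp add: B_lin field_simps power2_eq_square)
  qed simp
  \<comment> \<open>The residual of the eigenvalue equation. Moving from \<open>x\<close> to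
    \<open>x + t *\<^sub>R w\<close> changes the defect to first order by
    \<open>- 2 * t * (w \<bullet> w)\<close>, which nonnegativity permits only for
    \<open>w = 0\<close>.\<close>
  define w where "w = B *v x - \<mu> *\<^sub>R x"
  have wU: "w \<in> U"
    unfolding w_def using U_lin BU x(1) by blast
  have "w \<bullet> w = 0"
  proof (rule real_eq_0_if_quadratic_nonneg)
    show "0 \<le> - 2 * t * (w \<bullet> w) + t\<^sup>2 * (\<mu> * (norm w)\<^sup>2 - w \<bullet> (B *v w))" for t
    proof -
      have "x + t *\<^sub>R w \<in> U" using U_lin wU x(1) by blast
      from nonneg[OF this] have "0 \<le> \<mu> * ((x + t *\<^sub>R w) \<bullet> (x + t *\<^sub>R w)) - (x + t *\<^sub>R w) \<bullet> (B *v (x + t *\<^sub>R w))"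
        by (simp add: power2_norm_eq_inner)
      also have "\<dots> = \<mu> * (x \<bullet> x) - x \<bullet> (B *v x) - 2 * t * (w \<bullet> (B *v x) - \<mu> * (w \<bullet> x))
          + t\<^sup>2 * (\<mu> * (w \<bullet> w) - w \<bullet> (B *v w))"
        using B_sym[of x w] by (simp add: B_lin inner_add_left inner_add_right inner_commute algebra_simps power2_eq_square)
      also have "w \<bullet> (B *v x) - \<mu> * (w \<bullet> x) = w \<bullet> w"
        by (simp add: w_def inner_diff_right inner_diff_left)
      also have "\<mu> * (x \<bullet> x) - x \<bullet> (B *v x) = 0"
        using x(2) by (simp add: \<mu>_def flip: power2_norm_eq_inner)
      finally show ?thesis by (simp add: power2_norm_eq_inner)
    qed
  qed simp
  then have eig: "B *v x = \<mu> *\<^sub>R x" by (simp add: w_def)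
  \<comment> \<open>With \<open>- J\<close> as the set of active coordinates, the columns cleared
    before stay cleared.\<close>
  obtain Q where Q: "ctranspose Q ** Q = mat 1" "Q ** ctranspose Q = mat 1"
    "Q *v x = axis l (of_real (norm x))"
    "\<And>i j. i \<notin> - J \<or> j \<notin> - J \<Longrightarrow> Q $ i $ j = (if i = j then 1 else 0)"
    using exists_unitary_to_axis[of l "- J" x] insert.hyps x(1) by (auto simp: U_def)
  define C where "C = Q ** B ** ctranspose Q"
  have "(ctranspose Q ** Q) *v x = ctranspose Q *v axis l 1"
    using Q(3) x(2) by (simp flip: matrix_vector_mul_assoc)
  then have "C *v axis l 1 = Q *v (B *v x)"
    by (simp add: C_def Q(1) flip: matrix_vector_mul_assoc)
  also have "\<dots> = \<mu> *\<^sub>R axis l 1"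
    using Q(3) x(2) by (simp add: eig linear_scale[OF linear_matrix_vector_mult_left])
  finally have Cl: "C *v axis l 1 = \<mu> *\<^sub>R axis l 1" .
  have "C $ i $ l = (C *v axis l 1) $ i" for i
    by (simp add: matrix_vector_mult_def axis_def if_distrib[of "\<lambda>x. _ * x"] cong: if_cong)
  then have "C $ i $ l = (\<mu> *\<^sub>R axis l 1) $ i" for i
    by (simp only: Cl)
  then have "C $ i $ l = 0" if "i \<noteq> l" for i
    using that by (simp add: axis_def)
  moreover have "C $ i $ j = 0" if "j \<in> J" "i \<noteq> j" for i j
  proof -
    have QJ: "Q $ j $ q = (if j = q then 1 else 0)" "Q $ i $ j = 0" for q
      using Q(4) that by auto
    have "C $ i $ j = (\<Sum>q\<in>UNIV. (Q ** B) $ i $ q * conjugate (Q $ j $ q))"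
      by (simp add: C_def matrix_mul_nth)
    also have "\<dots> = (Q ** B) $ i $ j"
      by (simp add: QJ(1) if_distrib[of conjugate] if_distrib[of "\<lambda>x. _ * x"] cong: if_cong)
    also have "\<dots> = (\<Sum>p\<in>UNIV. Q $ i $ p * B $ p $ j)"
      by (simp add: matrix_mul_nth)
    also have "\<dots> = 0"
    proof (intro sum.neutral ballI)
      show "Q $ i $ p * B $ p $ j = 0" for p
        by (cases "p = j") (simp_all add: QJ(2) diag1[OF that(1)])
    qed
    finally show ?thesis .
  qed
  moreover have "ctranspose (W ** ctranspose Q) ** A ** (W ** ctranspose Q) = C"
    by (simp add: C_def B_def ctranspose_mult matrix_mul_assoc)
  moreover have "ctranspose (W ** ctranspose Q) ** (W ** ctranspose Q) = mat 1"
  proof -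
    have "ctranspose (W ** ctranspose Q) ** (W ** ctranspose Q) = Q ** (ctranspose W ** W) ** ctranspose Q"
      by (simp add: ctranspose_mult matrix_mul_assoc)
    then show ?thesis by (simp add: W Q)
  qed
  ultimately show ?case
    using matrix_left_inverse_imp_right by (intro exI[of _ "W ** ctranspose Q"]) auto
qed

theorem hermitian_has_spectrum:
  fixes A :: "'a::{real_normed_div_algebra, euclidean_space}^'m^'m"
  assumes "hermitian A"
  shows "is_spectrum A (eigvals A)"
proof -
  obtain W :: "'a^'m^'m" where W: "ctranspose W ** W = mat 1" "W ** ctranspose W = mat 1"
    and diag: "\<And>i j. i \<noteq> j \<Longrightarrow> (ctranspose W ** A ** W) $ i $ j = 0"
    using hermitian_partial_diagonalization[OF finite assms, of UNIV] by auto
  define B where "B = ctranspose W ** A ** W"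
  have "ctranspose B = B"
    using hermitian_mult[OF assms, of W] by (simp add: B_def hermitian_def)
  then have real: "B $ i $ i = of_real (re_part (B $ i $ i))" for i
    by (metis ctranspose_nth conjugate_eq_self_iff)
  have "B = real_diag (\<chi> i. re_part (B $ i $ i))"
    using real diag by (simp add: vec_eq_iff real_diag_def B_def)
  moreover have "A = W ** B ** ctranspose W"
  proof -
    have "W ** B ** ctranspose W = (W ** ctranspose W) ** A ** (W ** ctranspose W)"
      by (simp add: B_def matrix_mul_assoc)
    then show ?thesis by (simp add: W)
  qed
  ultimately have "is_spectrum A (\<chi> i. re_part (B $ i $ i))"
    unfolding is_spectrum_def using W(1) by metis
  then show ?thesis
    unfolding eigvals_def by (rule someI)
qed

text \<open>Each eigenvalue is the value of the quadratic form at the corresponding column of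
  \<open>W\<close>, hence positive.\<close>

lemma pos_def_spectrum:
  fixes A :: "'a::{real_normed_div_algebra, euclidean_space}^'m^'m"
  assumes "pos_def A"
  obtains W where "ctranspose W ** W = mat 1" "W ** ctranspose W = mat 1"
    "A = W ** diag_mat (\<lambda>i. of_real (eigvals A $ i)) ** ctranspose W" "\<And>i. eigvals A $ i > 0"
proof -
  obtain W where W: "ctranspose W ** W = mat 1" "A = W ** diag_mat (\<lambda>i. of_real (eigvals A $ i)) ** ctranspose W"
    using hermitian_has_spectrum[of A] assms by (auto simp: pos_def_iff is_spectrum_def real_diag_eq)
  moreover have "W ** ctranspose W = mat 1"
    by (rule matrix_left_inverse_imp_right[OF W(1)])
  moreover have "eigvals A $ i > 0" for i
  proof -
    let ?x = "W *v axis i 1"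
    have Wx: "ctranspose W *v ?x = axis i 1"
      by (simp add: matrix_vector_mul_assoc W(1))
    then have "?x \<noteq> 0" by (auto simp: axis_eq_0_iff)
    with assms have "0 < ?x \<bullet> (A *v ?x)" by (simp add: pos_def_iff)
    also have "A *v ?x = W *v (diag_mat (\<lambda>i. of_real (eigvals A $ i)) *v (ctranspose W *v ?x))"
      by (subst W(2)) (simp only: matrix_vector_mul_assoc matrix_mul_assoc)
    also have "\<dots> = W *v (eigvals A $ i *\<^sub>R axis i 1)"
      unfolding Wx by (intro arg_cong[of _ _ "(*v) W"]) (simp add: vec_eq_iff diag_mat_vector_nth axis_def of_real_def)
    also have "?x \<bullet> \<dots> = axis i 1 \<bullet> ((ctranspose W ** W) *v (eigvals A $ i *\<^sub>R axis i 1))"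
      by (simp add: inner_matrix_vector_mult matrix_vector_mul_assoc)
    also have "\<dots> = eigvals A $ i"
      by (simp add: W(1) inner_axis_axis dot_square_norm norm_axis)
    finally show ?thesis .
  qed
  ultimately show ?thesis using that by blast
qed

lemma hdet_pos: "pos_def A \<Longrightarrow> hdet A > 0"
  unfolding hdet_def by (rule prod_pos) (metis pos_def_spectrum)

section \<open>Lebesgue measure on subspaces\<close>

text \<open>The measure depends on the vectors, not merely on their span. For an orthonormal family
  it is the Lebesgue measure of the subspace. For the basis of Hermitian matrices used later, whose
  off-diagonal members have norm \<open>sqrt 2\<close>, it is the product measure of the real
  components, without the factors that the Euclidean norm would introduce.\<close>

definition span_lebesgue :: "'i set \<Rightarrow> ('i \<Rightarrow> 'e::euclidean_space) \<Rightarrow> 'e measure"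
  where "span_lebesgue I v =
    distr (\<Pi>\<^sub>M i\<in>I. (lborel :: real measure)) borel (\<lambda>f. \<Sum>i\<in>I. f i *\<^sub>R v i)"

lemma sets_span_lebesgue [simp, measurable_cong]: "sets (span_lebesgue I v) = sets borel"
  by (simp add: span_lebesgue_def)

lemma space_span_lebesgue [simp]: "space (span_lebesgue I v) = UNIV"
  by (simp add: span_lebesgue_def)

lemma measurable_linear_combination [measurable]:
  "(\<lambda>f. \<Sum>i\<in>I. f i *\<^sub>R (v i :: 'e::euclidean_space)) \<in>
    borel_measurable (\<Pi>\<^sub>M i\<in>I. (lborel :: real measure))"
  by (intro borel_measurable_sum borel_measurable_scaleR borel_measurable_const) measurable

lemma nn_integral_span_lebesgue:
  assumes [measurable]: "F \<in> borel_measurable borel"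
  shows "(\<integral>\<^sup>+x. F x \<partial>span_lebesgue I v)
    = (\<integral>\<^sup>+f. F (\<Sum>i\<in>I. f i *\<^sub>R v i) \<partial>(\<Pi>\<^sub>M i\<in>I. (lborel :: real measure)))"
  unfolding span_lebesgue_def by (rule nn_integral_distr) measurable

interpretation lborel_prod: product_sigma_finite "\<lambda>_. lborel :: 'x::euclidean_space measure"
  by standard

lemma sigma_finite_PiM_lborel:
  "finite I \<Longrightarrow> sigma_finite_measure (\<Pi>\<^sub>M i\<in>I. (lborel :: real measure))"
  by (rule lborel_prod.sigma_finite)

lemma measurable_nn_integral_span_lebesgue [measurable]:
  assumes I: "finite I" and [measurable]: "case_prod G \<in> borel_measurable (N \<Otimes>\<^sub>M borel)"
  shows "(\<lambda>x. \<integral>\<^sup>+y. G x y \<partial>span_lebesgue I v) \<in> borel_measurable N"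
proof -
  interpret P: sigma_finite_measure "\<Pi>\<^sub>M i\<in>I. (lborel :: real measure)"
    by (rule sigma_finite_PiM_lborel[OF I])
  have "(\<lambda>x. \<integral>\<^sup>+f. G x (\<Sum>i\<in>I. f i *\<^sub>R v i) \<partial>(\<Pi>\<^sub>M i\<in>I. (lborel :: real measure)))
      \<in> borel_measurable N"
    by measurable
  moreover have "(\<integral>\<^sup>+y. G x y \<partial>span_lebesgue I v)
      = (\<integral>\<^sup>+f. G x (\<Sum>i\<in>I. f i *\<^sub>R v i) \<partial>(\<Pi>\<^sub>M i\<in>I. (lborel :: real measure)))"
    if "x \<in> space N" for x
    by (rule nn_integral_span_lebesgue) (use that in measurable)
  ultimately show ?thesis
    by (simp cong: measurable_cong)
qed

text \<open>The image measure can fail to be sigma-finite when the vectors are dependent, so Fubini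
  is applied to the product measure on the coefficients.\<close>

lemma nn_integral_span_lebesgue_swap:
  fixes v :: "'i \<Rightarrow> 'e::euclidean_space"
  assumes I: "finite I" and M: "sigma_finite_measure M"
    and [measurable]: "case_prod G \<in> borel_measurable (M \<Otimes>\<^sub>M borel)"
  shows "(\<integral>\<^sup>+x. \<integral>\<^sup>+y. G x y \<partial>span_lebesgue I v \<partial>M) = (\<integral>\<^sup>+y. \<integral>\<^sup>+x. G x y \<partial>M \<partial>span_lebesgue I v)"
proof -
  interpret M: sigma_finite_measure M by fact
  interpret P: sigma_finite_measure "\<Pi>\<^sub>M i\<in>I. (lborel :: real measure)"
    by (rule sigma_finite_PiM_lborel[OF I])
  interpret MP: pair_sigma_finite M "\<Pi>\<^sub>M i\<in>I. (lborel :: real measure)"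
    by standard
  have "(\<integral>\<^sup>+x. \<integral>\<^sup>+y. G x y \<partial>span_lebesgue I v \<partial>M)
      = (\<integral>\<^sup>+x. \<integral>\<^sup>+f. G x (\<Sum>i\<in>I. f i *\<^sub>R v i) \<partial>(\<Pi>\<^sub>M i\<in>I. (lborel :: real measure)) \<partial>M)"
    by (intro nn_integral_cong nn_integral_span_lebesgue) measurable
  also have "\<dots> = (\<integral>\<^sup>+f. \<integral>\<^sup>+x. G x (\<Sum>i\<in>I. f i *\<^sub>R v i) \<partial>M \<partial>(\<Pi>\<^sub>M i\<in>I. (lborel :: real measure)))"
    by (rule MP.Fubini'[symmetric]) measurable
  also have "\<dots> = (\<integral>\<^sup>+y. \<integral>\<^sup>+x. G x y \<partial>M \<partial>span_lebesgue I v)"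
    by (rule nn_integral_span_lebesgue[symmetric]) measurable
  finally show ?thesis .
qed

lemma nn_integral_span_lebesgue_swap2:
  fixes v :: "'i \<Rightarrow> 'e::euclidean_space" and w :: "'j \<Rightarrow> 'f::euclidean_space"
  assumes I: "finite I" and J: "finite J"
    and [measurable]: "case_prod G \<in> borel_measurable (borel \<Otimes>\<^sub>M borel)"
  shows "(\<integral>\<^sup>+x. \<integral>\<^sup>+y. G x y \<partial>span_lebesgue I v \<partial>span_lebesgue J w)
    = (\<integral>\<^sup>+y. \<integral>\<^sup>+x. G x y \<partial>span_lebesgue J w \<partial>span_lebesgue I v)"
proof -
  have "(\<integral>\<^sup>+x. \<integral>\<^sup>+y. G x y \<partial>span_lebesgue I v \<partial>span_lebesgue J w)
      = (\<integral>\<^sup>+f. \<integral>\<^sup>+y. G (\<Sum>i\<in>J. f i *\<^sub>R w i) y \<partial>span_lebesgue I v \<partial>(\<Pi>\<^sub>M i\<in>J. (lborel :: real measure)))"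
    by (rule nn_integral_span_lebesgue) (use I in measurable)
  also have "\<dots> = (\<integral>\<^sup>+y. \<integral>\<^sup>+f. G (\<Sum>i\<in>J. f i *\<^sub>R w i) y \<partial>(\<Pi>\<^sub>M i\<in>J. (lborel :: real measure)) \<partial>span_lebesgue I v)"
    by (rule nn_integral_span_lebesgue_swap[OF I sigma_finite_PiM_lborel[OF J]]) measurable
  also have "\<dots> = (\<integral>\<^sup>+y. \<integral>\<^sup>+x. G x y \<partial>span_lebesgue J w \<partial>span_lebesgue I v)"
    by (intro nn_integral_cong nn_integral_span_lebesgue[symmetric]) measurable
  finally show ?thesis .
qed

lemma nn_integral_span_lebesgue_empty:
  assumes [measurable]: "F \<in> borel_measurable borel"
  shows "(\<integral>\<^sup>+x. F x \<partial>span_lebesgue {} v) = F 0"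
  by (simp add: nn_integral_span_lebesgue PiM_empty nn_integral_count_space_finite)

lemma nn_integral_span_lebesgue_Un:
  assumes "finite A" "finite B" "A \<inter> B = {}" and [measurable]: "F \<in> borel_measurable borel"
  shows "(\<integral>\<^sup>+x. F x \<partial>span_lebesgue (A \<union> B) v)
    = (\<integral>\<^sup>+x. \<integral>\<^sup>+y. F (x + y) \<partial>span_lebesgue B v \<partial>span_lebesgue A v)"
proof -
  have eq: "(\<Sum>i\<in>A \<union> B. merge A B (f, g) i *\<^sub>R v i) = (\<Sum>i\<in>A. f i *\<^sub>R v i) + (\<Sum>i\<in>B. g i *\<^sub>R v i)" for f g
    using assms(1-3) by (subst sum.union_disjoint) (auto intro!: arg_cong2[where f="(+)"] sum.cong simp: merge_def)
  have "(\<integral>\<^sup>+x. F x \<partial>span_lebesgue (A \<union> B) v)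
     = (\<integral>\<^sup>+f. \<integral>\<^sup>+g. F ((\<Sum>i\<in>A. f i *\<^sub>R v i) + (\<Sum>i\<in>B. g i *\<^sub>R v i)) \<partial>(\<Pi>\<^sub>M i\<in>B. (lborel :: real measure)) \<partial>(\<Pi>\<^sub>M i\<in>A. (lborel :: real measure)))"
    by (subst nn_integral_span_lebesgue, simp, subst lborel_prod.product_nn_integral_fold)
      (use assms(1-3) in \<open>auto simp: eq\<close>)
  also have "\<dots> = (\<integral>\<^sup>+f. \<integral>\<^sup>+y. F ((\<Sum>i\<in>A. f i *\<^sub>R v i) + y) \<partial>span_lebesgue B v \<partial>(\<Pi>\<^sub>M i\<in>A. (lborel :: real measure)))"
    by (intro nn_integral_cong nn_integral_span_lebesgue[symmetric]) measurable
  also have "\<dots> = (\<integral>\<^sup>+x. \<integral>\<^sup>+y. F (x + y) \<partial>span_lebesgue B v \<partial>span_lebesgue A v)"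
    by (rule nn_integral_span_lebesgue[symmetric]) (use assms(2) in measurable)
  finally show ?thesis .
qed

lemma nn_integral_span_lebesgue_singleton:
  assumes [measurable]: "F \<in> borel_measurable borel"
  shows "(\<integral>\<^sup>+x. F x \<partial>span_lebesgue {i} v) = (\<integral>\<^sup>+t. F (t *\<^sub>R v i) \<partial>lborel)"
  using lborel_prod.product_nn_integral_singleton[of "\<lambda>t. F (t *\<^sub>R v i)" i]
  by (simp add: nn_integral_span_lebesgue)

lemma nn_integral_span_lebesgue_insert:
  assumes "finite I" "i \<notin> I" and [measurable]: "F \<in> borel_measurable borel"
  shows "(\<integral>\<^sup>+x. F x \<partial>span_lebesgue (insert i I) v)
    = (\<integral>\<^sup>+t. \<integral>\<^sup>+y. F (t *\<^sub>R v i + y) \<partial>span_lebesgue I v \<partial>lborel)"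
  using nn_integral_span_lebesgue_Un[of "{i}" I F v] assms
  by (simp add: nn_integral_span_lebesgue_singleton)

lemma measure_eqI_nn_integral:
  assumes "sets M = sets borel" "sets N = sets borel"
    and "\<And>F. F \<in> borel_measurable borel \<Longrightarrow> (\<integral>\<^sup>+x. F x \<partial>M) = (\<integral>\<^sup>+x. F x \<partial>N)"
  shows "M = N"
proof (rule measure_eqI)
  fix A assume "A \<in> sets M"
  with assms(1,2) assms(3)[of "indicator A"] show "emeasure M A = emeasure N A" by simp
qed (use assms in simp)

lemma span_lebesgue_reindex:
  assumes "finite I" "inj_on f I"
  shows "span_lebesgue (f ` I) v = span_lebesgue I (v \<circ> f)"
proof (rule measure_eqI_nn_integral)
  fix F :: "'c \<Rightarrow> ennreal" assume "F \<in> borel_measurable borel"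
  with assms show "(\<integral>\<^sup>+x. F x \<partial>span_lebesgue (f ` I) v) = (\<integral>\<^sup>+x. F x \<partial>span_lebesgue I (v \<circ> f))"
  proof (induction I arbitrary: F)
    case (insert i I)
    note [measurable] = insert.prems(2)
    show ?case
      using insert.hyps insert.prems(1)
      by (simp add: nn_integral_span_lebesgue_insert insert.IH)
  qed (simp add: nn_integral_span_lebesgue_empty)
qed simp_all

lemma span_lebesgue_cong: "(\<And>i. i \<in> I \<Longrightarrow> v i = w i) \<Longrightarrow> span_lebesgue I v = span_lebesgue I w"
  by (simp add: span_lebesgue_def cong: sum.cong)

lemma nn_integral_span_lebesgue_linear:
  fixes v :: "'i \<Rightarrow> 'e::euclidean_space" and L :: "'e \<Rightarrow> 'f::euclidean_space"
  assumes "linear L" and [measurable]: "F \<in> borel_measurable borel"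
  shows "(\<integral>\<^sup>+x. F (L x) \<partial>span_lebesgue I v) = (\<integral>\<^sup>+x. F x \<partial>span_lebesgue I (L \<circ> v))"
proof -
  have [measurable]: "L \<in> borel_measurable borel"
    by (intro borel_measurable_continuous_onI linear_continuous_on linear_linear[THEN iffD2] assms(1))
  show ?thesis
    by (simp add: nn_integral_span_lebesgue linear_sum[OF assms(1)] linear_scale[OF assms(1)])
qed

text \<open>The component of \<open>a\<close> along \<open>v i\<close> is absorbed by a translation
  of one real coefficient, the remainder by the induction hypothesis.\<close>

lemma nn_integral_span_lebesgue_translate:
  assumes "finite I" "a \<in> span (v ` I)" and "F \<in> borel_measurable borel"
  shows "(\<integral>\<^sup>+x. F (x + a) \<partial>span_lebesgue I v) = (\<integral>\<^sup>+x. F x \<partial>span_lebesgue I v)"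
  using assms
proof (induction I arbitrary: a F)
  case (insert i I)
  note [measurable] = insert.prems(2)
  from insert.prems(1) obtain c where c: "a - c *\<^sub>R v i \<in> span (v ` I)"
    by (auto simp: span_insert)
  have "(\<integral>\<^sup>+x. F (x + a) \<partial>span_lebesgue (insert i I) v)
      = (\<integral>\<^sup>+t. \<integral>\<^sup>+y. F (t *\<^sub>R v i + (y + (a - c *\<^sub>R v i)) + c *\<^sub>R v i) \<partial>span_lebesgue I v \<partial>lborel)"
    using insert.hyps by (simp add: nn_integral_span_lebesgue_insert add_ac)
  also have "\<dots> = (\<integral>\<^sup>+t. \<integral>\<^sup>+y. F (t *\<^sub>R v i + y + c *\<^sub>R v i) \<partial>span_lebesgue I v \<partial>lborel)"
    by (intro nn_integral_cong insert.IH[OF c]) measurable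
  also have "\<dots> = (\<integral>\<^sup>+t. \<integral>\<^sup>+y. F ((c + 1 * t) *\<^sub>R v i + y) \<partial>span_lebesgue I v \<partial>lborel)"
    by (simp add: algebra_simps)
  also have "\<dots> = (\<integral>\<^sup>+t. \<integral>\<^sup>+y. F (t *\<^sub>R v i + y) \<partial>span_lebesgue I v \<partial>lborel)"
    using nn_integral_real_affine[of "\<lambda>t. \<integral>\<^sup>+y. F (t *\<^sub>R v i + y) \<partial>span_lebesgue I v" 1 c] insert.hyps(1)
    by simp
  finally show ?case
    using insert.hyps by (simp add: nn_integral_span_lebesgue_insert)
qed (simp add: nn_integral_span_lebesgue_empty)

lemma nn_integral_span_lebesgue_scale:
  fixes F :: "'e::euclidean_space \<Rightarrow> ennreal"
  assumes "finite I" "\<And>i. i \<in> I \<Longrightarrow> c i \<noteq> 0" and "F \<in> borel_measurable borel"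
  shows "ennreal (\<Prod>i\<in>I. \<bar>c i\<bar>) * (\<integral>\<^sup>+x. F x \<partial>span_lebesgue I (\<lambda>i. c i *\<^sub>R v i)) = (\<integral>\<^sup>+x. F x \<partial>span_lebesgue I v)"
  using assms
proof (induction I arbitrary: F)
  case (insert i I)
  note [measurable] = insert.prems(2) insert.hyps(1)
  have nz: "c i \<noteq> 0" "\<And>j. j \<in> I \<Longrightarrow> c j \<noteq> 0"
    using insert.prems(1) by auto
  have "ennreal (\<Prod>i\<in>insert i I. \<bar>c i\<bar>) * (\<integral>\<^sup>+x. F x \<partial>span_lebesgue (insert i I) (\<lambda>i. c i *\<^sub>R v i))
     = ennreal \<bar>c i\<bar> * (\<integral>\<^sup>+t. ennreal (\<Prod>i\<in>I. \<bar>c i\<bar>) * (\<integral>\<^sup>+y. F (t *\<^sub>R (c i *\<^sub>R v i) + y) \<partial>span_lebesgue I (\<lambda>i. c i *\<^sub>R v i)) \<partial>lborel)"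
    by (subst nn_integral_cmult)
      (use insert.hyps in \<open>simp_all add: nn_integral_span_lebesgue_insert ennreal_mult prod_nonneg mult.assoc\<close>)
  also have "\<dots> = ennreal \<bar>c i\<bar> * (\<integral>\<^sup>+t. (\<integral>\<^sup>+y. F (t *\<^sub>R (c i *\<^sub>R v i) + y) \<partial>span_lebesgue I v) \<partial>lborel)"
    by (intro arg_cong2[where f="(*)"] nn_integral_cong insert.IH refl nz(2)) measurable
  also have "\<dots> = ennreal \<bar>c i\<bar> * (\<integral>\<^sup>+t. (\<integral>\<^sup>+y. F ((0 + c i * t) *\<^sub>R v i + y) \<partial>span_lebesgue I v) \<partial>lborel)"
    by (simp add: mult.commute)
  also have "\<dots> = (\<integral>\<^sup>+t. (\<integral>\<^sup>+y. F (t *\<^sub>R v i + y) \<partial>span_lebesgue I v) \<partial>lborel)"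
    by (rule nn_integral_real_affine[symmetric]) (simp_all add: nz)
  finally show ?case
    using insert.hyps by (simp add: nn_integral_span_lebesgue_insert)
qed (simp add: nn_integral_span_lebesgue_empty)

lemma lborel_eq_span_lebesgue: "lborel = span_lebesgue Basis (\<lambda>b. b)"
  unfolding span_lebesgue_def by (rule lborel_eq)

section \<open>Orthonormal families and uniqueness of Lebesgue measure on a subspace\<close>

definition orthonormal_family :: "'i set \<Rightarrow> ('i \<Rightarrow> 'e::euclidean_space) \<Rightarrow> bool"
  where "orthonormal_family I v \<longleftrightarrow> (\<forall>i\<in>I. \<forall>j\<in>I. v i \<bullet> v j = (if i = j then 1 else 0))"

lemma norm_orthonormal_sum:
  assumes "finite I" "orthonormal_family I v"
  shows "(norm (\<Sum>i\<in>I. f i *\<^sub>R v i))\<^sup>2 = (\<Sum>i\<in>I. (f i)\<^sup>2)"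
proof -
  have "(\<Sum>i\<in>I. f i *\<^sub>R v i) \<bullet> (\<Sum>i\<in>I. f i *\<^sub>R v i) = (\<Sum>i\<in>I. \<Sum>j\<in>I. f i * f j * (v i \<bullet> v j))"
    by (simp add: inner_sum_left inner_sum_right mult.assoc mult.left_commute sum_distrib_left inner_commute)
  also have "\<dots> = (\<Sum>i\<in>I. \<Sum>j\<in>I. if i = j then f i * f j else 0)"
    using assms(2) by (intro sum.cong refl) (simp add: orthonormal_family_def)
  also have "\<dots> = (\<Sum>i\<in>I. (f i)\<^sup>2)"
    using assms(1) by (simp add: power2_eq_square)
  finally show ?thesis by (simp add: power2_norm_eq_inner)
qed

lemma orthonormal_family_inj: "orthonormal_family I v \<Longrightarrow> inj_on v I"
  unfolding orthonormal_family_def by (intro inj_onI) (metis zero_neq_one)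

lemma dim_orthonormal_family:
  assumes "finite I" "orthonormal_family I v"
  shows "dim (span (v ` I)) = card I"
proof -
  have "independent (v ` I)"
  proof (rule pairwise_orthogonal_independent)
    show "pairwise orthogonal (v ` I)"
      using assms(2) by (auto simp: pairwise_def orthogonal_def orthonormal_family_def)
    show "0 \<notin> v ` I"
      using assms(2) by (force simp: orthonormal_family_def)
  qed
  then show ?thesis
    by (simp add: dim_eq_card_independent card_image orthonormal_family_inj[OF assms(2)])
qed

lemma nn_integral_span_lebesgue_cong:
  assumes [measurable]: "F \<in> borel_measurable borel" "G \<in> borel_measurable borel"
    and "\<And>x. x \<in> span (v ` I) \<Longrightarrow> F x = G x"
  shows "(\<integral>\<^sup>+x. F x \<partial>span_lebesgue I v) = (\<integral>\<^sup>+x. G x \<partial>span_lebesgue I v)"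
  unfolding nn_integral_span_lebesgue[OF assms(1)] nn_integral_span_lebesgue[OF assms(2)]
  by (intro nn_integral_cong assms(3) span_sum span_scale span_base) auto

text \<open>This fixes the normalization: the mass of the ball depends only on the number of vectors
  and is positive and finite.\<close>

lemma emeasure_span_lebesgue_unit_ball:
  assumes "finite I" "orthonormal_family I v"
  shows "emeasure (span_lebesgue I v) (cball 0 1) = ennreal (unit_ball_vol (card I))"
proof -
  have "emeasure (span_lebesgue I v) (cball 0 1) = emeasure (\<Pi>\<^sub>M i\<in>I. lborel)
      ((\<lambda>f. \<Sum>i\<in>I. f i *\<^sub>R v i) -` cball 0 1 \<inter> space (\<Pi>\<^sub>M i\<in>I. (lborel :: real measure)))"
    unfolding span_lebesgue_def by (rule emeasure_distr) auto
  also have "(\<lambda>f. \<Sum>i\<in>I. f i *\<^sub>R v i) -` cball 0 1 = {f. sqrt (\<Sum>i\<in>I. (f i)\<^sup>2) \<le> 1}"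
    by (auto simp flip: norm_orthonormal_sum[OF assms])
  finally show ?thesis
    using emeasure_cball_aux[OF assms(1), of 1] by simp
qed

lemma nn_integral_span_lebesgue_reflect:
  fixes v :: "'i \<Rightarrow> 'e::euclidean_space"
  assumes "finite I" and F: "F \<in> borel_measurable borel"
  shows "(\<integral>\<^sup>+x. F (- x) \<partial>span_lebesgue I v) = (\<integral>\<^sup>+x. F x \<partial>span_lebesgue I v)"
proof -
  have "linear (uminus :: 'e \<Rightarrow> 'e)"
    by (simp add: linear_iff)
  then have "(\<integral>\<^sup>+x. F (- x) \<partial>span_lebesgue I v) = (\<integral>\<^sup>+x. F x \<partial>span_lebesgue I (\<lambda>i. (-1) *\<^sub>R v i))"
    using nn_integral_span_lebesgue_linear[OF _ F, of uminus I v] by (simp add: o_def)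
  then show ?thesis
    using nn_integral_span_lebesgue_scale[OF assms(1) _ F, of "\<lambda>_. -1" v] by simp
qed

text \<open>Uniqueness of a translation-invariant measure, by evaluating
  \<open>\<integral>\<integral> F(y) g(x + y)\<close> for the unit ball \<open>g\<close> in two ways.\<close>

lemma span_lebesgue_unique:
  fixes v :: "'i \<Rightarrow> 'e::euclidean_space" and w :: "'j \<Rightarrow> 'e"
  assumes I: "finite I" "orthonormal_family I v" and J: "finite J" "orthonormal_family J w"
    and span: "span (v ` I) = span (w ` J)"
  shows "span_lebesgue I v = span_lebesgue J w"
proof (rule measure_eqI_nn_integral)
  fix F :: "'e \<Rightarrow> ennreal" assume [measurable]: "F \<in> borel_measurable borel"
  note [measurable] = I(1) J(1)
  let ?\<mu> = "span_lebesgue I v" and ?\<nu> = "span_lebesgue J w"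
  define g where "g = (indicator (cball 0 1) :: 'e \<Rightarrow> ennreal)"
  have [measurable]: "g \<in> borel_measurable borel"
    unfolding g_def by (rule borel_measurable_indicator) simp
  have "card I = card J"
    using dim_orthonormal_family[OF I] dim_orthonormal_family[OF J] span by simp
  then have g: "(\<integral>\<^sup>+x. g x \<partial>?\<mu>) = ennreal (unit_ball_vol (card I))"
      "(\<integral>\<^sup>+x. g x \<partial>?\<nu>) = ennreal (unit_ball_vol (card I))"
    by (simp_all add: g_def emeasure_span_lebesgue_unit_ball I J)
  have "(\<integral>\<^sup>+y. F y \<partial>?\<nu>) * (\<integral>\<^sup>+x. g x \<partial>?\<mu>) = (\<integral>\<^sup>+y. \<integral>\<^sup>+x. F y * g x \<partial>?\<mu> \<partial>?\<nu>)"
    by (simp add: nn_integral_cmult nn_integral_multc)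
  also have "\<dots> = (\<integral>\<^sup>+y. \<integral>\<^sup>+x. F y * g (x + y) \<partial>?\<mu> \<partial>?\<nu>)"
    by (intro nn_integral_span_lebesgue_cong
        nn_integral_span_lebesgue_translate[symmetric, OF I(1)]) (simp_all add: span)
  also have "\<dots> = (\<integral>\<^sup>+x. \<integral>\<^sup>+y. F y * g (x + y) \<partial>?\<nu> \<partial>?\<mu>)"
    by (rule nn_integral_span_lebesgue_swap2) (simp_all add: I J)
  also have "\<dots> = (\<integral>\<^sup>+x. \<integral>\<^sup>+y. F (y - x) * g y \<partial>?\<nu> \<partial>?\<mu>)"
  proof (rule nn_integral_span_lebesgue_cong)
    fix x assume "x \<in> span (v ` I)"
    with span have "x \<in> span (w ` J)" by simp
    then show "(\<integral>\<^sup>+y. F y * g (x + y) \<partial>?\<nu>) = (\<integral>\<^sup>+y. F (y - x) * g y \<partial>?\<nu>)"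
      using nn_integral_span_lebesgue_translate[OF J(1), of x w "\<lambda>y. F (y - x) * g y"]
      by (simp add: add.commute)
  qed simp_all
  also have "\<dots> = (\<integral>\<^sup>+y. \<integral>\<^sup>+x. F (y - x) * g y \<partial>?\<mu> \<partial>?\<nu>)"
    by (rule nn_integral_span_lebesgue_swap2) (simp_all add: I J)
  also have "\<dots> = (\<integral>\<^sup>+y. \<integral>\<^sup>+x. F x * g y \<partial>?\<mu> \<partial>?\<nu>)"
  proof (rule nn_integral_span_lebesgue_cong)
    fix y assume "y \<in> span (w ` J)"
    with span have y: "- y \<in> span (v ` I)" by (simp add: span_neg)
    have "(\<integral>\<^sup>+x. F (y - x) * g y \<partial>?\<mu>) = (\<integral>\<^sup>+x. F (- x) * g y \<partial>?\<mu>)"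
      using nn_integral_span_lebesgue_translate[OF I(1) y, of "\<lambda>x. F (- x) * g y"] by simp
    also have "\<dots> = (\<integral>\<^sup>+x. F x * g y \<partial>?\<mu>)"
      using nn_integral_span_lebesgue_reflect[OF I(1), of "\<lambda>x. F x * g y"] by simp
    finally show "(\<integral>\<^sup>+x. F (y - x) * g y \<partial>?\<mu>) = (\<integral>\<^sup>+x. F x * g y \<partial>?\<mu>)" .
  qed simp_all
  also have "\<dots> = (\<integral>\<^sup>+x. F x \<partial>?\<mu>) * (\<integral>\<^sup>+y. g y \<partial>?\<nu>)"
    by (simp add: nn_integral_cmult nn_integral_multc)
  finally show "(\<integral>\<^sup>+x. F x \<partial>?\<mu>) = (\<integral>\<^sup>+y. F y \<partial>?\<nu>)"
    using unit_ball_vol_pos[OF of_nat_0_le_iff, of "card I"]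
    by (auto simp: g mult.commute[of _ "ennreal (unit_ball_vol (real (card I)))"] ennreal_mult_cancel_left)
qed simp_all

text \<open>\<open>Q\<close> carries the family to another orthonormal family in the same span, and
  equality of dimensions makes the spans equal; uniqueness then replaces the computation of a
  Jacobian.\<close>

lemma nn_integral_span_lebesgue_isometry:
  fixes v :: "'i \<Rightarrow> 'e::euclidean_space"
  assumes I: "finite I" "orthonormal_family I v"
    and Q: "linear Q" "\<And>x. norm (Q x) = norm x" "\<And>i. i \<in> I \<Longrightarrow> Q (v i) \<in> span (v ` I)"
    and F: "F \<in> borel_measurable borel"
  shows "(\<integral>\<^sup>+x. F (Q x) \<partial>span_lebesgue I v) = (\<integral>\<^sup>+x. F x \<partial>span_lebesgue I v)"
proof -
  have "Q x \<bullet> Q y = x \<bullet> y" for x y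
    using Q(2)[of "x + y"] by (simp add: dot_norm linear_add[OF Q(1)] Q(2))
  then have on: "orthonormal_family I (Q \<circ> v)"
    using I(2) by (simp add: orthonormal_family_def)
  have "span ((Q \<circ> v) ` I) = span (v ` I)"
  proof (rule subspace_dim_equal)
    show "span ((Q \<circ> v) ` I) \<subseteq> span (v ` I)"
      using Q(3) by (intro span_minimal) auto
    show "dim (span (v ` I)) \<le> dim (span ((Q \<circ> v) ` I))"
      unfolding dim_orthonormal_family[OF I] dim_orthonormal_family[OF I(1) on] ..
  qed simp_all
  then have "span_lebesgue I (Q \<circ> v) = span_lebesgue I v"
    by (intro span_lebesgue_unique I on)
  then show ?thesis
    using nn_integral_span_lebesgue_linear[OF Q(1) F, of I v] by simp
qed

section \<open>Integration of radial functions\<close>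

lemma nn_integral_powr_Icc:
  fixes a t :: real
  assumes "a > 0" "t \<ge> 0"
  shows "(\<integral>\<^sup>+s. ennreal (s powr (a - 1)) * indicator {0..t} s \<partial>lborel) = ennreal (t powr a / a)"
proof -
  have "((\<lambda>s. s powr (a - 1)) has_integral (t powr a / a)) {0..t}"
    using has_integral_powr_from_0[of "a - 1" t] assms by simp
  from nn_integral_has_integral_lebesgue[OF _ this] have "ennreal (t powr a / a) = (\<integral>\<^sup>+s. ennreal (indicator {0..t} s * s powr (a - 1)) \<partial>lborel)"
    by (simp add: nn_integral_completion)
  also have "\<dots> = (\<integral>\<^sup>+s. ennreal (s powr (a - 1)) * indicator {0..t} s \<partial>lborel)"
    by (intro nn_integral_cong) (simp add: indicator_def)
  finally show ?thesis ..
qed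

text \<open>Both measures are compared on half-lines. The mass of \<open>{..t}\<close> on the left
  is the volume of a ball of radius \<open>sqrt t\<close>, a multiple of \<open>t powr q\<close>,
  and differentiation gives the density. The volume constant is
  \<open>pi powr q / Gamma (q + 1)\<close>; the functional equation of \<open>Gamma\<close> removes
  the factor \<open>q\<close> produced by the derivative.\<close>

lemma distr_sum_squares:
  assumes I: "finite I" "I \<noteq> {}"
  defines "q \<equiv> real (card I) / 2"
  shows "distr (\<Pi>\<^sub>M i\<in>I. (lborel :: real measure)) borel (\<lambda>f. \<Sum>i\<in>I. (f i)\<^sup>2)
    = density lborel (\<lambda>t. ennreal (pi powr q / Gamma q * (t powr (q - 1))) * indicator {0..} t)"
    (is "?M = ?N")
proof -
  have q: "q > 0"
    using I by (simp add: q_def card_gt_0_iff)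
  define C where "C = pi powr q / Gamma q"
  have K: "0 \<le> C"
    using q by (simp add: C_def Gamma_real_pos less_imp_le)
  have [measurable]: "(\<lambda>f. \<Sum>i\<in>I. (f i)\<^sup>2) \<in> borel_measurable (\<Pi>\<^sub>M i\<in>I. (lborel :: real measure))"
    by measurable
  have M: "emeasure ?M {..t} = ennreal (unit_ball_vol (card I) * t powr q)" if "t > 0" for t
  proof -
    have "sqrt t ^ card I = t powr q"
      using that by (simp add: q_def powr_half_sqrt[symmetric] powr_powr flip: powr_realpow)
    then show ?thesis
      using emeasure_cball_aux[OF I(1), of "sqrt t"] that
      by (subst emeasure_distr) (auto simp: vimage_def)
  qed
  \<comment> \<open>Balls shrinking to a point give the case \<open>t \<le> 0\<close>; in particular
    there is no atom at \<open>0\<close>.\<close>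
  have M0: "emeasure ?M {..t} = 0" if "t \<le> 0" for t
  proof -
    have "emeasure ?M {..t} \<le> ennreal (unit_ball_vol (card I) * (inverse (real (Suc n))) powr q)" for n
    proof -
      have "emeasure ?M {..t} \<le> emeasure ?M {..inverse (real (Suc n))}"
        by (rule emeasure_mono) (use that in \<open>auto intro: order_trans\<close>)
      then show ?thesis by (simp add: M)
    qed
    moreover have "(\<lambda>n. ennreal (unit_ball_vol (card I) * (inverse (real (Suc n))) powr q))
        \<longlonglongrightarrow> ennreal (unit_ball_vol (card I) * 0 powr q)"
      using q by (intro tendsto_ennrealI tendsto_intros LIMSEQ_inverse_real_of_nat tendsto_powr2) auto
    ultimately show ?thesis
      using LIMSEQ_le_const[of _ _ "emeasure ?M {..t}"] by fastforce
  qed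
  have vol: "unit_ball_vol (card I) = C / q"
  proof -
    have "q \<notin> \<int>\<^sub>\<le>\<^sub>0"
      using q by (auto elim!: nonpos_Ints_cases)
    then show ?thesis
      using Gamma_plus1[of q] by (simp add: unit_ball_vol_def C_def mult.commute flip: q_def)
  qed
  have N: "emeasure ?N {..t} = ennreal (unit_ball_vol (card I) * t powr q)" if "t \<ge> 0" for t
  proof -
    have "emeasure ?N {..t} = (\<integral>\<^sup>+s. ennreal (C) * (ennreal (s powr (q - 1)) * indicator {0..t} s) \<partial>lborel)"
      unfolding C_def[symmetric]
      by (subst emeasure_density)
        (auto intro!: nn_integral_cong simp: indicator_def ennreal_mult'[OF K])
    also have "\<dots> = ennreal (C) * ennreal (t powr q / q)"
      using that q by (subst nn_integral_cmult) (auto simp: nn_integral_powr_Icc)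
    also have "\<dots> = ennreal (unit_ball_vol (card I) * t powr q)"
      using K q by (simp add: vol ennreal_mult'[symmetric])
    finally show ?thesis .
  qed
  have N0: "emeasure ?N {..t} = 0" if "t < 0" for t
    using that by (subst emeasure_density) (auto intro!: nn_integral_0_iff_AE[THEN iffD2] AE_I2 simp: indicator_def)
  have eq: "emeasure ?M {..t} = emeasure ?N {..t}" for t
    using M[of t] M0[of t] N[of t] N0[of t] q by (cases t "0::real" rule: linorder_cases) auto
  show ?thesis
  proof (rule measure_eqI_generator_eq[where E = "range (\<lambda>a::real. {..a})" and \<Omega> = UNIV and A = "\<lambda>n. {..real n}"])
    show "Int_stable (range (\<lambda>a::real. {..a}))"
      by (auto simp: Int_stable_def)
    show "sets ?M = sigma_sets UNIV (range (\<lambda>a::real. {..a}))"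
      "sets ?N = sigma_sets UNIV (range (\<lambda>a::real. {..a}))"
      by (simp_all add: borel_eq_atMost)
    show "(\<Union>n. {..real n}) = UNIV"
      using real_arch_simple by auto
    show "emeasure ?M {..real n} \<noteq> \<infinity>" for n
      unfolding eq by (subst N) simp_all
  qed (auto simp: eq)
qed

text \<open>The open half-line may replace the closed one because
  \<open>0 powr (q - 1) = 0\<close>.\<close>

lemma nn_integral_span_lebesgue_radial:
  assumes I: "finite I" "I \<noteq> {}" "orthonormal_family I v"
    and [measurable]: "H \<in> borel_measurable borel"
  defines "q \<equiv> real (card I) / 2"
  shows "(\<integral>\<^sup>+x. H ((norm x)\<^sup>2) \<partial>span_lebesgue I v)
    = ennreal (pi powr q / Gamma q) * (\<integral>\<^sup>+t. ennreal (t powr (q - 1)) * indicator {0<..} t * H t \<partial>lborel)"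
proof -
  have q: "q > 0"
    using I by (simp add: q_def card_gt_0_iff)
  define C where "C = pi powr q / Gamma q"
  have K: "0 \<le> C"
    using q by (simp add: C_def Gamma_real_pos less_imp_le)
  have "(\<integral>\<^sup>+x. H ((norm x)\<^sup>2) \<partial>span_lebesgue I v) = (\<integral>\<^sup>+t. H t \<partial>distr (\<Pi>\<^sub>M i\<in>I. (lborel :: real measure)) borel (\<lambda>f. \<Sum>i\<in>I. (f i)\<^sup>2))"
    by (simp add: nn_integral_span_lebesgue norm_orthonormal_sum[OF I(1,3)] nn_integral_distr)
  also have "\<dots> = (\<integral>\<^sup>+t. ennreal (C) * (ennreal (t powr (q - 1)) * indicator {0<..} t * H t) \<partial>lborel)"
    unfolding distr_sum_squares[OF I(1,2), folded q_def] C_def[symmetric]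
    by (subst nn_integral_density)
      (auto intro!: nn_integral_cong simp: indicator_def ennreal_mult'[OF K] mult.commute mult.left_commute)
  also have "\<dots> = ennreal (C) * (\<integral>\<^sup>+t. ennreal (t powr (q - 1)) * indicator {0<..} t * H t \<partial>lborel)"
    by (rule nn_integral_cmult) measurable
  finally show ?thesis unfolding C_def .
qed

section \<open>Measurability and norms of matrix products\<close>

lemma linear_borel_measurable:
  fixes f :: "'e::euclidean_space \<Rightarrow> 'f::euclidean_space"
  shows "linear f \<Longrightarrow> f \<in> borel_measurable borel"
  by (intro borel_measurable_continuous_onI linear_continuous_on linear_linear[THEN iffD2])

lemma borel_measurable_matrix_mul [measurable]:
  fixes F :: "_ \<Rightarrow> 'a::{real_normed_div_algebra, euclidean_space}^'k^'n" and G :: "_ \<Rightarrow> 'a^'m^'k"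
  assumes "F \<in> borel_measurable M" "G \<in> borel_measurable M"
  shows "(\<lambda>x. F x ** G x) \<in> borel_measurable M"
proof (rule borel_measurable_continuous_Pair[OF assms])
  show "continuous_on UNIV (\<lambda>x. fst x ** snd x :: 'a^'m^'n)"
    unfolding matrix_matrix_mult_def by (intro continuous_intros)
qed

lemma borel_measurable_ctranspose [measurable]:
  "(ctranspose :: 'a::{real_normed_div_algebra, euclidean_space}^'m^'n \<Rightarrow> _) \<in> borel_measurable borel"
  by (rule linear_borel_measurable[OF linear_ctranspose])

lemma inner_eq_re_trace:
  fixes A B :: "'a::{real_normed_div_algebra, euclidean_space}^'m^'n"
  shows "A \<bullet> B = re_part (trace (ctranspose A ** B))"
proof -
  have "A \<bullet> B = (\<Sum>i\<in>UNIV. \<Sum>j\<in>UNIV. re_part (conjugate (A $ i $ j) * B $ i $ j))"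
    by (simp add: inner_vec_def inner_eq_re_part)
  also have "\<dots> = re_part (trace (ctranspose A ** B))"
    by (subst sum.swap) (simp add: trace_def matrix_mul_nth re_part_sum)
  finally show ?thesis .
qed

lemma norm_unitary_mult:
  fixes Z :: "'a::{real_normed_div_algebra, euclidean_space}^'m^'n"
  assumes "ctranspose Q ** Q = mat 1"
  shows "norm (Q ** Z) = norm Z"
proof -
  have "ctranspose (Q ** Z) ** (Q ** Z) = ctranspose Z ** (ctranspose Q ** Q) ** Z"
    by (simp add: ctranspose_mult matrix_mul_assoc)
  then have "(Q ** Z) \<bullet> (Q ** Z) = Z \<bullet> Z"
    by (simp add: inner_eq_re_trace assms)
  then show ?thesis by (simp add: norm_eq_sqrt_inner)
qed

section \<open>Lebesgue measure on a block of matrix entries\<close>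

definition unit_mat :: "'n \<times> 'm \<times> 'a \<Rightarrow> 'a::{real_normed_div_algebra, euclidean_space}^'m^'n"
  where "unit_mat = (\<lambda>(i, j, u). axis i (axis j u))"

lemma unit_mat_nth: "unit_mat (i, j, u) $ p $ q = (if p = i \<and> q = j then u else 0)"
  by (simp add: unit_mat_def axis_def)

text \<open>The block with rows \<open>K\<close> and columns \<open>J\<close> is realized inside the
  full matrix type, with all other entries \<open>0\<close>, so that it can shrink during an
  induction. If \<open>K\<close> or \<open>J\<close> is empty, this is the point mass at
  \<open>0\<close>.\<close>

definition block_lebesgue :: "'n set \<Rightarrow> 'm set \<Rightarrow> ('a::{real_normed_div_algebra, euclidean_space}^'m^'n) measure"
  where "block_lebesgue K J = span_lebesgue (K \<times> J \<times> Basis) unit_mat"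

lemma orthonormal_unit_mat: "orthonormal_family (K \<times> J \<times> Basis) unit_mat"
  by (auto simp: orthonormal_family_def unit_mat_def inner_axis_axis inner_Basis)

lemma unit_mat_image: "unit_mat ` (UNIV \<times> UNIV \<times> Basis) = Basis"
proof -
  have row: "(Basis :: ('a^'m) set) = (\<Union>j. \<Union>u\<in>Basis. {axis j u})"
    by (rule Basis_vec_def)
  have "(Basis :: ('a^'m^'n) set) = (\<Union>i. \<Union>v\<in>Basis. {axis i v})"
    by (rule Basis_vec_def)
  also have "\<dots> = (\<lambda>(i, j, u). axis i (axis j u)) ` (UNIV \<times> UNIV \<times> Basis)"
  proof (intro set_eqI iffI)
    fix x :: "'a^'m^'n" assume "x \<in> (\<Union>i. \<Union>v\<in>Basis. {axis i v})"
    then obtain i j u where "u \<in> Basis" "x = axis i (axis j u)"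
      unfolding row by blast
    then show "x \<in> (\<lambda>(i, j, u). axis i (axis j u)) ` (UNIV \<times> UNIV \<times> Basis)"
      by (intro image_eqI[of _ _ "(i, j, u)"]) (simp_all only: prod.case mem_Times_iff fst_conv snd_conv UNIV_I)
  next
    fix x :: "'a^'m^'n" assume "x \<in> (\<lambda>(i, j, u). axis i (axis j u)) ` (UNIV \<times> UNIV \<times> Basis)"
    then obtain p where "p \<in> UNIV \<times> UNIV \<times> Basis" "x = (\<lambda>(i, j, u). axis i (axis j u)) p"
      by (rule imageE)
    then obtain i j u where "u \<in> Basis" "x = axis i (axis j u)"
      by (cases p) (simp only: mem_Times_iff fst_conv snd_conv prod.case, blast)
    then show "x \<in> (\<Union>i. \<Union>v\<in>Basis. {axis i v})"
      unfolding row by blast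
  qed
  finally show ?thesis unfolding unit_mat_def by (rule sym)
qed

lemma block_lebesgue_UNIV: "block_lebesgue UNIV UNIV = lborel"
  unfolding block_lebesgue_def lborel_eq_span_lebesgue
  by (rule span_lebesgue_unique)
    (auto simp: orthonormal_unit_mat unit_mat_image, simp add: orthonormal_family_def inner_Basis)

lemma unit_mat_scaleR: "unit_mat (i, j, c *\<^sub>R u) = c *\<^sub>R unit_mat (i, j, u)"
  by (simp add: vec_eq_iff unit_mat_nth)

lemma linear_unit_mat: "linear (\<lambda>u. unit_mat (i, j, u) :: 'a::{real_normed_div_algebra, euclidean_space}^'m^'n)"
  by (simp add: linear_iff vec_eq_iff unit_mat_nth)

lemma mat_eq_sum_unit_mat:
  fixes Z :: "'a::{real_normed_div_algebra, euclidean_space}^'m^'n"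
  shows "Z = (\<Sum>i\<in>UNIV. \<Sum>j\<in>UNIV. unit_mat (i, j, Z $ i $ j))"
proof -
  have "(\<Sum>i\<in>UNIV. \<Sum>j\<in>UNIV. unit_mat (i, j, Z $ i $ j) $ p $ q) = Z $ p $ q" for p q
  proof -
    have "(\<Sum>i\<in>UNIV. \<Sum>j\<in>UNIV. unit_mat (i, j, Z $ i $ j) $ p $ q)
        = (\<Sum>i\<in>UNIV. if p = i then \<Sum>j\<in>UNIV. if q = j then Z $ i $ j else 0 else 0)"
      by (intro sum.cong refl) (simp add: unit_mat_nth)
    then show ?thesis by simp
  qed
  then show ?thesis by (simp add: vec_eq_iff)
qed

lemma in_span_unit_mat_iff:
  fixes Z :: "'a::{real_normed_div_algebra, euclidean_space}^'m^'n"
  shows "Z \<in> span (unit_mat ` (K \<times> J \<times> Basis)) \<longleftrightarrow> (\<forall>i j. i \<notin> K \<or> j \<notin> J \<longrightarrow> Z $ i $ j = 0)"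
proof
  have "subspace {Z :: 'a^'m^'n. \<forall>i j. i \<notin> K \<or> j \<notin> J \<longrightarrow> Z $ i $ j = 0}"
    by (auto simp: subspace_def)
  moreover have "unit_mat ` (K \<times> J \<times> Basis) \<subseteq> {Z :: 'a^'m^'n. \<forall>i j. i \<notin> K \<or> j \<notin> J \<longrightarrow> Z $ i $ j = 0}"
    by (auto simp: unit_mat_nth)
  ultimately show "\<forall>i j. i \<notin> K \<or> j \<notin> J \<longrightarrow> Z $ i $ j = 0"
    if "Z \<in> span (unit_mat ` (K \<times> J \<times> Basis))"
    using span_minimal that by blast
next
  assume Z: "\<forall>i j. i \<notin> K \<or> j \<notin> J \<longrightarrow> Z $ i $ j = 0"
  have "unit_mat (i, j, Z $ i $ j) \<in> span (unit_mat ` (K \<times> J \<times> Basis))" for i j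
  proof (cases "i \<in> K \<and> j \<in> J")
    case True
    have "unit_mat (i, j, Z $ i $ j) = (\<Sum>u\<in>Basis. (Z $ i $ j \<bullet> u) *\<^sub>R (unit_mat (i, j, u) :: 'a^'m^'n))"
      using linear_sum[OF linear_unit_mat, of i j "\<lambda>u. (Z $ i $ j \<bullet> u) *\<^sub>R u" Basis]
      by (simp only: euclidean_representation unit_mat_scaleR)
    also have "\<dots> \<in> span (unit_mat ` (K \<times> J \<times> Basis))"
      using True by (intro span_sum span_scale span_base) auto
    finally show ?thesis .
  next
    case False
    with Z have "unit_mat (i, j, Z $ i $ j) = (0 :: 'a^'m^'n)"
      by (auto simp: vec_eq_iff unit_mat_nth)
    then show ?thesis by (simp add: span_zero)
  qed
  then have "(\<Sum>i\<in>UNIV. \<Sum>j\<in>UNIV. unit_mat (i, j, Z $ i $ j)) \<in> span (unit_mat ` (K \<times> J \<times> Basis))"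
    by (intro span_sum)
  then show "Z \<in> span (unit_mat ` (K \<times> J \<times> Basis))"
    unfolding mat_eq_sum_unit_mat[symmetric] .
qed

text \<open>Left multiplication by \<open>Q\<close> is an isometry of the matrix space, and since
  \<open>Q\<close> is trivial outside \<open>K\<close> it preserves the block.\<close>

lemma nn_integral_block_lebesgue_unitary:
  fixes Q :: "'a::{real_normed_div_algebra, euclidean_space}^'n^'n" and F :: "'a^'m^'n \<Rightarrow> ennreal"
  assumes Q: "ctranspose Q ** Q = mat 1"
    "\<And>i j. i \<notin> K \<or> j \<notin> K \<Longrightarrow> Q $ i $ j = (if i = j then 1 else 0)"
    and F: "F \<in> borel_measurable borel"
  shows "(\<integral>\<^sup>+Z. F (Q ** Z) \<partial>block_lebesgue K J) = (\<integral>\<^sup>+Z. F Z \<partial>block_lebesgue K J)"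
  unfolding block_lebesgue_def
proof (rule nn_integral_span_lebesgue_isometry)
  show "linear (\<lambda>Z. Q ** Z)" by (rule linear_matrix_mul_left)
  show "norm (Q ** Z) = norm Z" for Z :: "'a^'m^'n" by (rule norm_unitary_mult[OF Q(1)])
  show "Q ** unit_mat p \<in> span (unit_mat ` (K \<times> J \<times> Basis))" if p: "p \<in> K \<times> J \<times> Basis" for p
  proof -
    obtain i j u where iju: "p = (i, j, u)" "i \<in> K" "j \<in> J" "u \<in> Basis"
      using p by auto
    have "(Q ** unit_mat p) $ a $ b = (if b = j then Q $ a $ i * u else 0)" for a b
      unfolding iju matrix_mul_nth unit_mat_nth by (cases "b = j") (simp_all add: if_distrib[of "\<lambda>x. _ * x"] cong: if_cong)
    then show ?thesis
      using Q(2) iju by (auto simp: in_span_unit_mat_iff)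
  qed
qed (use F in \<open>simp_all add: orthonormal_unit_mat\<close>)

section \<open>Jacobians of left multiplications\<close>

text \<open>\<open>c\<close> is the absolute Jacobian of \<open>f\<close>, expressed through
  integrals. These constants multiply under composition and are determined by \<open>f\<close>,
  which makes up for the absence of a multiplicative determinant over \<open>'a\<close>.\<close>

definition scales_lborel :: "('e::euclidean_space \<Rightarrow> 'e) \<Rightarrow> real \<Rightarrow> bool"
  where "scales_lborel f c \<longleftrightarrow> f \<in> borel_measurable borel \<and> 0 \<le> c \<and>
    (\<forall>F\<in>borel_measurable borel. ennreal c * (\<integral>\<^sup>+x. F (f x) \<partial>lborel) = (\<integral>\<^sup>+x. F x \<partial>lborel))"

lemma scales_lborelD:
  "scales_lborel f c \<Longrightarrow> F \<in> borel_measurable borel \<Longrightarrow>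
    ennreal c * (\<integral>\<^sup>+x. F (f x) \<partial>lborel) = (\<integral>\<^sup>+x. F x \<partial>lborel)"
  by (simp add: scales_lborel_def)

lemma scales_lborel_compose:
  assumes f: "scales_lborel f c" and g: "scales_lborel g d"
  shows "scales_lborel (\<lambda>x. f (g x)) (c * d)"
  unfolding scales_lborel_def
proof (intro conjI ballI)
  have [measurable]: "f \<in> borel_measurable borel" "g \<in> borel_measurable borel"
    using assms by (simp_all add: scales_lborel_def)
  show "(\<lambda>x. f (g x)) \<in> borel_measurable borel" by measurable
  show cd: "0 \<le> c * d" using assms by (simp add: scales_lborel_def)
  fix F :: "'a \<Rightarrow> ennreal" assume [measurable]: "F \<in> borel_measurable borel"
  have "ennreal d * (\<integral>\<^sup>+x. F (f (g x)) \<partial>lborel) = (\<integral>\<^sup>+x. F (f x) \<partial>lborel)"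
    by (rule scales_lborelD[OF g]) measurable
  moreover have "ennreal c * (\<integral>\<^sup>+x. F (f x) \<partial>lborel) = (\<integral>\<^sup>+x. F x \<partial>lborel)"
    using f by (simp add: scales_lborel_def)
  ultimately show "ennreal (c * d) * (\<integral>\<^sup>+x. F (f (g x)) \<partial>lborel) = (\<integral>\<^sup>+x. F x \<partial>lborel)"
    using f g by (simp add: scales_lborel_def ennreal_mult mult.assoc)
qed

text \<open>Testing with the unit ball suffices, because its volume is positive and finite.\<close>

lemma scales_lborel_unique:
  fixes f :: "'e::euclidean_space \<Rightarrow> 'e"
  assumes "scales_lborel f c" "scales_lborel f d"
  shows "c = d"
proof -
  define F where "F = (indicator (cball 0 1) :: 'e \<Rightarrow> ennreal)"
  define I where "I = (\<integral>\<^sup>+x. F (f x) \<partial>lborel)"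
  have [measurable]: "F \<in> borel_measurable borel"
    unfolding F_def by (rule borel_measurable_indicator) simp
  have V: "(\<integral>\<^sup>+x. F x \<partial>lborel) = ennreal (unit_ball_vol DIM('e))"
    unfolding F_def by (simp add: emeasure_cball)
  have c: "ennreal c * I = ennreal (unit_ball_vol DIM('e))"
    and d: "ennreal d * I = ennreal (unit_ball_vol DIM('e))"
    using assms by (simp_all add: scales_lborel_def I_def V)
  have pos: "unit_ball_vol (real DIM('e)) > 0" by simp
  have "I \<noteq> 0" using c pos by (auto simp: ennreal_eq_0_iff simp del: unit_ball_vol_pos)
  moreover have "I \<noteq> \<top>"
  proof
    assume "I = \<top>"
    with c have "ennreal (unit_ball_vol DIM('e)) \<in> {0, \<top>}"
      by (cases "ennreal c = 0") (auto simp: ennreal_mult_top)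
    with pos show False by (simp add: ennreal_eq_0_iff del: unit_ball_vol_pos)
  qed
  moreover have "I * ennreal c = I * ennreal d" using c d by (simp add: mult.commute)
  ultimately show ?thesis
    using assms by (auto simp: ennreal_mult_cancel_left scales_lborel_def)
qed

lemma scales_lborel_unitary:
  fixes Q :: "'a::{real_normed_div_algebra, euclidean_space}^'n^'n"
  assumes "ctranspose Q ** Q = mat 1"
  shows "scales_lborel (\<lambda>Z :: 'a^'m^'n. Q ** Z) 1"
  using nn_integral_block_lebesgue_unitary[OF assms, of UNIV _ "UNIV :: 'm set"]
  by (simp add: scales_lborel_def block_lebesgue_UNIV linear_borel_measurable[OF linear_matrix_mul_left])

text \<open>The exponent counts the real components in a row of \<open>Z\<close>; in row
  \<open>i\<close> each of them is scaled by \<open>l i\<close>.\<close>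

lemma scales_lborel_diag:
  assumes l: "\<And>i. l i > 0"
  shows "scales_lborel (\<lambda>Z :: 'a::{real_normed_div_algebra, euclidean_space}^'m^'n. diag_mat (\<lambda>i. of_real (l i)) ** Z)
    ((\<Prod>i\<in>UNIV. l i) ^ (CARD('m) * DIM('a)))"
  unfolding scales_lborel_def
proof (intro conjI ballI)
  let ?D = "\<lambda>Z :: 'a^'m^'n. diag_mat (\<lambda>i. of_real (l i)) ** Z"
  let ?I = "UNIV \<times> UNIV \<times> Basis :: ('n \<times> 'm \<times> 'a) set"
  show "?D \<in> borel_measurable borel"
    by (rule linear_borel_measurable[OF linear_matrix_mul_left])
  show "0 \<le> (\<Prod>i\<in>UNIV. l i) ^ (CARD('m) * DIM('a))"
    using l by (intro zero_le_power prod_nonneg) (simp add: less_imp_le)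
  fix F :: "'a^'m^'n \<Rightarrow> ennreal" assume F: "F \<in> borel_measurable borel"
  have "?D (unit_mat p) = l (fst p) *\<^sub>R unit_mat p" for p
    by (cases p) (simp add: vec_eq_iff diag_mat_mult_nth unit_mat_nth of_real_def)
  then have eq: "(\<integral>\<^sup>+Z. F (?D Z) \<partial>lborel) = (\<integral>\<^sup>+Z. F Z \<partial>span_lebesgue ?I (\<lambda>p. l (fst p) *\<^sub>R unit_mat p))"
    using nn_integral_span_lebesgue_linear[OF linear_matrix_mul_left F, of ?I unit_mat]
    by (simp add: o_def flip: block_lebesgue_UNIV block_lebesgue_def)
  have "(\<Prod>p\<in>?I. \<bar>l (fst p)\<bar>) = (\<Prod>i\<in>UNIV. l i) ^ (CARD('m) * DIM('a))"
  proof -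
    have "(\<Prod>p\<in>?I. \<bar>l (fst p)\<bar>) = (\<Prod>i\<in>UNIV. \<Prod>q\<in>(UNIV :: 'm set) \<times> (Basis :: 'a set). l i)"
      using l by (subst prod.cartesian_product) (simp add: case_prod_beta less_imp_le)
    then show ?thesis
      by (simp add: prod_power_distrib[symmetric] card_cartesian_product)
  qed
  moreover have "l i \<noteq> 0" for i
    using l[of i] by simp
  ultimately show "ennreal ((\<Prod>i\<in>UNIV. l i) ^ (CARD('m) * DIM('a))) * (\<integral>\<^sup>+Z. F (?D Z) \<partial>lborel) = (\<integral>\<^sup>+Z. F Z \<partial>lborel)"
    unfolding eq using nn_integral_span_lebesgue_scale[OF _ _ F, of ?I "\<lambda>p. l (fst p)" unit_mat]
    by (simp flip: block_lebesgue_UNIV block_lebesgue_def)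
qed

text \<open>\<open>hdet\<close> is defined through a choice of eigenvalues; here it is tied to a
  quantity determined by the action of \<open>A\<close>. Identities between determinants are later
  obtained by comparing Jacobians and taking roots.\<close>

lemma scales_lborel_pos_def:
  fixes A :: "'a::{real_normed_div_algebra, euclidean_space}^'n^'n"
  assumes "pos_def A"
  shows "scales_lborel (\<lambda>Z :: 'a^'m^'n. A ** Z) (hdet A ^ (CARD('m) * DIM('a)))"
proof -
  obtain W where W: "ctranspose W ** W = mat 1" "W ** ctranspose W = mat 1"
    "A = W ** diag_mat (\<lambda>i. of_real (eigvals A $ i)) ** ctranspose W" "\<And>i. eigvals A $ i > 0"
    using pos_def_spectrum[OF assms] by blast
  have "scales_lborel (\<lambda>Z :: 'a^'m^'n. W ** (diag_mat (\<lambda>i. of_real (eigvals A $ i)) ** (ctranspose W ** Z)))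
      (1 * ((\<Prod>i\<in>UNIV. eigvals A $ i) ^ (CARD('m) * DIM('a)) * 1))"
    by (rule scales_lborel_compose[OF scales_lborel_unitary[OF W(1)]
          scales_lborel_compose[OF scales_lborel_diag scales_lborel_unitary]]) (simp_all add: W(1,2,4))
  moreover have "W ** (diag_mat (\<lambda>i. of_real (eigvals A $ i)) ** (ctranspose W ** Z)) = A ** Z" for Z :: "'a^'m^'n"
    using arg_cong[OF W(3), of "\<lambda>B. B ** Z"] by (simp only: matrix_mul_assoc)
  ultimately show ?thesis by (simp add: hdet_def)
qed

text \<open>Apart from the diagonal, \<open>L\<close> has entries only in rows of \<open>R\<close>
  and columns outside \<open>R\<close>. With the rows of \<open>Z\<close> outside \<open>R\<close>
  held fixed, its rows in \<open>R\<close> are merely translated.\<close>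

lemma scales_lborel_shear:
  fixes L :: "'a::{real_normed_div_algebra, euclidean_space}^'n^'n"
  assumes L: "\<And>i j. i \<notin> R \<or> j \<in> R \<Longrightarrow> L $ i $ j = (if i = j then 1 else 0)"
  shows "scales_lborel (\<lambda>Z :: 'a^'m^'n. L ** Z) 1"
  unfolding scales_lborel_def
proof (intro conjI ballI)
  show "(\<lambda>Z :: 'a^'m^'n. L ** Z) \<in> borel_measurable borel"
    by (rule linear_borel_measurable[OF linear_matrix_mul_left])
  fix F :: "'a^'m^'n \<Rightarrow> ennreal" assume [measurable]: "F \<in> borel_measurable borel"
  let ?I = "\<lambda>R. R \<times> UNIV \<times> Basis :: ('n \<times> 'm \<times> 'a) set"
  have "?I (- R) \<union> ?I R = ?I UNIV" by auto
  then have lb: "(\<integral>\<^sup>+Z. G Z \<partial>lborel) = (\<integral>\<^sup>+X. \<integral>\<^sup>+Y. G (X + Y) \<partial>span_lebesgue (?I R) unit_mat \<partial>span_lebesgue (?I (- R)) unit_mat)"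
    if "G \<in> borel_measurable borel" for G :: "'a^'m^'n \<Rightarrow> ennreal"
    using nn_integral_span_lebesgue_Un[of "?I (- R)" "?I R" G unit_mat] that
    by (auto simp flip: block_lebesgue_UNIV simp: block_lebesgue_def)
  have inner: "(\<integral>\<^sup>+Y. F (L ** (X + Y)) \<partial>span_lebesgue (?I R) unit_mat) = (\<integral>\<^sup>+Y. F (X + Y) \<partial>span_lebesgue (?I R) unit_mat)" for X :: "'a^'m^'n"
  proof -
    have "(\<integral>\<^sup>+Y. F (L ** (X + Y)) \<partial>span_lebesgue (?I R) unit_mat)
        = (\<integral>\<^sup>+Y. F (X + (Y + (L ** X - X))) \<partial>span_lebesgue (?I R) unit_mat)"
    proof (rule nn_integral_span_lebesgue_cong)
      fix Y :: "'a^'m^'n" assume "Y \<in> span (unit_mat ` ?I R)"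
      then have Y: "Y $ i $ j = 0" if "i \<notin> R" for i j
        using that by (auto simp: in_span_unit_mat_iff)
      have "L $ i $ q * Y $ q $ j = (if i = q then Y $ q $ j else 0)" for i q j
        by (cases "q \<in> R") (simp_all add: L Y)
      then have "(L ** Y) $ i $ j = Y $ i $ j" for i j
        by (simp add: matrix_mul_nth)
      then have "L ** Y = Y" by (simp add: vec_eq_iff)
      then have "L ** (X + Y) = X + (Y + (L ** X - X))"
        by (simp add: matrix_add_ldistrib')
      then show "F (L ** (X + Y)) = F (X + (Y + (L ** X - X)))"
        by (rule arg_cong)
    qed simp_all
    also have "\<dots> = (\<integral>\<^sup>+Y. F (X + Y) \<partial>span_lebesgue (?I R) unit_mat)"
    proof (rule nn_integral_span_lebesgue_translate)
      have "(L ** X) $ i $ j = X $ i $ j" if "i \<notin> R" for i j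
        using that by (simp add: matrix_mul_nth L if_distrib[of "\<lambda>x. x * _"] cong: if_cong)
      then show "L ** X - X \<in> span (unit_mat ` ?I R)"
        by (simp add: in_span_unit_mat_iff)
    qed simp_all
    finally show ?thesis .
  qed
  show "ennreal 1 * (\<integral>\<^sup>+Z. F (L ** Z) \<partial>lborel) = (\<integral>\<^sup>+Z. F Z \<partial>lborel)"
    by (simp add: lb inner)
qed simp

section \<open>Schur complements\<close>

lemma hermitian_nth: "hermitian S \<Longrightarrow> conjugate (S $ i $ j) = S $ j $ i"
  unfolding hermitian_def by (metis ctranspose_nth)

lemma hermitian_diag_real: "hermitian S \<Longrightarrow> S $ i $ i = of_real (re_part (S $ i $ i))"
  using hermitian_nth[of S i i] conjugate_eq_self_iff by blast

lemma hermitianI: "(\<And>i j. conjugate (S $ i $ j) = S $ j $ i) \<Longrightarrow> hermitian S"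
  by (simp add: hermitian_def vec_eq_iff)

lemma pos_def_congruence:
  fixes A B :: "'a::{real_normed_div_algebra, euclidean_space}^'m^'m"
  assumes B: "\<And>x. B *v x = 0 \<Longrightarrow> x = 0" and A: "hermitian A"
  shows "pos_def (ctranspose B ** A ** B) \<longleftrightarrow> pos_def A"
proof -
  have form: "x \<bullet> ((ctranspose B ** A ** B) *v x) = (B *v x) \<bullet> (A *v (B *v x))" for x
  proof -
    have "(B *v x) \<bullet> (A *v (B *v x)) = x \<bullet> (ctranspose B *v (A *v (B *v x)))"
      by (rule inner_matrix_vector_mult)
    then show ?thesis by (simp only: matrix_vector_mul_assoc matrix_mul_assoc)
  qed
  have "inj ((*v) B)"
    using B by (simp add: linear_injective_0[OF linear_matrix_vector_mult_left])
  then have surj: "surj ((*v) B)"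
    using linear_injective_imp_surjective[OF linear_matrix_vector_mult_left, of B] by simp
  show ?thesis
  proof
    assume pd: "pos_def (ctranspose B ** A ** B)"
    have "0 < y \<bullet> (A *v y)" if "y \<noteq> 0" for y
    proof -
      obtain x where x: "y = B *v x" using surj by (metis surjD)
      with that have "x \<noteq> 0" by auto
      with pd show ?thesis by (simp add: pos_def_iff form x)
    qed
    with A show "pos_def A" by (simp add: pos_def_iff)
  next
    assume "pos_def A"
    then show "pos_def (ctranspose B ** A ** B)"
      using hermitian_mult[OF A, of B] B by (auto simp: pos_def_iff form)
  qed
qed

text \<open>The pivot row and column are set to \<open>0\<close> instead of being deleted, which
  keeps the type. For Hermitian \<open>S\<close> the pivot is real, so dividing by its real part is
  dividing by the pivot.\<close>

definition schur_complement :: "'m \<Rightarrow> 'a::{real_normed_div_algebra, euclidean_space}^'m^'m \<Rightarrow> 'a^'m^'m"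
  where "schur_complement k S = (\<chi> i j. if i = k \<or> j = k then 0
    else S $ i $ j - (1 / re_part (S $ k $ k)) *\<^sub>R (S $ i $ k * S $ k $ j))"

lemma schur_complement_nth:
  "schur_complement k S $ i $ j = (if i = k \<or> j = k then 0
    else S $ i $ j - (1 / re_part (S $ k $ k)) *\<^sub>R (S $ i $ k * S $ k $ j))"
  by (simp add: schur_complement_def)

lemma hermitian_schur_complement: "hermitian S \<Longrightarrow> hermitian (schur_complement k S)"
  by (rule hermitianI) (simp add: schur_complement_nth conjugate_mult hermitian_nth)

text \<open>The identity matrix outside the index set \<open>J\<close>: adding it to a matrix supported on
  \<open>J \<times> J\<close> turns statements about the principal submatrix into statements about a full matrix.\<close>

definition id_off :: "'m set \<Rightarrow> 'a::{real_normed_div_algebra, euclidean_space}^'m^'m"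
  where "id_off J = diag_mat (\<lambda>i. if i \<in> J then 0 else 1)"

lemma id_off_nth: "id_off J $ i $ j = (if i = j \<and> i \<notin> J then 1 else 0)"
  by (simp add: id_off_def diag_mat_def)

definition supported :: "'m set \<Rightarrow> 'a::{real_normed_div_algebra, euclidean_space}^'m^'m \<Rightarrow> bool"
  where "supported J S \<longleftrightarrow> (\<forall>i j. i \<notin> J \<or> j \<notin> J \<longrightarrow> S $ i $ j = 0)"

lemma supported_schur_complement:
  "supported J S \<Longrightarrow> supported (J - {k}) (schur_complement k S)"
  by (auto simp: supported_def schur_complement_nth)

lemma hermitian_id_off: "hermitian S \<Longrightarrow> hermitian (S + id_off J)"
  by (rule hermitianI) (auto simp: hermitian_nth id_off_nth)

text \<open>One step of a block Cholesky factorization. The factor is split into a diagonal matrix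
  \<open>E\<close>, carrying the root of the pivot, and a shear \<open>L\<close>, whose row
  \<open>k\<close> carries \<open>S $ k $ j\<close> divided by \<open>t\<close>, because the
  Jacobian of each is known. Position \<open>(k, k)\<close> of the middle factor is
  \<open>1\<close>: it comes from \<open>id_off (J - {k})\<close>.\<close>

lemma schur_factorization:
  fixes S :: "'a::{real_normed_div_algebra, euclidean_space}^'m^'m"
  assumes S: "hermitian S" and k: "k \<in> J" and supp: "supported J S"
    and t: "t = re_part (S $ k $ k)" "t > 0"
  obtains E L where
    "S + id_off J = ctranspose (E ** L) ** (schur_complement k S + id_off (J - {k})) ** (E ** L)"
    "E = diag_mat (\<lambda>i. of_real (if i = k then sqrt t else 1))"
    "\<And>i j. i \<noteq> k \<or> j = k \<Longrightarrow> L $ i $ j = (if i = j then 1 else 0)"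
proof -
  define e where "e = (\<lambda>i. if i = k then sqrt t else 1)"
  define E :: "'a^'m^'m" where "E = diag_mat (\<lambda>i. of_real (e i))"
  define L :: "'a^'m^'m" where "L = (\<chi> i j. if i = k \<and> j \<noteq> k then (1 / t) *\<^sub>R S $ k $ j else if i = j then 1 else 0)"
  define C where "C = schur_complement k S + id_off (J - {k})"
  define M where "M = E ** C ** E"
  have Skk: "S $ k $ k = of_real t"
    using hermitian_diag_real[OF S] t by simp
  have C: "C $ i $ j = (if i = k \<or> j = k then (if i = j then 1 else 0)
      else S $ i $ j + id_off J $ i $ j - (1 / t) *\<^sub>R (S $ i $ k * S $ k $ j))" for i j
    using k by (auto simp: C_def schur_complement_nth id_off_nth t(1))
  have M: "M $ i $ j = (if i = k \<or> j = k then (if i = j then of_real t else 0) else C $ i $ j)" for i j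
    using t(2) by (auto simp: M_def E_def mult_diag_mat_nth diag_mat_mult_nth C e_def simp flip: of_real_mult)
  have L: "L $ i $ j = (if i = k \<and> j \<noteq> k then (1 / t) *\<^sub>R S $ k $ j else if i = j then 1 else 0)" for i j
    by (simp add: L_def)
  have prod_ML: "(M ** L) $ i $ j = (if i = k then S $ k $ j else if j = k then 0 else C $ i $ j)" for i j
  proof (cases "i = k")
    case True
    have "M $ k $ q * L $ q $ j = (if q = k then of_real t * L $ k $ j else 0)" for q
      by (simp add: M)
    then have "(M ** L) $ k $ j = of_real t * L $ k $ j"
      by (simp add: matrix_mul_nth)
    then show ?thesis
      using t(2) True by (simp add: L_def Skk of_real_def)
  next
    case False
    have "M $ i $ q * L $ q $ j = (if q = j then (if j = k then 0 else C $ i $ j) else 0)" for q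
      using False by (auto simp: M L_def)
    then have "(M ** L) $ i $ j = (if j = k then 0 else C $ i $ j)"
      by (simp add: matrix_mul_nth)
    with False show ?thesis by simp
  qed
  have "(ctranspose L ** (M ** L)) $ p $ j = (S + id_off J) $ p $ j" for p j
  proof (cases "p = k")
    case True
    have "conjugate (L $ q $ k) * (M ** L) $ q $ j = (if q = k then S $ k $ j else 0)" for q
      by (simp add: L prod_ML)
    then have "(ctranspose L ** (M ** L)) $ k $ j = S $ k $ j"
      by (simp add: matrix_mul_nth)
    with True show ?thesis using k by (simp add: id_off_nth)
  next
    case False
    have "conjugate (L $ q $ p) * (M ** L) $ q $ j = (if q = k then (1 / t) *\<^sub>R (S $ p $ k * S $ k $ j) else 0)
        + (if q = p then (if j = k then 0 else C $ p $ j) else 0)" for q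
      using False by (auto simp: L prod_ML hermitian_nth[OF S])
    then have "(ctranspose L ** (M ** L)) $ p $ j = (1 / t) *\<^sub>R (S $ p $ k * S $ k $ j) + (if j = k then 0 else C $ p $ j)"
      by (simp add: matrix_mul_nth sum.distrib)
    then show ?thesis
      using False t(2) k by (auto simp: C Skk of_real_def id_off_nth)
  qed
  then have "S + id_off J = ctranspose L ** (M ** L)"
    by (simp add: vec_eq_iff)
  also have "\<dots> = ctranspose (E ** L) ** C ** (E ** L)"
    by (simp add: M_def ctranspose_mult E_def ctranspose_diag_mat matrix_mul_assoc)
  finally have "S + id_off J = ctranspose (E ** L) ** C ** (E ** L)" .
  then show ?thesis
    by (rule that[unfolded C_def[symmetric]]) (auto simp: E_def e_def L_def)
qed

lemma schur_factor_inj: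
  fixes L :: "'a::{real_normed_div_algebra, euclidean_space}^'m^'m"
  assumes t: "t > 0" and E: "E = diag_mat (\<lambda>i. of_real (if i = k then sqrt t else 1))"
    and L: "\<And>i j. i \<noteq> k \<or> j = k \<Longrightarrow> L $ i $ j = (if i = j then 1 else 0)"
    and x: "(E ** L) *v x = 0"
  shows "x = 0"
proof -
  have Lx: "(L *v x) $ i = 0" for i
  proof -
    have "(E *v (L *v x)) $ i = 0" using x by (simp add: matrix_vector_mul_assoc)
    then show ?thesis using t by (simp add: E diag_mat_vector_nth split: if_splits)
  qed
  have x0: "x $ i = 0" if "i \<noteq> k" for i
    using Lx[of i] that by (simp add: matrix_vector_mult_def L if_distrib[of "\<lambda>x. x * _"] cong: if_cong)
  have "L $ k $ j * x $ j = (if j = k then x $ k else 0)" for j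
    by (simp add: L x0)
  then have "x $ k = 0"
    using Lx[of k] by (simp add: matrix_vector_mult_def)
  with x0 have "x $ i = 0" for i by (cases "i = k") auto
  then show ?thesis by (simp add: vec_eq_iff)
qed

lemma pos_def_diag_pos:
  fixes S :: "'a::{real_normed_div_algebra, euclidean_space}^'m^'m"
  assumes "pos_def (S + id_off J)" "k \<in> J"
  shows "re_part (S $ k $ k) > 0"
proof -
  have "axis k 1 \<noteq> (0 :: 'a^'m)" by (simp add: axis_eq_0_iff)
  with assms have "0 < axis k 1 \<bullet> ((S + id_off J) *v axis k 1)" by (simp add: pos_def_iff)
  also have "\<dots> = ((S + id_off J) *v axis k 1) $ k \<bullet> 1"
    by (simp add: inner_axis' inner_commute)
  also have "((S + id_off J) *v axis k 1) $ k = S $ k $ k"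
    using assms(2) by (simp add: matrix_vector_mult_def axis_def id_off_nth if_distrib[of "\<lambda>x. _ * x"] cong: if_cong)
  finally show ?thesis by (simp add: re_part_def)
qed

text \<open>With a positive pivot, the factorization is a congruence by an injective matrix, which
  preserves positive definiteness in both directions. A nonpositive pivot excludes it.\<close>

lemma pos_def_schur:
  fixes S :: "'a::{real_normed_div_algebra, euclidean_space}^'m^'m"
  assumes "hermitian S" "k \<in> J" "supported J S"
  shows "pos_def (S + id_off J) \<longleftrightarrow>
    re_part (S $ k $ k) > 0 \<and> pos_def (schur_complement k S + id_off (J - {k}))"
proof (cases "re_part (S $ k $ k) > 0")
  case True
  obtain E L where EL:
    "S + id_off J = ctranspose (E ** L) ** (schur_complement k S + id_off (J - {k})) ** (E ** L)"
    "E = diag_mat (\<lambda>i. of_real (if i = k then sqrt (re_part (S $ k $ k)) else 1))"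
    "\<And>i j. i \<noteq> k \<or> j = k \<Longrightarrow> L $ i $ j = (if i = j then 1 else 0)"
    using schur_factorization[OF assms refl True] by blast
  have "pos_def (ctranspose (E ** L) ** (schur_complement k S + id_off (J - {k})) ** (E ** L))
      \<longleftrightarrow> pos_def (schur_complement k S + id_off (J - {k}))"
    using schur_factor_inj[OF True EL(2,3)]
    by (intro pos_def_congruence hermitian_id_off hermitian_schur_complement assms)
  with True show ?thesis by (simp add: EL(1))
next
  case False
  then show ?thesis using pos_def_diag_pos[OF _ assms(2)] by blast
qed

text \<open>Both sides of the factorization act on square matrices by left multiplication. The two
  shears have Jacobian \<open>1\<close> and the two copies of \<open>E\<close> contribute the root
  of the pivot twice, so the claim holds after raising to the power
  \<open>CARD('m) * DIM('a)\<close>; positivity allows the root to be taken.\<close>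

lemma hdet_schur:
  fixes S :: "'a::{real_normed_div_algebra, euclidean_space}^'m^'m"
  assumes S: "hermitian S" "k \<in> J" "supported J S" and pd: "pos_def (S + id_off J)"
  shows "hdet (S + id_off J) = re_part (S $ k $ k) * hdet (schur_complement k S + id_off (J - {k}))"
proof -
  let ?t = "re_part (S $ k $ k)" and ?C = "schur_complement k S + id_off (J - {k})"
  let ?N = "CARD('m) * DIM('a)"
  have t: "?t > 0" and C: "pos_def ?C"
    using pos_def_schur[OF S] pd by auto
  obtain E L where EL: "S + id_off J = ctranspose (E ** L) ** ?C ** (E ** L)"
    "E = diag_mat (\<lambda>i. of_real (if i = k then sqrt ?t else 1))"
    "\<And>i j. i \<noteq> k \<or> j = k \<Longrightarrow> L $ i $ j = (if i = j then 1 else 0)"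
    using schur_factorization[OF S refl t] by blast
  have sE: "scales_lborel (\<lambda>Z :: 'a^'m^'m. E ** Z) (sqrt ?t ^ ?N)"
    using scales_lborel_diag[where 'm='m and 'a='a, of "\<lambda>i::'m. if i = k then sqrt ?t else 1"] t
    by (simp add: EL(2))
  have sL: "scales_lborel (\<lambda>Z :: 'a^'m^'m. L ** Z) 1"
    by (rule scales_lborel_shear[of "{k}"]) (simp add: EL(3))
  have sL': "scales_lborel (\<lambda>Z :: 'a^'m^'m. ctranspose L ** Z) 1"
    by (rule scales_lborel_shear[of "- {k}"]) (auto simp: EL(3))
  have "ctranspose E = E"
    by (simp add: EL(2) ctranspose_diag_mat)
  then have "(S + id_off J) ** Z = ctranspose L ** (E ** (?C ** (E ** (L ** Z))))" for Z :: "'a^'m^'m"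
    by (simp add: EL(1) ctranspose_mult matrix_mul_assoc)
  moreover have "scales_lborel (\<lambda>Z :: 'a^'m^'m. ctranspose L ** (E ** (?C ** (E ** (L ** Z)))))
      (1 * (sqrt ?t ^ ?N * (hdet ?C ^ ?N * (sqrt ?t ^ ?N * 1))))"
    by (rule scales_lborel_compose[OF sL' scales_lborel_compose[OF sE
          scales_lborel_compose[OF scales_lborel_pos_def[OF C] scales_lborel_compose[OF sE sL]]]])
  ultimately have "hdet (S + id_off J) ^ ?N = 1 * (sqrt ?t ^ ?N * (hdet ?C ^ ?N * (sqrt ?t ^ ?N * 1)))"
    using scales_lborel_pos_def[OF pd, where 'm='m] by (intro scales_lborel_unique) simp_all
  also have "\<dots> = (sqrt ?t * sqrt ?t * hdet ?C) ^ ?N"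
    by (simp only: power_mult_distrib mult_ac mult_1)
  finally have "hdet (S + id_off J) ^ ?N = (?t * hdet ?C) ^ ?N"
    using t by simp
  then show ?thesis
    using t hdet_pos[OF C] hdet_pos[OF pd] by (simp add: power_eq_iff_eq_base)
qed

section \<open>Powers of the determinant as Borel functions\<close>

lemma pos_def_mat_1: "pos_def (mat 1 :: 'a::{real_normed_div_algebra, euclidean_space}^'m^'m)"
  by (simp add: pos_def_iff hermitian_def)

text \<open>Which eigenvalues \<open>eigvals\<close> selects cannot be seen from its definition; the
  value is read off from the Jacobian of the identity map.\<close>

lemma hdet_mat_1: "hdet (mat 1 :: 'a::{real_normed_div_algebra, euclidean_space}^'m^'m) = 1"
proof -
  let ?N = "CARD('m) * DIM('a)"
  have "scales_lborel (\<lambda>Z :: 'a^'m^'m. mat 1 ** Z) (hdet (mat 1 :: 'a^'m^'m) ^ ?N)"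
    by (rule scales_lborel_pos_def[OF pos_def_mat_1])
  moreover have "scales_lborel (\<lambda>Z :: 'a^'m^'m. mat 1 ** Z) 1"
    by (simp add: scales_lborel_def)
  ultimately have "hdet (mat 1 :: 'a^'m^'m) ^ ?N = 1 ^ ?N"
    using scales_lborel_unique by fastforce
  moreover have "hdet (mat 1 :: 'a^'m^'m) > 0"
    by (rule hdet_pos[OF pos_def_mat_1])
  ultimately show ?thesis
    by (subst (asm) power_eq_iff_eq_base) auto
qed

lemma borel_measurable_mat_nth [measurable (raw)]:
  fixes F :: "_ \<Rightarrow> 'a::{real_normed_div_algebra, euclidean_space}^'m^'n"
  assumes "F \<in> borel_measurable M"
  shows "(\<lambda>x. F x $ i $ j) \<in> borel_measurable M"
  using assms by (rule measurable_compose[OF _ linear_borel_measurable]) (simp add: linear_iff)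

lemma borel_measurable_matI:
  fixes F :: "_ \<Rightarrow> 'a::{real_normed_div_algebra, euclidean_space}^'m^'n"
  assumes "\<And>i j. (\<lambda>x. F x $ i $ j) \<in> borel_measurable M"
  shows "F \<in> borel_measurable M"
proof (rule borel_measurable_euclidean_space[THEN iffD2], intro ballI)
  fix b :: "'a^'m^'n"
  assume "b \<in> Basis"
  then obtain i j c where b: "b = axis i (axis j c)"
    by (auto simp: Basis_vec_def)
  have "(\<lambda>x. (F x $ i $ j) \<bullet> c) \<in> borel_measurable M"
    by (intro borel_measurable_inner assms borel_measurable_const)
  then show "(\<lambda>x. F x \<bullet> b) \<in> borel_measurable M"
    by (simp only: b inner_axis)
qed

lemma borel_measurable_re_part [measurable (raw)]:
  "F \<in> borel_measurable M \<Longrightarrow> (\<lambda>x. re_part (F x :: 'a::{real_normed_div_algebra, euclidean_space})) \<in> borel_measurable M"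
  unfolding re_part_def by (intro borel_measurable_inner borel_measurable_const)

lemma borel_measurable_schur_complement [measurable]:
  "(schur_complement k :: 'a::{real_normed_div_algebra, euclidean_space}^'m^'m \<Rightarrow> _) \<in> borel_measurable borel"
proof (rule borel_measurable_matI)
  fix i j :: 'm
  show "(\<lambda>S :: 'a^'m^'m. schur_complement k S $ i $ j) \<in> borel_measurable borel"
    by (cases "i = k \<or> j = k") (simp_all add: schur_complement_nth, measurable)
qed

lemma pred_hermitian [measurable]:
  "Measurable.pred borel (hermitian :: 'a::{real_normed_div_algebra, euclidean_space}^'m^'m \<Rightarrow> bool)"
  unfolding hermitian_def by measurable

lemma pred_supported [measurable]:
  "Measurable.pred borel (supported J :: 'a::{real_normed_div_algebra, euclidean_space}^'m^'m \<Rightarrow> bool)"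
proof -
  have "supported J = (\<lambda>S :: 'a^'m^'m. \<forall>i\<in>UNIV. \<forall>j\<in>UNIV. i \<notin> J \<or> j \<notin> J \<longrightarrow> S $ i $ j = 0)"
    by (auto simp: supported_def fun_eq_iff)
  then show ?thesis by simp
qed

text \<open>Cutting off outside the cone lets integrals run over all Hermitian matrices, and it
  makes the recursion \<open>pd_power_schur\<close> valid for every \<open>S\<close>.\<close>

definition pd_power :: "real \<Rightarrow> 'm set \<Rightarrow> 'a::{real_normed_div_algebra, euclidean_space}^'m^'m \<Rightarrow> ennreal"
  where "pd_power e J S = (if hermitian S \<and> supported J S \<and> pos_def (S + id_off J)
    then ennreal (hdet (S + id_off J) powr e) else 0)"

lemma pd_power_empty:
  "pd_power e {} (S :: 'a::{real_normed_div_algebra, euclidean_space}^'m^'m) = (if S = 0 then 1 else 0)"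
proof -
  have "supported {} S \<longleftrightarrow> S = 0" by (simp add: supported_def vec_eq_iff)
  moreover have "hermitian (0 :: 'a^'m^'m)" by (rule hermitianI) simp
  ultimately show ?thesis
    by (simp add: pd_power_def id_off_def pos_def_mat_1 hdet_mat_1)
qed

lemma pd_power_schur:
  fixes S :: "'a::{real_normed_div_algebra, euclidean_space}^'m^'m"
  assumes "k \<in> J"
  shows "pd_power e J S = (if hermitian S \<and> supported J S \<and> re_part (S $ k $ k) > 0
    then ennreal (re_part (S $ k $ k) powr e) * pd_power e (J - {k}) (schur_complement k S) else 0)"
proof (cases "hermitian S \<and> supported J S \<and> re_part (S $ k $ k) > 0")
  case True
  then have S: "hermitian S" "k \<in> J" "supported J S" and t: "re_part (S $ k $ k) > 0"
    using assms by auto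
  show ?thesis
  proof (cases "pos_def (S + id_off J)")
    case pd: True
    then have "pos_def (schur_complement k S + id_off (J - {k}))"
      using pos_def_schur[OF S] by simp
    then show ?thesis
      using True pd hdet_schur[OF S pd] hermitian_schur_complement[OF S(1)]
        supported_schur_complement[OF S(3)] hdet_pos
      by (simp add: pd_power_def powr_mult less_imp_le ennreal_mult)
  next
    case False
    then show ?thesis
      using True pos_def_schur[OF S] by (simp add: pd_power_def)
  qed
next
  case False
  then show ?thesis using pos_def_diag_pos[OF _ assms] by (auto simp: pd_power_def)
qed

text \<open>A product of eigenvalues picked by choice does not show its measurability. The recursion
  over Schur complements expresses it through matrix entries.\<close>

lemma borel_measurable_pd_power [measurable]:
  fixes J :: "'m::finite set"
  shows "(pd_power e J :: 'a::{real_normed_div_algebra, euclidean_space}^'m^'m \<Rightarrow> _) \<in> borel_measurable borel"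
  using finite[of J]
proof (induction J rule: finite_psubset_induct)
  case (psubset J)
  show ?case
  proof (cases "J = {}")
    case True
    have "(\<lambda>S :: 'a^'m^'m. (if S = 0 then 1 else 0) :: ennreal) \<in> borel_measurable borel"
      by measurable
    then show ?thesis
      unfolding True pd_power_empty[abs_def] .
  next
    case False
    then obtain k where k: "k \<in> J" by auto
    have [measurable]: "(pd_power e (J - {k}) :: 'a^'m^'m \<Rightarrow> _) \<in> borel_measurable borel"
      by (rule psubset.IH) (use k in auto)
    show ?thesis
      unfolding pd_power_schur[OF k, abs_def] by measurable
  qed
qed

section \<open>Measurable Cholesky factors\<close>

definition schur_row :: "'n \<Rightarrow> 'm \<Rightarrow> 'a::{real_normed_div_algebra, euclidean_space}^'m^'m \<Rightarrow> 'a^'m^'n"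
  where "schur_row l k S = (\<chi> i j. if i = l then (1 / sqrt (re_part (S $ k $ k))) *\<^sub>R S $ k $ j else 0)"

lemma schur_row_nth: "schur_row l k S $ i $ j =
    (if i = l then (1 / sqrt (re_part (S $ k $ k))) *\<^sub>R S $ k $ j else 0)"
  by (simp add: schur_row_def)

lemma borel_measurable_schur_row [measurable]:
  "(schur_row l k :: 'a::{real_normed_div_algebra, euclidean_space}^'m^'m \<Rightarrow> 'a^'m^'n) \<in> borel_measurable borel"
proof (rule borel_measurable_matI)
  show "(\<lambda>S :: 'a^'m^'m. (schur_row l k S :: 'a^'m^'n) $ i $ j) \<in> borel_measurable borel" for i j
    by (cases "i = l") (simp_all add: schur_row_nth, measurable)
qed

text \<open>The Gram matrix of the Cholesky row restores row and column \<open>k\<close> and,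
  elsewhere, the rank-one term that the Schur complement subtracts.\<close>

lemma gram_schur_row:
  fixes S :: "'a::{real_normed_div_algebra, euclidean_space}^'m^'m"
  assumes S: "hermitian S" and t: "re_part (S $ k $ k) > 0"
  shows "ctranspose (schur_row l k S :: 'a^'m^'n) ** schur_row l k S + schur_complement k S = S"
proof -
  let ?t = "re_part (S $ k $ k)" and ?R = "schur_row l k S :: 'a^'m^'n"
  have Skk: "S $ k $ k = of_real ?t" by (rule hermitian_diag_real[OF S])
  have RR: "(ctranspose ?R ** ?R) $ i $ j = (1 / ?t) *\<^sub>R (S $ i $ k * S $ k $ j)" for i j
  proof -
    have "conjugate (?R $ q $ i) * ?R $ q $ j = (if q = l then (1 / ?t) *\<^sub>R (S $ i $ k * S $ k $ j) else 0)" for q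
      using t by (simp add: schur_row_nth hermitian_nth[OF S])
    then show ?thesis by (simp add: matrix_mul_nth)
  qed
  have row: "(1 / ?t) *\<^sub>R (S $ k $ k * S $ k $ j) = S $ k $ j" for j
    using t by (subst Skk) (simp add: of_real_def)
  have col: "(1 / ?t) *\<^sub>R (S $ i $ k * S $ k $ k) = S $ i $ k" for i
    using t by (subst (2) Skk) (simp add: of_real_def)
  have "(ctranspose ?R ** ?R + schur_complement k S) $ i $ j = S $ i $ j" for i j
    unfolding vector_add_component RR schur_complement_nth
    by (cases "i = k"; cases "j = k") (simp_all add: row col del: scaleR_eq_iff)
  then show ?thesis by (simp add: vec_eq_iff)
qed

lemma gram_add_disjoint_rows:
  fixes A B :: "'a::{real_normed_div_algebra, euclidean_space}^'m^'n"
  assumes "\<And>i j. i \<notin> K \<Longrightarrow> A $ i $ j = 0" "\<And>i j. i \<in> K \<Longrightarrow> B $ i $ j = 0"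
  shows "ctranspose (A + B) ** (A + B) = ctranspose A ** A + ctranspose B ** B"
proof -
  have "conjugate (A $ q $ i) * B $ q $ j = 0" "conjugate (B $ q $ i) * A $ q $ j = 0" for q i j
    by (cases "q \<in> K"; simp add: assms)+
  then have "ctranspose A ** B = 0" "ctranspose B ** A = 0"
    by (simp_all only: vec_eq_iff matrix_mul_nth ctranspose_nth zero_index sum.neutral_const simp_thms)
  then show ?thesis
    by (simp add: ctranspose_add matrix_add_rdistrib' matrix_add_ldistrib')
qed

text \<open>A generalized Cholesky factorization, obtained by peeling off one Schur complement at a time.\<close>

lemma exists_measurable_gram_root:
  fixes J :: "'m::finite set" and K :: "'n::finite set"
  assumes "card J \<le> card K"
  shows "\<exists>c :: 'a::{real_normed_div_algebra, euclidean_space}^'m^'m \<Rightarrow> 'a^'m^'n.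
    c \<in> borel_measurable borel \<and> (\<forall>S i j. i \<notin> K \<longrightarrow> c S $ i $ j = 0) \<and>
    (\<forall>S. hermitian S \<longrightarrow> supported J S \<longrightarrow> pos_def (S + id_off J) \<longrightarrow> ctranspose (c S) ** c S = S)"
  using finite[of J] assms
proof (induction J arbitrary: K rule: finite_psubset_induct)
  case (psubset J)
  show ?case
  proof (cases "J = {}")
    case True
    have "ctranspose (0 :: 'a^'m^'n) ** 0 = S" if "supported J S" for S
      using that True by (simp add: supported_def vec_eq_iff matrix_mul_nth)
    then show ?thesis by (intro exI[of _ "\<lambda>_. 0"]) simp
  next
    case False
    then obtain k where k: "k \<in> J" by auto
    with psubset.prems psubset.hyps have "K \<noteq> {}"
      by (auto simp: card_0_eq)
    then obtain l where l: "l \<in> K" by auto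
    have "card (J - {k}) \<le> card (K - {l})"
      using k l psubset.prems by (simp add: card_Diff_singleton)
    then have "\<exists>c :: 'a^'m^'m \<Rightarrow> 'a^'m^'n.
      c \<in> borel_measurable borel \<and> (\<forall>S i j. i \<notin> K - {l} \<longrightarrow> c S $ i $ j = 0) \<and>
      (\<forall>S. hermitian S \<longrightarrow> supported (J - {k}) S \<longrightarrow> pos_def (S + id_off (J - {k})) \<longrightarrow> ctranspose (c S) ** c S = S)"
      by (intro psubset.IH) (use k in auto)
    then obtain c :: "'a^'m^'m \<Rightarrow> 'a^'m^'n" where [measurable]: "c \<in> borel_measurable borel"
      and supp: "\<And>S i j. i \<notin> K - {l} \<Longrightarrow> c S $ i $ j = 0"
      and c: "\<And>S. hermitian S \<Longrightarrow> supported (J - {k}) S \<Longrightarrow> pos_def (S + id_off (J - {k})) \<Longrightarrow> ctranspose (c S) ** c S = S"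
      by blast
    \<comment> \<open>The Cholesky row occupies row \<open>l\<close> and the recursive factor the
      rows \<open>K - {l}\<close>, so the Gram matrices of the two summands add.\<close>
    define c' where "c' S = schur_row l k S + c (schur_complement k S)" for S
    have "c' \<in> borel_measurable borel"
      unfolding c'_def by measurable
    moreover have "c' S $ i $ j = 0" if "i \<notin> K" for S i j
      using that l supp[of i] by (auto simp: c'_def schur_row_nth)
    moreover have "ctranspose (c' S) ** c' S = S"
      if S: "hermitian S" "supported J S" "pos_def (S + id_off J)" for S
    proof -
      have pd: "re_part (S $ k $ k) > 0" "pos_def (schur_complement k S + id_off (J - {k}))"
        using pos_def_schur[OF S(1) k S(2)] S(3) by auto
      have "ctranspose (c' S) ** c' S = ctranspose (schur_row l k S :: 'a^'m^'n) ** schur_row l k S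
          + ctranspose (c (schur_complement k S)) ** c (schur_complement k S)"
        unfolding c'_def by (rule gram_add_disjoint_rows[of "{l}"]) (auto simp: schur_row_nth supp)
      also have "ctranspose (c (schur_complement k S)) ** c (schur_complement k S) = schur_complement k S"
        by (rule c) (use S pd in \<open>simp_all add: hermitian_schur_complement supported_schur_complement\<close>)
      finally show ?thesis
        by (simp add: gram_schur_row[OF S(1) pd(1)])
    qed
    ultimately show ?thesis by blast
  qed
qed

section \<open>Lebesgue measure on Hermitian matrices\<close>

definition herm_unit :: "'m \<Rightarrow> 'm \<Rightarrow> 'a \<Rightarrow> 'a::{real_normed_div_algebra, euclidean_space}^'m^'m"
  where "herm_unit i j a = unit_mat (i, j, a) + unit_mat (j, i, conjugate a)"

text \<open>On the diagonal \<open>herm_unit\<close> would enter the same position twice, hence the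
  separate case.\<close>

definition herm_basis :: "'m \<times> 'm \<times> 'a \<Rightarrow> 'a::{real_normed_div_algebra, euclidean_space}^'m^'m"
  where "herm_basis = (\<lambda>(i, j, u). if i = j then unit_mat (i, j, u) else herm_unit i j u)"

text \<open>Diagonal positions carry only the real unit \<open>1\<close>, positions above the
  diagonal all of \<open>Basis\<close>. These are the real components in the definition of Lebesgue
  measure on Hermitian matrices.\<close>

definition herm_index :: "'m::finite set \<Rightarrow> ('m \<times> 'm \<times> 'a::{real_normed_div_algebra, euclidean_space}) set"
  where "herm_index J = (\<lambda>i. (i, i, 1)) ` J \<union>
    (\<lambda>((i, j), u). (i, j, u)) ` ({(i, j). i \<in> J \<and> j \<in> J \<and> to_nat i < to_nat j} \<times> Basis)"

definition herm_lebesgue :: "'m::finite set \<Rightarrow> ('a::{real_normed_div_algebra, euclidean_space}^'m^'m) measure"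
  where "herm_lebesgue J = span_lebesgue (herm_index J) herm_basis"

lemma herm_unit_nth: "herm_unit i j a $ p $ q =
    (if p = i \<and> q = j then a else 0) + (if p = j \<and> q = i then conjugate a else 0)"
  by (simp add: herm_unit_def unit_mat_nth)

lemma herm_unit_swap: "herm_unit j i (conjugate a) = herm_unit i j a"
  by (simp add: herm_unit_def add.commute)

lemma linear_herm_unit:
  "linear (herm_unit i j :: _ \<Rightarrow> 'a::{real_normed_div_algebra, euclidean_space}^'m^'m)"
proof (rule linearI)
  show "herm_unit i j (a + b) = (herm_unit i j a + herm_unit i j b :: 'a^'m^'m)" for a b
    unfolding herm_unit_def conjugate_add linear_add[OF linear_unit_mat] by (simp only: add_ac)
  show "herm_unit i j (c *\<^sub>R a) = c *\<^sub>R (herm_unit i j a :: 'a^'m^'m)" for c a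
    unfolding herm_unit_def conjugate_scaleR linear_scale[OF linear_unit_mat] by (simp only: scaleR_add_right)
qed

lemma finite_herm_index [simp]: "finite (herm_index J)"
  by (simp add: herm_index_def)

lemma ctranspose_unit_mat: "ctranspose (unit_mat (i, j, a)) = unit_mat (j, i, conjugate a)"
  by (auto simp: vec_eq_iff unit_mat_nth)

text \<open>For the nontrivial direction, a Hermitian \<open>S\<close> is half of
  \<open>S + ctranspose S\<close>, and this is the sum of the matrices
  \<open>herm_unit i j (S $ i $ j)\<close>.\<close>

lemma herm_basis_in_span_iff:
  fixes S :: "'a::{real_normed_div_algebra, euclidean_space}^'m^'m"
  shows "S \<in> span (herm_basis ` herm_index J) \<longleftrightarrow> hermitian S \<and> supported J S"
proof
  have "subspace {S :: 'a^'m^'m. hermitian S \<and> supported J S}"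
    by (auto simp: subspace_def hermitian_def supported_def ctranspose_add ctranspose_scaleR
        linear_0[OF linear_ctranspose])
  moreover have "herm_basis ` herm_index J \<subseteq> {S :: 'a^'m^'m. hermitian S \<and> supported J S}"
  proof (intro image_subsetI)
    fix p :: "'m \<times> 'm \<times> 'a" assume "p \<in> herm_index J"
    then consider i where "p = (i, i, 1)" "i \<in> J"
      | i j u where "p = (i, j, u)" "i \<in> J" "j \<in> J" "i \<noteq> j"
      unfolding herm_index_def by force
    then show "herm_basis p \<in> {S :: 'a^'m^'m. hermitian S \<and> supported J S}"
    proof cases
      case 1
      then show ?thesis
        by (auto simp: herm_basis_def hermitian_def ctranspose_unit_mat supported_def unit_mat_nth)
    next
      case 2
      then show ?thesis
        by (auto simp: herm_basis_def hermitian_def ctranspose_unit_mat supported_def herm_unit_def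
            ctranspose_add add.commute unit_mat_nth)
    qed
  qed
  ultimately show "hermitian S \<and> supported J S" if "S \<in> span (herm_basis ` herm_index J)"
    using span_minimal that by blast
next
  assume S: "hermitian S \<and> supported J S"
  have less: "herm_unit i j a \<in> span (herm_basis ` herm_index J)"
    if "i \<in> J" "j \<in> J" "to_nat i < to_nat j" for i j and a :: 'a
  proof -
    have "herm_unit i j a = (\<Sum>u\<in>Basis. (a \<bullet> u) *\<^sub>R herm_unit i j u)"
      using linear_sum[OF linear_herm_unit, of i j "\<lambda>u. (a \<bullet> u) *\<^sub>R u" Basis]
      by (simp only: euclidean_representation linear_scale[OF linear_herm_unit])
    also have "\<dots> \<in> span (herm_basis ` herm_index J)"
    proof (intro span_sum span_scale span_base)
      fix u :: 'a assume "u \<in> Basis"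
      with that have "(i, j, u) \<in> herm_index J" by (force simp: herm_index_def)
      moreover have "herm_unit i j u = herm_basis (i, j, u)"
        using that by (auto simp: herm_basis_def)
      ultimately show "herm_unit i j u \<in> herm_basis ` herm_index J" by blast
    qed
    finally show ?thesis .
  qed
  have "herm_unit i j (S $ i $ j) \<in> span (herm_basis ` herm_index J)" for i j
  proof (cases "i \<in> J \<and> j \<in> J")
    case False
    with S have "S $ i $ j = 0" by (auto simp: supported_def)
    then show ?thesis by (simp add: linear_0[OF linear_herm_unit] span_zero)
  next
    case True
    consider "to_nat i < to_nat j" | "to_nat j < to_nat i" | "i = j"
      using linorder_less_linear[of "to_nat i" "to_nat j"] by (auto simp only: to_nat_split)
    then show ?thesis
    proof cases
      case 1
      with True less show ?thesis by blast
    next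
      case 2
      with True less[of j i "conjugate (S $ i $ j)"] show ?thesis
        by (simp add: herm_unit_swap)
    next
      case 3
      obtain r where r: "S $ i $ i = r *\<^sub>R 1"
        using S hermitian_diag_real[of S i] by (auto simp: of_real_def)
      have "herm_unit i i (r *\<^sub>R 1) = (2 * r) *\<^sub>R herm_basis (i, i, 1 :: 'a)"
        by (auto simp: vec_eq_iff herm_unit_nth herm_basis_def unit_mat_nth simp flip: scaleR_2)
      moreover have "(i, i, 1) \<in> herm_index J" using True by (force simp: herm_index_def)
      ultimately show ?thesis
        unfolding 3[symmetric] r by (simp only:) (intro span_scale span_base imageI)
    qed
  qed
  then have "(1 / 2) *\<^sub>R (\<Sum>i\<in>UNIV. \<Sum>j\<in>UNIV. herm_unit i j (S $ i $ j)) \<in> span (herm_basis ` herm_index J)"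
    by (intro span_scale span_sum)
  moreover have "(\<Sum>i\<in>UNIV. \<Sum>j\<in>UNIV. herm_unit i j (S $ i $ j)) = S + ctranspose S"
  proof -
    have "ctranspose S = ctranspose (\<Sum>i\<in>UNIV. \<Sum>j\<in>UNIV. unit_mat (i, j, S $ i $ j))"
      by (simp only: mat_eq_sum_unit_mat[symmetric])
    also have "\<dots> = (\<Sum>i\<in>UNIV. \<Sum>j\<in>UNIV. unit_mat (j, i, conjugate (S $ i $ j)))"
      by (simp only: linear_sum[OF linear_ctranspose] ctranspose_unit_mat)
    finally have "ctranspose S = (\<Sum>i\<in>UNIV. \<Sum>j\<in>UNIV. unit_mat (j, i, conjugate (S $ i $ j)))" .
    then show ?thesis
      by (simp only: herm_unit_def sum.distrib mat_eq_sum_unit_mat[symmetric])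
  qed
  ultimately show "S \<in> span (herm_basis ` herm_index J)"
    using S by (simp add: hermitian_def flip: scaleR_2)
qed

text \<open>Row \<open>l\<close> of a rectangular matrix becomes row \<open>k\<close> of a Hermitian
  one, with its conjugate in column \<open>k\<close>. In this way the off-diagonal part of a row of
  \<open>S\<close> and a row of \<open>Y\<close> are integrated with the same measure.\<close>

definition herm_cross :: "'n \<Rightarrow> 'm \<Rightarrow> 'a::{real_normed_div_algebra, euclidean_space}^'m^'n \<Rightarrow> 'a^'m^'m"
  where "herm_cross l k Z = unit_mat (k, l, 1) ** Z + ctranspose (unit_mat (k, l, 1) ** Z)"

lemma unit_mat_mult_nth: "(unit_mat (k, l, a) ** Z) $ i $ j = (if i = k then a * Z $ l $ j else 0)"
  by (cases "i = k") (simp_all add: matrix_mul_nth unit_mat_nth if_distrib[of "\<lambda>x. x * _"] cong: if_cong)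

lemma herm_cross_nth: "herm_cross l k Z $ i $ j =
    (if i = k then Z $ l $ j else 0) + (if j = k then conjugate (Z $ l $ i) else 0)"
  by (simp add: herm_cross_def unit_mat_mult_nth)

lemma linear_herm_cross:
  "linear (herm_cross l k :: 'a::{real_normed_div_algebra, euclidean_space}^'m^'n \<Rightarrow> _)"
  unfolding herm_cross_def[abs_def]
  by (intro linear_compose_add linear_matrix_mul_left
      linear_compose[OF linear_matrix_mul_left linear_ctranspose, unfolded o_def])

lemma borel_measurable_herm_cross [measurable]:
  "(herm_cross l k :: 'a::{real_normed_div_algebra, euclidean_space}^'m^'n \<Rightarrow> _) \<in> borel_measurable borel"
  by (rule linear_borel_measurable[OF linear_herm_cross])

lemma finite_block_index [simp]: "finite (K \<times> J \<times> (Basis :: 'a::euclidean_space set))"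
  for K :: "'n::finite set" and J :: "'m::finite set"
  by (intro finite_cartesian_product) simp_all

text \<open>Since \<open>k\<close> comes first in the enumeration, every pair involving it occurs as
  \<open>(k, j)\<close> and never as \<open>(j, k)\<close>, so no coordinate has to be
  conjugated.\<close>

lemma herm_index_min:
  assumes k: "k \<in> J" and min: "\<And>j. j \<in> J \<Longrightarrow> to_nat k \<le> to_nat j"
  shows "(herm_index J :: ('m::finite \<times> 'm \<times> 'a::{real_normed_div_algebra, euclidean_space}) set) = insert (k, k, 1) (({k} \<times> (J - {k}) \<times> Basis) \<union> herm_index (J - {k}))"
proof -
  have lt: "to_nat k < to_nat j" if "j \<in> J - {k}" for j
    using that min[of j] by (metis DiffE insertI1 le_neq_implies_less to_nat_split)
  have pairs: "{(i, j). i \<in> J \<and> j \<in> J \<and> to_nat i < to_nat j} =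
      {k} \<times> (J - {k}) \<union> {(i, j). i \<in> J - {k} \<and> j \<in> J - {k} \<and> to_nat i < to_nat j}"
    using k lt by (auto dest: leD[OF min])
  have eq1: "(\<lambda>i. (i, i, 1 :: 'a)) ` J = insert (k, k, 1) ((\<lambda>i. (i, i, 1)) ` (J - {k}))"
    using k by blast
  have eq2: "(\<lambda>((i, j), u). (i, j, u :: 'a)) ` (({k} \<times> (J - {k})) \<times> Basis) = {k} \<times> (J - {k}) \<times> Basis"
    by force
  show ?thesis
    unfolding herm_index_def pairs Sigma_Un_distrib1 image_Un eq1 eq2 by blast
qed

text \<open>Coordinates adapted to a pivot: its value \<open>t\<close>, the rest of its row, and the
  block on \<open>J - {k}\<close>. The row is parametrized by rectangular matrices supported in row
  \<open>l\<close>, as on the other side of the induction step.\<close>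

lemma nn_integral_herm_lebesgue_min:
  fixes F :: "'a::{real_normed_div_algebra, euclidean_space}^'m^'m \<Rightarrow> ennreal" and l :: "'n::finite"
  assumes k: "k \<in> J" and min: "\<And>j. j \<in> J \<Longrightarrow> to_nat k \<le> to_nat j"
    and [measurable]: "F \<in> borel_measurable borel"
  shows "(\<integral>\<^sup>+S. F S \<partial>herm_lebesgue J) =
    (\<integral>\<^sup>+t. \<integral>\<^sup>+Z. \<integral>\<^sup>+S. F (t *\<^sub>R unit_mat (k, k, 1) + herm_cross l k Z + S) \<partial>herm_lebesgue (J - {k})
      \<partial>(block_lebesgue {l} (J - {k}) :: ('a^'m^'n) measure) \<partial>lborel)"
proof -
  let ?J = "J - {k}"
  let ?I = "{k} \<times> ?J \<times> (Basis :: 'a set)" and ?I' = "{l} \<times> ?J \<times> (Basis :: 'a set)"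
  have notin: "(k, k, 1) \<notin> ?I \<union> herm_index ?J" and disj: "?I \<inter> herm_index ?J = {}"
    unfolding herm_index_def by auto
  define f :: "'n \<times> 'm \<times> 'a \<Rightarrow> 'm \<times> 'm \<times> 'a" where "f = (\<lambda>(_, j, u). (k, j, u))"
  have f: "inj_on f ?I'" "f ` ?I' = ?I"
    by (auto simp: f_def inj_on_def image_iff)
  have row: "(\<integral>\<^sup>+X. G X \<partial>span_lebesgue ?I herm_basis) = (\<integral>\<^sup>+Z. G (herm_cross l k Z) \<partial>block_lebesgue {l} ?J)"
    if [measurable]: "G \<in> borel_measurable borel" for G :: "'a^'m^'m \<Rightarrow> ennreal"
  proof -
    have "span_lebesgue ?I herm_basis = span_lebesgue ?I' (herm_basis \<circ> f)"
      using span_lebesgue_reindex[OF finite_block_index f(1), of herm_basis] f(2) by simp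
    also have "\<dots> = span_lebesgue ?I' (herm_cross l k \<circ> unit_mat)"
      by (rule span_lebesgue_cong)
        (auto simp: f_def herm_basis_def vec_eq_iff herm_unit_nth herm_cross_nth unit_mat_nth)
    finally show ?thesis
      using nn_integral_span_lebesgue_linear[OF linear_herm_cross that, of ?I' unit_mat]
      by (simp add: block_lebesgue_def)
  qed
  have idx: "herm_index J = insert (k, k, 1) (?I \<union> herm_index ?J)"
    by (rule herm_index_min[OF k min])
  have "(\<integral>\<^sup>+S. F S \<partial>herm_lebesgue J) =
      (\<integral>\<^sup>+t. \<integral>\<^sup>+X. F (t *\<^sub>R unit_mat (k, k, 1) + X) \<partial>span_lebesgue (?I \<union> herm_index ?J) herm_basis \<partial>lborel)"
    unfolding herm_lebesgue_def idx
    by (subst nn_integral_span_lebesgue_insert[OF _ notin]) (simp_all add: herm_basis_def)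
  also have "\<dots> = (\<integral>\<^sup>+t. \<integral>\<^sup>+X. \<integral>\<^sup>+S. F (t *\<^sub>R unit_mat (k, k, 1) + X + S) \<partial>herm_lebesgue ?J \<partial>span_lebesgue ?I herm_basis \<partial>lborel)"
    unfolding herm_lebesgue_def
    by (subst nn_integral_span_lebesgue_Un[OF _ _ disj]) (simp_all add: add.assoc)
  also have "\<dots> = (\<integral>\<^sup>+t. \<integral>\<^sup>+Z. \<integral>\<^sup>+S. F (t *\<^sub>R unit_mat (k, k, 1) + herm_cross l k Z + S) \<partial>herm_lebesgue ?J
      \<partial>(block_lebesgue {l} ?J :: ('a^'m^'n) measure) \<partial>lborel)"
    unfolding herm_lebesgue_def by (intro nn_integral_cong row) measurable
  finally show ?thesis .
qed

section \<open>The distribution of Gram matrices\<close>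

abbreviation (input) gram :: "'a::{real_normed_div_algebra, euclidean_space}^'m^'n \<Rightarrow> 'a^'m^'m"
  where "gram Z \<equiv> ctranspose Z ** Z"

lemma gram_unitary:
  assumes "ctranspose Q ** Q = mat 1"
  shows "gram (Q ** Z) = gram Z"
proof -
  have "gram (Q ** Z) = ctranspose Z ** (ctranspose Q ** Q) ** Z"
    by (simp only: ctranspose_mult matrix_mul_assoc)
  then show ?thesis by (simp add: assms)
qed

lemma hermitian_gram: "hermitian (gram Z)"
  by (simp add: hermitian_def ctranspose_mult)

section \<open>Peeling a column and a row off a block\<close>

lemma block_lebesgue_Un_cols:
  fixes F :: "'a::{real_normed_div_algebra, euclidean_space}^'m^'n \<Rightarrow> ennreal"
  assumes [measurable]: "F \<in> borel_measurable borel" and disj: "A \<inter> B = {}"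
  shows "(\<integral>\<^sup>+Z. F Z \<partial>block_lebesgue K (A \<union> B))
    = (\<integral>\<^sup>+X. \<integral>\<^sup>+Y. F (X + Y) \<partial>block_lebesgue K B \<partial>block_lebesgue K A)"
proof -
  have "K \<times> (A \<union> B) \<times> Basis = K \<times> A \<times> Basis \<union> K \<times> B \<times> (Basis :: 'a set)" by blast
  moreover have "(K \<times> A \<times> Basis) \<inter> (K \<times> B \<times> (Basis :: 'a set)) = {}" using disj by blast
  ultimately show ?thesis
    unfolding block_lebesgue_def by (simp only:) (rule nn_integral_span_lebesgue_Un; simp)
qed

lemma block_lebesgue_Un_rows:
  fixes F :: "'a::{real_normed_div_algebra, euclidean_space}^'m^'n \<Rightarrow> ennreal"
  assumes [measurable]: "F \<in> borel_measurable borel" and disj: "A \<inter> B = {}"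
  shows "(\<integral>\<^sup>+Z. F Z \<partial>block_lebesgue (A \<union> B) J)
    = (\<integral>\<^sup>+X. \<integral>\<^sup>+Y. F (X + Y) \<partial>block_lebesgue B J \<partial>block_lebesgue A J)"
proof -
  have "(A \<union> B) \<times> J \<times> Basis = A \<times> J \<times> Basis \<union> B \<times> J \<times> (Basis :: 'a set)" by blast
  moreover have "(A \<times> J \<times> Basis) \<inter> (B \<times> J \<times> (Basis :: 'a set)) = {}" using disj by blast
  ultimately show ?thesis
    unfolding block_lebesgue_def by (simp only:) (rule nn_integral_span_lebesgue_Un; simp)
qed

lemma measurable_nn_integral_block_lebesgue [measurable]:
  assumes "case_prod G \<in> borel_measurable (N \<Otimes>\<^sub>M borel)"
  shows "(\<lambda>x. \<integral>\<^sup>+Z. G x Z \<partial>(block_lebesgue K J :: ('a::{real_normed_div_algebra, euclidean_space}^'m^'n) measure)) \<in> borel_measurable N"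
  unfolding block_lebesgue_def
  by (rule measurable_nn_integral_span_lebesgue[OF finite_block_index assms])

lemma measurable_nn_integral_herm_lebesgue [measurable]:
  assumes "case_prod G \<in> borel_measurable (N \<Otimes>\<^sub>M borel)"
  shows "(\<lambda>x. \<integral>\<^sup>+S. G x S \<partial>(herm_lebesgue J :: ('a::{real_normed_div_algebra, euclidean_space}^'m^'m) measure)) \<in> borel_measurable N"
  unfolding herm_lebesgue_def
  by (rule measurable_nn_integral_span_lebesgue[OF finite_herm_index assms])

lemma sets_block_lebesgue [simp, measurable_cong]: "sets (block_lebesgue K J) = sets borel"
  by (simp add: block_lebesgue_def)

lemma sets_herm_lebesgue [simp, measurable_cong]: "sets (herm_lebesgue J) = sets borel"
  by (simp add: herm_lebesgue_def)

lemma nn_integral_block_lebesgue_cong: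
  fixes F G :: "'a::{real_normed_div_algebra, euclidean_space}^'m^'n \<Rightarrow> ennreal"
  assumes "F \<in> borel_measurable borel" "G \<in> borel_measurable borel"
    and "\<And>Z. (\<And>i j. i \<notin> K \<or> j \<notin> J \<Longrightarrow> Z $ i $ j = 0) \<Longrightarrow> F Z = G Z"
  shows "(\<integral>\<^sup>+Z. F Z \<partial>block_lebesgue K J) = (\<integral>\<^sup>+Z. G Z \<partial>block_lebesgue K J)"
  unfolding block_lebesgue_def
  by (rule nn_integral_span_lebesgue_cong[OF assms(1,2)], rule assms(3), simp add: in_span_unit_mat_iff)

lemma nn_integral_herm_lebesgue_cong:
  fixes F G :: "'a::{real_normed_div_algebra, euclidean_space}^'m^'m \<Rightarrow> ennreal"
  assumes "F \<in> borel_measurable borel" "G \<in> borel_measurable borel"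
    and "\<And>S. hermitian S \<Longrightarrow> supported J S \<Longrightarrow> F S = G S"
  shows "(\<integral>\<^sup>+S. F S \<partial>herm_lebesgue J) = (\<integral>\<^sup>+S. G S \<partial>herm_lebesgue J)"
  unfolding herm_lebesgue_def
  by (rule nn_integral_span_lebesgue_cong[OF assms(1,2)]) (simp add: assms(3) herm_basis_in_span_iff)

text \<open>Rotating the first column onto a coordinate axis leaves the Gram matrix unchanged.\<close>

lemma nn_integral_gram_rotate_column:
  fixes F :: "'a::{real_normed_div_algebra, euclidean_space}^'m^'m \<Rightarrow> ennreal" and X :: "'a^'m^'n"
  assumes F [measurable]: "F \<in> borel_measurable borel" and l: "l \<in> K"
    and X: "\<And>i j. i \<notin> K \<or> j \<notin> {k} \<Longrightarrow> X $ i $ j = 0"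
  shows "(\<integral>\<^sup>+Y. F (gram (X + Y)) \<partial>block_lebesgue K J)
    = (\<integral>\<^sup>+Y. F (gram (norm X *\<^sub>R unit_mat (l, k, 1) + Y)) \<partial>block_lebesgue K J)"
proof -
  define x where "x = (\<chi> i. X $ i $ k)"
  have x0: "x $ i = 0" if "i \<notin> K" for i
    using that X by (simp add: x_def)
  have "\<exists>Q. gram Q = mat 1 \<and> Q *v x = axis l (of_real (norm x)) \<and>
      (\<forall>i j. i \<notin> K \<or> j \<notin> K \<longrightarrow> Q $ i $ j = (if i = j then 1 else 0))"
  proof (rule exists_unitary_to_axis[of l K x, OF l x0])
    fix Q :: "'a^'n^'n" assume "gram Q = mat 1" "Q *v x = axis l (of_real (norm x))"
      "\<And>i j. i \<notin> K \<or> j \<notin> K \<Longrightarrow> Q $ i $ j = (if i = j then 1 else 0)"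
    then show ?thesis by (intro exI[of _ Q] conjI allI impI)
  qed
  then obtain Q where Q: "gram Q = mat 1" "Q *v x = axis l (of_real (norm x))"
    "\<forall>i j. i \<notin> K \<or> j \<notin> K \<longrightarrow> Q $ i $ j = (if i = j then 1 else 0)"
    by (elim exE conjE)
  have QX: "Q ** X = norm x *\<^sub>R unit_mat (l, k, 1)"
  proof -
    have "(Q ** X) $ i $ j = (norm x *\<^sub>R unit_mat (l, k, 1)) $ i $ j" for i j
    proof (cases "j = k")
      case True
      then have "(Q ** X) $ i $ j = (Q *v x) $ i"
        by (simp add: matrix_mul_nth matrix_vector_mult_def x_def)
      also have "\<dots> = (if i = l then of_real (norm x) else 0)"
        by (simp only: Q(2)) (simp add: axis_def)
      finally show ?thesis using True by (simp add: unit_mat_nth of_real_def)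
    qed (simp add: matrix_mul_nth X unit_mat_nth)
    then show ?thesis by (simp add: vec_eq_iff)
  qed
  have "norm X = norm x"
    using norm_unitary_mult[OF Q(1), of X] by (simp add: QX unit_mat_def norm_axis)
  have "(\<integral>\<^sup>+Y. F (gram (X + Y)) \<partial>block_lebesgue K J)
      = (\<integral>\<^sup>+Y. F (gram (norm X *\<^sub>R unit_mat (l, k, 1) + Q ** Y)) \<partial>block_lebesgue K J)"
    using gram_unitary[OF Q(1), of "X + _"] by (simp add: matrix_add_ldistrib' QX \<open>norm X = norm x\<close>)
  also have "\<dots> = (\<integral>\<^sup>+Y. F (gram (norm X *\<^sub>R unit_mat (l, k, 1) + Y)) \<partial>block_lebesgue K J)"
    by (rule nn_integral_block_lebesgue_unitary[OF Q(1) Q(3)[rule_format]]) measurable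
  finally show ?thesis .
qed

text \<open>After the rotation, the integral over the other columns depends on column
  \<open>k\<close> only through its length, so the radial formula applies. \<open>q\<close> is half
  the number of real components of a column.\<close>

lemma nn_integral_gram_peel_column:
  fixes F :: "'a::{real_normed_div_algebra, euclidean_space}^'m^'m \<Rightarrow> ennreal"
    and K :: "'n::finite set"
  assumes [measurable]: "F \<in> borel_measurable borel" and k: "k \<in> J" and l: "l \<in> K"
  defines "q \<equiv> real DIM('a) * real (card K) / 2"
  shows "(\<integral>\<^sup>+Z. F (gram Z) \<partial>(block_lebesgue K J :: ('a^'m^'n) measure)) = ennreal (pi powr q / Gamma q) *
    (\<integral>\<^sup>+t. ennreal (t powr (q - 1)) * indicator {0<..} t *
      (\<integral>\<^sup>+Y. F (gram (sqrt t *\<^sub>R unit_mat (l, k, 1) + Y)) \<partial>(block_lebesgue K (J - {k}) :: ('a^'m^'n) measure)) \<partial>lborel)"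
proof -
  let ?B = "block_lebesgue K (J - {k}) :: ('a^'m^'n) measure"
  define H where "H r = (\<integral>\<^sup>+Y. F (gram (r *\<^sub>R unit_mat (l, k, 1) + Y)) \<partial>?B)" for r
  have [measurable]: "H \<in> borel_measurable borel" unfolding H_def by measurable
  have J: "J = {k} \<union> (J - {k})" using k by blast
  have "(\<integral>\<^sup>+Z. F (gram Z) \<partial>(block_lebesgue K J :: ('a^'m^'n) measure))
      = (\<integral>\<^sup>+X. \<integral>\<^sup>+Y. F (gram (X + Y)) \<partial>?B \<partial>block_lebesgue K {k})"
    by (subst J, subst block_lebesgue_Un_cols) auto
  also have "\<dots> = (\<integral>\<^sup>+X. H (norm X) \<partial>(block_lebesgue K {k} :: ('a^'m^'n) measure))"
    by (rule nn_integral_block_lebesgue_cong)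
      (auto simp: H_def intro!: nn_integral_gram_rotate_column[OF _ l])
  also have "\<dots> = (\<integral>\<^sup>+X. H (sqrt ((norm X)\<^sup>2)) \<partial>(block_lebesgue K {k} :: ('a^'m^'n) measure))"
    by simp
  also have "\<dots> = ennreal (pi powr q / Gamma q) * (\<integral>\<^sup>+t. ennreal (t powr (q - 1)) * indicator {0<..} t * H (sqrt t) \<partial>lborel)"
  proof -
    have ne: "K \<times> {k} \<times> (Basis :: 'a set) \<noteq> {}" using l by auto
    have q: "real (card (K \<times> {k} \<times> (Basis :: 'a set))) / 2 = q"
      by (simp add: q_def card_cartesian_product)
    show ?thesis
      unfolding block_lebesgue_def
      by (rule nn_integral_span_lebesgue_radial[OF finite_block_index ne orthonormal_unit_mat, unfolded q]) simp
  qed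
  finally show ?thesis by (simp only: H_def)
qed

text \<open>The rotated column lives in row \<open>l\<close> alone. Hence the other rows enter only
  through their own Gram matrix, and the inner integral has the shape to which an induction
  hypothesis applies.\<close>

lemma nn_integral_gram_peel_row:
  fixes F :: "'a::{real_normed_div_algebra, euclidean_space}^'m^'m \<Rightarrow> ennreal"
    and K :: "'n::finite set"
  assumes [measurable]: "F \<in> borel_measurable borel" and l: "l \<in> K"
  shows "(\<integral>\<^sup>+Y. F (gram (r *\<^sub>R unit_mat (l, k, 1) + Y)) \<partial>(block_lebesgue K J :: ('a^'m^'n) measure)) =
    (\<integral>\<^sup>+y. \<integral>\<^sup>+Y. F (gram (r *\<^sub>R unit_mat (l, k, 1) + y) + gram Y)
      \<partial>(block_lebesgue (K - {l}) J :: ('a^'m^'n) measure) \<partial>(block_lebesgue {l} J :: ('a^'m^'n) measure))"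
proof -
  have K: "K = {l} \<union> (K - {l})" using l by blast
  have "(\<integral>\<^sup>+Y. F (gram (r *\<^sub>R unit_mat (l, k, 1) + Y)) \<partial>(block_lebesgue K J :: ('a^'m^'n) measure)) =
    (\<integral>\<^sup>+y. \<integral>\<^sup>+Y. F (gram (r *\<^sub>R unit_mat (l, k, 1) + (y + Y)))
      \<partial>block_lebesgue (K - {l}) J \<partial>block_lebesgue {l} J)"
    by (subst K, subst block_lebesgue_Un_rows) auto
  also have "\<dots> = (\<integral>\<^sup>+y. \<integral>\<^sup>+Y. F (gram (r *\<^sub>R unit_mat (l, k, 1) + y) + gram Y)
      \<partial>block_lebesgue (K - {l}) J \<partial>block_lebesgue {l} J)"
  proof (rule nn_integral_block_lebesgue_cong)
    fix y :: "'a^'m^'n" assume y: "\<And>i j. i \<notin> {l} \<or> j \<notin> J \<Longrightarrow> y $ i $ j = 0"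
    show "(\<integral>\<^sup>+Y. F (gram (r *\<^sub>R unit_mat (l, k, 1) + (y + Y))) \<partial>block_lebesgue (K - {l}) J)
        = (\<integral>\<^sup>+Y. F (gram (r *\<^sub>R unit_mat (l, k, 1) + y) + gram Y) \<partial>block_lebesgue (K - {l}) J)"
    proof (rule nn_integral_block_lebesgue_cong)
      fix Y :: "'a^'m^'n" assume Y: "\<And>i j. i \<notin> K - {l} \<or> j \<notin> J \<Longrightarrow> Y $ i $ j = 0"
      have "gram ((r *\<^sub>R unit_mat (l, k, 1) + y) + Y) = gram (r *\<^sub>R unit_mat (l, k, 1) + y) + gram Y"
        by (rule gram_add_disjoint_rows[of "{l}"]) (use y Y in \<open>auto simp: unit_mat_nth\<close>)
      then show "F (gram (r *\<^sub>R unit_mat (l, k, 1) + (y + Y))) = F (gram (r *\<^sub>R unit_mat (l, k, 1) + y) + gram Y)"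
        by (simp only: add.assoc)
    qed measurable
  qed measurable
  finally show ?thesis .
qed

section \<open>Completing the square at a pivot\<close>

lemma gram_single_row_nth:
  fixes Z :: "'a::{real_normed_div_algebra, euclidean_space}^'m^'n"
  assumes "\<And>i j. i \<noteq> l \<Longrightarrow> Z $ i $ j = 0"
  shows "gram Z $ i $ j = conjugate (Z $ l $ i) * Z $ l $ j"
proof -
  have "gram Z $ i $ j = (\<Sum>q\<in>UNIV. if q = l then conjugate (Z $ l $ i) * Z $ l $ j else 0)"
    unfolding matrix_mul_nth ctranspose_nth
    by (intro sum.cong refl) (simp add: assms split: if_split)
  then show ?thesis by simp
qed

text \<open>These are the data required by \<open>pd_power_schur\<close>, computed in the adapted
  coordinates.\<close>

lemma herm_cross_decomposition:
  fixes Z :: "'a::{real_normed_div_algebra, euclidean_space}^'m^'n" and S :: "'a^'m^'m"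
  assumes k: "k \<in> J" and t: "t > 0"
    and Z: "\<And>i j. i \<notin> {l} \<or> j \<notin> J - {k} \<Longrightarrow> Z $ i $ j = 0"
    and S: "hermitian S" "supported (J - {k}) S"
  defines "T \<equiv> t *\<^sub>R unit_mat (k, k, 1) + herm_cross l k Z + S"
  shows "hermitian T" "supported J T" "re_part (T $ k $ k) = t"
    "schur_complement k T = S - (1 / t) *\<^sub>R gram Z"
proof -
  have Zk: "Z $ i $ k = 0" for i using Z by blast
  have Sk: "S $ k $ j = 0" "S $ j $ k = 0" for j using S(2) by (auto simp: supported_def)
  have T: "T $ i $ j = (if i = k \<and> j = k then of_real t else if i = k then Z $ l $ j
      else if j = k then conjugate (Z $ l $ i) else S $ i $ j)" for i j
    by (simp add: T_def unit_mat_nth herm_cross_nth Zk Sk of_real_def)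
  show "hermitian T"
    by (rule hermitianI) (simp add: T hermitian_nth[OF S(1)])
  show "supported J T"
    unfolding supported_def
  proof (intro allI impI)
    fix i j assume ij: "i \<notin> J \<or> j \<notin> J"
    then have "S $ i $ j = 0" "\<not> (i = k \<and> j = k)"
      using k S(2) by (auto simp: supported_def)
    moreover have "Z $ l $ j = 0" if "i = k"
      using that ij k Z[of l j] by blast
    moreover have "Z $ l $ i = 0" if "j = k"
      using that ij k Z[of l i] by blast
    ultimately show "T $ i $ j = 0"
      by (simp add: T)
  qed
  show tk: "re_part (T $ k $ k) = t" by (simp add: T)
  have "gram Z $ i $ j = conjugate (Z $ l $ i) * Z $ l $ j" for i j
    by (rule gram_single_row_nth) (use Z in blast)
  then have "schur_complement k T $ i $ j = (S - (1 / t) *\<^sub>R gram Z) $ i $ j" for i j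
    by (simp add: schur_complement_nth tk) (simp add: T Zk Sk)
  then show "schur_complement k T = S - (1 / t) *\<^sub>R gram Z"
    by (simp add: vec_eq_iff)
qed

text \<open>Completion of the square: the terms quadratic, mixed and constant in \<open>Z\<close>
  are those of the Gram matrix of a single row. The factors \<open>sqrt t\<close> and
  \<open>1 / sqrt t\<close> cancel in the mixed terms.\<close>

lemma herm_cross_plus_gram:
  fixes Z :: "'a::{real_normed_div_algebra, euclidean_space}^'m^'n"
  assumes t: "t > 0" and Z: "\<And>i j. i \<notin> {l} \<or> j \<notin> J - {k} \<Longrightarrow> Z $ i $ j = 0"
  shows "t *\<^sub>R unit_mat (k, k, 1) + herm_cross l k Z + (1 / t) *\<^sub>R gram Z
    = gram (sqrt t *\<^sub>R unit_mat (l, k, 1) + (1 / sqrt t) *\<^sub>R Z)"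
proof -
  let ?R = "sqrt t *\<^sub>R unit_mat (l, k, 1) + (1 / sqrt t) *\<^sub>R Z"
  have Zk: "Z $ i $ k = 0" for i using Z by blast
  have gZ: "gram Z $ i $ j = conjugate (Z $ l $ i) * Z $ l $ j" for i j
    by (rule gram_single_row_nth) (use Z in blast)
  have gram_R: "gram ?R $ i $ j = conjugate (?R $ l $ i) * ?R $ l $ j" for i j
    by (rule gram_single_row_nth) (simp add: unit_mat_nth Z)
  have row_R: "?R $ l $ j = (if j = k then sqrt t *\<^sub>R 1 else (1 / sqrt t) *\<^sub>R Z $ l $ j)" for j
    by (simp add: unit_mat_nth Zk)
  have gR: "gram ?R $ i $ j = conjugate (if i = k then sqrt t *\<^sub>R 1 else (1 / sqrt t) *\<^sub>R Z $ l $ i) *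
      (if j = k then sqrt t *\<^sub>R 1 else (1 / sqrt t) *\<^sub>R Z $ l $ j)" for i j
    by (simp only: gram_R row_R)
  have "(t *\<^sub>R unit_mat (k, k, 1) + herm_cross l k Z + (1 / t) *\<^sub>R gram Z) $ i $ j = gram ?R $ i $ j" for i j
    unfolding gR vector_add_component vector_scaleR_component gZ unit_mat_nth herm_cross_nth
    using t by (cases "i = k"; cases "j = k") (simp_all add: Zk)
  then show ?thesis by (simp add: vec_eq_iff)
qed

text \<open>For a fixed pivot and row, translating the block by
  \<open>(1 / t) *\<^sub>R gram Z\<close> makes the Schur complement the variable of integration.
  The recursion for \<open>pd_power\<close> releases \<open>t powr e\<close>, and completing the
  square puts the argument of \<open>F\<close> into the form produced by peeling a row.\<close>

lemma nn_integral_herm_slice: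
  fixes F :: "'a::{real_normed_div_algebra, euclidean_space}^'m^'m \<Rightarrow> ennreal"
  assumes [measurable]: "F \<in> borel_measurable borel" and k: "k \<in> J" and t: "t > 0"
    and Z: "\<And>i j. i \<notin> {l} \<or> j \<notin> J - {k} \<Longrightarrow> Z $ i $ j = 0"
  shows "(\<integral>\<^sup>+S. F (t *\<^sub>R unit_mat (k, k, 1) + herm_cross l k Z + S)
      * pd_power e J (t *\<^sub>R unit_mat (k, k, 1) + herm_cross l k Z + S) \<partial>herm_lebesgue (J - {k}))
    = ennreal (t powr e) * (\<integral>\<^sup>+S. F (gram (sqrt t *\<^sub>R unit_mat (l, k, 1) + (1 / sqrt t) *\<^sub>R (Z :: 'a^'m^'n)) + S)
      * pd_power e (J - {k}) S \<partial>herm_lebesgue (J - {k}))"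
proof -
  let ?T = "t *\<^sub>R unit_mat (k, k, 1) + herm_cross l k Z"
  let ?G = "(1 / t) *\<^sub>R gram Z"
  have "(\<integral>\<^sup>+S. F (?T + S) * pd_power e J (?T + S) \<partial>herm_lebesgue (J - {k}))
      = (\<integral>\<^sup>+S. ennreal (t powr e) * (F (?T + S) * pd_power e (J - {k}) (S - ?G)) \<partial>herm_lebesgue (J - {k}))"
  proof (rule nn_integral_herm_lebesgue_cong)
    fix S :: "'a^'m^'m" assume "hermitian S" "supported (J - {k}) S"
    note T = herm_cross_decomposition[OF k t Z this]
    show "F (?T + S) * pd_power e J (?T + S) = ennreal (t powr e) * (F (?T + S) * pd_power e (J - {k}) (S - ?G))"
      using t by (simp only: pd_power_schur[OF k] T simp_thms if_True mult_ac)
  qed measurable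
  also have "\<dots> = (\<integral>\<^sup>+S. ennreal (t powr e) * (F (?T + (S + ?G)) * pd_power e (J - {k}) ((S + ?G) - ?G)) \<partial>herm_lebesgue (J - {k}))"
    unfolding herm_lebesgue_def
  proof (rule nn_integral_span_lebesgue_translate[symmetric])
    have "supported (J - {k}) (gram Z)"
      unfolding supported_def matrix_mul_nth ctranspose_nth
      by (intro allI impI sum.neutral ballI) (metis Z conjugate_0 mult_zero_left mult_zero_right)
    then have "supported (J - {k}) ?G"
      by (simp add: supported_def)
    moreover have "hermitian ?G"
      using hermitian_gram[of Z] by (simp add: hermitian_def ctranspose_scaleR)
    ultimately show "?G \<in> span (herm_basis ` herm_index (J - {k}))"
      by (simp add: herm_basis_in_span_iff)
  qed simp_all
  also have "\<dots> = (\<integral>\<^sup>+S. ennreal (t powr e) * (F (gram (sqrt t *\<^sub>R unit_mat (l, k, 1) + (1 / sqrt t) *\<^sub>R Z) + S)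
      * pd_power e (J - {k}) S) \<partial>herm_lebesgue (J - {k}))"
  proof -
    have "?T + (S + ?G) = (?T + ?G) + S" for S
      by (simp only: add_ac)
    then have "?T + (S + ?G) = gram (sqrt t *\<^sub>R unit_mat (l, k, 1) + (1 / sqrt t) *\<^sub>R Z) + S" for S
      by (simp only: herm_cross_plus_gram[OF t Z])
    then show ?thesis by (simp only: add_diff_cancel_right')
  qed
  also have "\<dots> = ennreal (t powr e) * (\<integral>\<^sup>+S. F (gram (sqrt t *\<^sub>R unit_mat (l, k, 1) + (1 / sqrt t) *\<^sub>R Z) + S)
      * pd_power e (J - {k}) S \<partial>herm_lebesgue (J - {k}))"
    by (rule nn_integral_cmult) measurable
  finally show ?thesis .
qed

text \<open>This undoes the factor \<open>1 / sqrt t\<close> that completing the square leaves on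
  the row.\<close>

lemma nn_integral_block_lebesgue_scale_row:
  fixes F :: "'a::{real_normed_div_algebra, euclidean_space}^'m^'n \<Rightarrow> ennreal"
  assumes F: "F \<in> borel_measurable borel" and c: "c > 0"
  shows "(\<integral>\<^sup>+Z. F ((1 / c) *\<^sub>R Z) \<partial>block_lebesgue {l} J)
    = ennreal (c powr (real DIM('a) * real (card J))) * (\<integral>\<^sup>+Z. F Z \<partial>block_lebesgue {l} J)"
proof -
  let ?I = "{l} \<times> J \<times> (Basis :: 'a set)"
  have [measurable]: "F \<in> borel_measurable borel" by fact
  have "(\<integral>\<^sup>+Z. F ((1 / c) *\<^sub>R Z) \<partial>span_lebesgue ?I unit_mat)
      = ennreal (\<Prod>i\<in>?I. \<bar>c\<bar>) * (\<integral>\<^sup>+Z. F ((1 / c) *\<^sub>R Z) \<partial>span_lebesgue ?I (\<lambda>p. c *\<^sub>R unit_mat p))"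
    by (rule nn_integral_span_lebesgue_scale[symmetric]) (use c in simp_all)
  also have "(\<integral>\<^sup>+Z. F ((1 / c) *\<^sub>R Z) \<partial>span_lebesgue ?I (\<lambda>p. c *\<^sub>R unit_mat p)) = (\<integral>\<^sup>+Z. F Z \<partial>span_lebesgue ?I unit_mat)"
    using nn_integral_span_lebesgue_linear[OF linear_scaleR[of "1 / c"] F, of ?I "\<lambda>p. c *\<^sub>R unit_mat p"] c
    by (simp add: o_def)
  also have "(\<Prod>i\<in>?I. \<bar>c\<bar>) = c powr (real DIM('a) * real (card J))"
    using c by (simp add: card_cartesian_product mult.commute flip: powr_realpow)
  finally show ?thesis by (simp add: block_lebesgue_def)
qed

text \<open>Factor \<open>i\<close> is the constant of the radial formula for a column with
  \<open>n - i\<close> entries: each pivot found before has used up one row.\<close>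

definition gram_const :: "real \<Rightarrow> nat \<Rightarrow> nat \<Rightarrow> real"
  where "gram_const \<beta> p n = (\<Prod>i<p. pi powr (\<beta> * (real n - real i) / 2) / Gamma (\<beta> * (real n - real i) / 2))"

lemma gram_const_Suc:
  "gram_const \<beta> (Suc p) (Suc n) = pi powr (\<beta> * real (Suc n) / 2) / Gamma (\<beta> * real (Suc n) / 2) * gram_const \<beta> p n"
  by (simp add: gram_const_def prod.lessThan_Suc_shift del: prod.lessThan_Suc)

text \<open>The exponent \<open>e\<close> depends only on the difference of the two cardinalities, so it does not change
  when a row and a column are peeled off.\<close>

theorem nn_integral_gram:
  fixes F :: "'a::{real_normed_div_algebra, euclidean_space}^'m^'m \<Rightarrow> ennreal"
    and J :: "'m set" and K :: "'n::finite set"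
  assumes "F \<in> borel_measurable borel" "card J \<le> card K"
    and "e = real DIM('a) * (real (card K) - real (card J) + 1) / 2 - 1"
  shows "(\<integral>\<^sup>+Z. F (gram Z) \<partial>(block_lebesgue K J :: ('a^'m^'n) measure))
    = ennreal (gram_const DIM('a) (card J) (card K)) * (\<integral>\<^sup>+S. F S * pd_power e J S \<partial>herm_lebesgue J)"
  using finite[of J] assms
proof (induction J arbitrary: K F rule: finite_psubset_induct)
  case (psubset J)
  note [measurable] = psubset.prems(1)
  show ?case
  proof (cases "J = {}")
    case True
    then show ?thesis
      by (simp add: block_lebesgue_def herm_lebesgue_def herm_index_def nn_integral_span_lebesgue_empty
          gram_const_def pd_power_empty linear_0[OF linear_ctranspose])
  next
    case False
    \<comment> \<open>Minimality is what \<open>nn_integral_herm_lebesgue_min\<close> asks of the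
      pivot.\<close>
    define k where "k = arg_min_on to_nat J"
    have k: "k \<in> J" and min: "\<And>j. j \<in> J \<Longrightarrow> to_nat k \<le> to_nat j"
      using False by (simp_all add: k_def arg_min_if_finite(1) arg_min_least)
    have "K \<noteq> {}" using False psubset.prems(2) psubset.hyps by (auto simp: card_0_eq)
    then obtain l where l: "l \<in> K" by auto
    let ?J = "J - {k}" and ?K = "K - {l}"
    let ?R = "\<lambda>t. sqrt t *\<^sub>R unit_mat (l, k, 1) :: 'a^'m^'n"
    have J: "card J = Suc (card ?J)" and K: "card K = Suc (card ?K)"
      using card_Suc_Diff1[OF finite k] card_Suc_Diff1[OF finite l] by (simp_all only:)
    have rJ: "real (card J) = real (card ?J) + 1" and rK: "real (card K) = real (card ?K) + 1"
      using J K by linarith+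
    have sub: "?J \<subset> J" using k by blast
    have le: "card ?J \<le> card ?K" using psubset.prems(2) J K by linarith
    have e: "e = real DIM('a) * (real (card ?K) - real (card ?J) + 1) / 2 - 1"
    proof -
      have "real (card K) - real (card J) = real (card ?K) - real (card ?J)"
        using rJ rK by linarith
      then show ?thesis by (simp only: psubset.prems(3))
    qed
    define q where "q = real DIM('a) * real (card K) / 2"
    define C where "C = gram_const DIM('a) (card ?J) (card ?K)"
    \<comment> \<open>The quantity in which both sides meet: for a given pivot, the integral over
      the rest of its row and over the Schur complement.\<close>
    define \<Phi> where "\<Phi> t = (\<integral>\<^sup>+y. \<integral>\<^sup>+S. F (gram (?R t + y) + S) * pd_power e ?J S
        \<partial>herm_lebesgue ?J \<partial>block_lebesgue {l} ?J)" for t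
    have [measurable]: "\<Phi> \<in> borel_measurable borel" unfolding \<Phi>_def by measurable
    \<comment> \<open>It is needed for general \<open>G\<close>, because it will be applied to
      \<open>F\<close> shifted by the Gram matrix of the pivot row.\<close>
    have IH: "(\<integral>\<^sup>+Y. G (gram Y) \<partial>(block_lebesgue ?K ?J :: ('a^'m^'n) measure))
        = ennreal C * (\<integral>\<^sup>+S. G S * pd_power e ?J S \<partial>herm_lebesgue ?J)"
      if "G \<in> borel_measurable borel" for G :: "'a^'m^'m \<Rightarrow> ennreal"
      unfolding C_def by (rule psubset.IH[OF sub that le e])
    have "(\<integral>\<^sup>+Z. F (gram Z) \<partial>(block_lebesgue K J :: ('a^'m^'n) measure)) = ennreal (pi powr q / Gamma q) *
        (\<integral>\<^sup>+t. ennreal (t powr (q - 1)) * indicator {0<..} t * (ennreal C * \<Phi> t) \<partial>lborel)"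
    proof -
      have "(\<integral>\<^sup>+Y. F (gram (?R t + Y)) \<partial>block_lebesgue K ?J) = ennreal C * \<Phi> t" for t
      proof -
        have "(\<integral>\<^sup>+Y. F (gram (?R t + Y)) \<partial>block_lebesgue K ?J)
            = (\<integral>\<^sup>+y. ennreal C * (\<integral>\<^sup>+S. F (gram (?R t + y) + S) * pd_power e ?J S \<partial>herm_lebesgue ?J) \<partial>block_lebesgue {l} ?J)"
          unfolding nn_integral_gram_peel_row[OF psubset.prems(1) l]
          by (intro nn_integral_cong IH) measurable
        also have "\<dots> = ennreal C * \<Phi> t"
          unfolding \<Phi>_def by (rule nn_integral_cmult) measurable
        finally show ?thesis .
      qed
      then show ?thesis
        unfolding nn_integral_gram_peel_column[OF psubset.prems(1) k l] q_def by simp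
    qed
    also have "\<dots> = ennreal (pi powr q / Gamma q) * (ennreal C *
        (\<integral>\<^sup>+t. ennreal (t powr (q - 1)) * indicator {0<..} t * \<Phi> t \<partial>lborel))"
      by (subst nn_integral_cmult[symmetric]) (simp_all add: mult_ac)
    also have "\<dots> = ennreal (gram_const DIM('a) (card J) (card K)) *
        (\<integral>\<^sup>+t. ennreal (t powr (q - 1)) * indicator {0<..} t * \<Phi> t \<partial>lborel)"
    proof -
      have qK: "q = real DIM('a) * real (Suc (card ?K)) / 2"
        by (simp only: q_def K)
      have "q > 0"
        unfolding qK by (intro divide_pos_pos mult_pos_pos) simp_all
      then have "0 \<le> pi powr q / Gamma q"
        by (intro divide_nonneg_nonneg less_imp_le[OF Gamma_real_pos]) simp_all
      moreover have "gram_const DIM('a) (card J) (card K) = pi powr q / Gamma q * C"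
        unfolding qK C_def J K by (rule gram_const_Suc)
      ultimately show ?thesis
        by (simp only: ennreal_mult' mult.assoc)
    qed
    also have "(\<integral>\<^sup>+t. ennreal (t powr (q - 1)) * indicator {0<..} t * \<Phi> t \<partial>lborel)
        = (\<integral>\<^sup>+S. F S * pd_power e J S \<partial>herm_lebesgue J)"
    proof -
      let ?T = "\<lambda>t (Z :: 'a^'m^'n) S. t *\<^sub>R unit_mat (k, k, 1) + herm_cross l k Z + S"
      have "(\<integral>\<^sup>+Z. \<integral>\<^sup>+S. F (?T t Z S) * pd_power e J (?T t Z S) \<partial>herm_lebesgue ?J \<partial>block_lebesgue {l} ?J)
          = ennreal (t powr (q - 1)) * indicator {0<..} t * \<Phi> t" for t
      proof (cases "t > 0")
        case t: True
        have "(\<integral>\<^sup>+Z. \<integral>\<^sup>+S. F (?T t Z S) * pd_power e J (?T t Z S) \<partial>herm_lebesgue ?J \<partial>block_lebesgue {l} ?J)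
            = (\<integral>\<^sup>+Z. ennreal (t powr e) * (\<integral>\<^sup>+S. F (gram (?R t + (1 / sqrt t) *\<^sub>R Z) + S) * pd_power e ?J S \<partial>herm_lebesgue ?J) \<partial>block_lebesgue {l} ?J)"
        proof (rule nn_integral_block_lebesgue_cong)
          fix Z :: "'a^'m^'n" assume "\<And>i j. i \<notin> {l} \<or> j \<notin> ?J \<Longrightarrow> Z $ i $ j = 0"
          then show "(\<integral>\<^sup>+S. F (?T t Z S) * pd_power e J (?T t Z S) \<partial>herm_lebesgue ?J)
              = ennreal (t powr e) * (\<integral>\<^sup>+S. F (gram (?R t + (1 / sqrt t) *\<^sub>R Z) + S) * pd_power e ?J S \<partial>herm_lebesgue ?J)"
            by (rule nn_integral_herm_slice[OF psubset.prems(1) k t])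
        qed measurable
        also have "\<dots> = ennreal (t powr e) * (\<integral>\<^sup>+Z. \<integral>\<^sup>+S. F (gram (?R t + (1 / sqrt t) *\<^sub>R Z) + S) * pd_power e ?J S \<partial>herm_lebesgue ?J \<partial>block_lebesgue {l} ?J)"
          by (rule nn_integral_cmult) measurable
        also have "\<dots> = ennreal (t powr e) * (ennreal (sqrt t powr (real DIM('a) * real (card ?J))) * \<Phi> t)"
          unfolding \<Phi>_def
          by (subst nn_integral_block_lebesgue_scale_row[symmetric]) (use t in simp_all)
        also have "\<dots> = ennreal (t powr e * sqrt t powr (real DIM('a) * real (card ?J))) * \<Phi> t"
          by (simp add: ennreal_mult mult.assoc)
        also have "t powr e * sqrt t powr (real DIM('a) * real (card ?J)) = t powr (q - 1)"
        proof -
          \<comment> \<open>The determinant gives \<open>e\<close>, the row scaling gives the second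
            summand, and the squared length of a column has exponent \<open>q - 1\<close>. This
            equation dictates the form of \<open>e\<close>.\<close>
          have "e + real DIM('a) * real (card ?J) / 2 = q - 1"
            unfolding psubset.prems(3) q_def using rJ by (simp add: field_simps del: card_Diff_insert)
          then show ?thesis
            using t by (simp add: powr_half_sqrt[symmetric] powr_powr flip: powr_add)
        qed
        finally show ?thesis using t by simp
      next
        \<comment> \<open>A nonpositive pivot excludes positive definiteness, so the left side
          vanishes like the indicator on the right.\<close>
        case t: False
        have "(\<integral>\<^sup>+Z. \<integral>\<^sup>+S. F (?T t Z S) * pd_power e J (?T t Z S) \<partial>herm_lebesgue ?J \<partial>block_lebesgue {l} ?J)
            = (\<integral>\<^sup>+Z. 0 \<partial>(block_lebesgue {l} ?J :: ('a^'m^'n) measure))"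
        proof (rule nn_integral_block_lebesgue_cong)
          fix Z :: "'a^'m^'n" assume Z: "\<And>i j. i \<notin> {l} \<or> j \<notin> ?J \<Longrightarrow> Z $ i $ j = 0"
          have "(\<integral>\<^sup>+S. F (?T t Z S) * pd_power e J (?T t Z S) \<partial>herm_lebesgue ?J) = (\<integral>\<^sup>+S. 0 \<partial>(herm_lebesgue ?J :: ('a^'m^'m) measure))"
          proof (rule nn_integral_herm_lebesgue_cong)
            fix S :: "'a^'m^'m" assume "supported ?J S"
            then have "re_part (?T t Z S $ k $ k) = t"
              using Z by (simp add: supported_def unit_mat_nth herm_cross_nth re_part_def dot_square_norm)
            then show "F (?T t Z S) * pd_power e J (?T t Z S) = 0"
              using t by (simp add: pd_power_schur[OF k])
          qed measurable
          then show "(\<integral>\<^sup>+S. F (?T t Z S) * pd_power e J (?T t Z S) \<partial>herm_lebesgue ?J) = 0" by simp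
        qed measurable
        then show ?thesis using t by simp
      qed
      then show ?thesis
        by (subst nn_integral_herm_lebesgue_min[OF k min, of _ l]) simp_all
    qed
    finally show ?thesis .
  qed
qed

section \<open>Comparison with the coordinate definition of Lebesgue measure\<close>

lemma nn_integral_PiM_linear:
  fixes g :: "'p \<Rightarrow> 'x::euclidean_space \<Rightarrow> 'e::euclidean_space"
  assumes "finite P" "\<And>p. linear (g p)" "F \<in> borel_measurable borel"
  shows "(\<integral>\<^sup>+u. F (\<Sum>p\<in>P. g p (u p)) \<partial>(\<Pi>\<^sub>M p\<in>P. (lborel :: 'x measure)))
    = (\<integral>\<^sup>+x. F x \<partial>span_lebesgue (P \<times> Basis) (\<lambda>(p, b). g p b))"
  using assms(1,3)
proof (induction P arbitrary: F)
  case empty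
  then show ?case
    by (simp add: nn_integral_span_lebesgue_empty PiM_empty nn_integral_count_space_finite)
next
  case (insert p P)
  note [measurable] = insert.prems insert.hyps(1)
  have [measurable]: "g q \<in> borel_measurable borel" for q
    by (rule linear_borel_measurable[OF assms(2)])
  have upd: "(\<Sum>q\<in>insert p P. g q ((u(p := y)) q)) = g p y + (\<Sum>q\<in>P. g q (u q))" for u y
    using insert.hyps by (simp add: sum.insert) (intro sum.cong, auto)
  have "(\<integral>\<^sup>+u. F (\<Sum>q\<in>insert p P. g q (u q)) \<partial>(\<Pi>\<^sub>M q\<in>insert p P. (lborel :: 'x measure)))
      = (\<integral>\<^sup>+y. \<integral>\<^sup>+u. F (\<Sum>q\<in>insert p P. g q ((u(p := y)) q)) \<partial>(\<Pi>\<^sub>M q\<in>P. (lborel :: 'x measure)) \<partial>lborel)"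
    by (rule lborel_prod.product_nn_integral_insert_rev[OF insert.hyps]) measurable
  also have "\<dots> = (\<integral>\<^sup>+y. \<integral>\<^sup>+u. F (g p y + (\<Sum>q\<in>P. g q (u q))) \<partial>(\<Pi>\<^sub>M q\<in>P. (lborel :: 'x measure)) \<partial>lborel)"
    by (simp only: upd)
  also have "\<dots> = (\<integral>\<^sup>+y. \<integral>\<^sup>+x. F (g p y + x) \<partial>span_lebesgue (P \<times> Basis) (\<lambda>(p, b). g p b) \<partial>lborel)"
    by (intro nn_integral_cong insert.IH) measurable
  also have "\<dots> = (\<integral>\<^sup>+y. \<integral>\<^sup>+x. F (y + x) \<partial>span_lebesgue (P \<times> Basis) (\<lambda>(p, b). g p b) \<partial>span_lebesgue Basis (g p))"
    unfolding lborel_eq_span_lebesgue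
    by (subst nn_integral_span_lebesgue_linear[OF assms(2)]) (use insert.hyps(1) in \<open>simp_all add: o_def\<close>)
  also have "span_lebesgue Basis (g p) = span_lebesgue ({p} \<times> Basis) (\<lambda>(p, b). g p b)"
  proof -
    have "{p} \<times> Basis = Pair p ` (Basis :: 'x set)" by auto
    moreover have "inj_on (Pair p) (Basis :: 'x set)" by (auto simp: inj_on_def)
    ultimately show ?thesis
      using span_lebesgue_reindex[OF finite_Basis, of "Pair p" "\<lambda>(p, b). g p b"] by (simp add: o_def)
  qed
  also have "(\<integral>\<^sup>+y. \<integral>\<^sup>+x. F (y + x) \<partial>span_lebesgue (P \<times> Basis) (\<lambda>(p, b). g p b) \<partial>span_lebesgue ({p} \<times> Basis) (\<lambda>(p, b). g p b))
      = (\<integral>\<^sup>+x. F x \<partial>span_lebesgue ({p} \<times> Basis \<union> P \<times> Basis) (\<lambda>(p, b). g p b))"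
    by (rule nn_integral_span_lebesgue_Un[symmetric]) (use insert.hyps in auto)
  also have "{p} \<times> Basis \<union> P \<times> Basis = insert p P \<times> (Basis :: 'x set)" by auto
  finally show ?case .
qed

lemma herm_of_eq_sum:
  "(herm_of (d, u) :: 'a::{real_normed_div_algebra, euclidean_space}^'m^'m) =
    (\<Sum>i\<in>UNIV. d i *\<^sub>R unit_mat (i, i, 1)) +
    (\<Sum>p\<in>{(i, j). to_nat i < to_nat (j::'m)}. herm_unit (fst p) (snd p) (u p))"
proof -
  let ?P = "{(i::'m, j). to_nat i < to_nat (j::'m)}"
  have "herm_of (d, u) $ a $ b = (\<Sum>i\<in>UNIV. d i *\<^sub>R (unit_mat (i, i, 1) :: 'a^'m^'m)) $ a $ b
      + (\<Sum>p\<in>?P. herm_unit (fst p) (snd p) (u p)) $ a $ b" for a b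
  proof -
    have diag: "(\<Sum>i\<in>UNIV. d i *\<^sub>R (unit_mat (i, i, 1) :: 'a^'m^'m)) $ a $ b = (if a = b then of_real (d a) else 0)"
    proof -
      have "(\<Sum>i\<in>UNIV. d i *\<^sub>R (unit_mat (i, i, 1) :: 'a^'m^'m)) $ a $ b
          = (\<Sum>i\<in>UNIV. if i = a then (if a = b then of_real (d a) else 0) else 0)"
        unfolding sum_component vector_scaleR_component unit_mat_nth
        by (intro sum.cong refl) (auto simp: of_real_def)
      then show ?thesis by simp
    qed
    have "(\<Sum>p\<in>?P. herm_unit (fst p) (snd p) (u p)) $ a $ b
        = (\<Sum>p\<in>?P. (if p = (a, b) then u (a, b) else 0) + (if p = (b, a) then conjugate (u (b, a)) else 0))"
      unfolding sum_component herm_unit_nth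
      by (intro sum.cong refl arg_cong2[where f="(+)"]) (auto simp: prod_eq_iff)
    also have "\<dots> = (if (a, b) \<in> ?P then u (a, b) else 0) + (if (b, a) \<in> ?P then conjugate (u (b, a)) else 0)"
      by (simp add: sum.distrib sum.delta)
    finally show ?thesis
      using diag linorder_less_linear[of "to_nat a" "to_nat b"]
      by (auto simp: herm_of_def simp del: sum_component)
  qed
  then show ?thesis by (simp add: vec_eq_iff del: sum_component)
qed

text \<open>\<open>herm_of\<close> is real-linear in the diagonal and the upper entries. Resolving
  each upper entry, which ranges over \<open>'a\<close>, into its components along
  \<open>Basis\<close> turns the product measure into coefficients of
  \<open>herm_basis\<close>.\<close>

lemma nn_integral_lborel_herm:
  fixes F :: "'a::{real_normed_div_algebra, euclidean_space}^'m^'m \<Rightarrow> ennreal"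
  assumes [measurable]: "F \<in> borel_measurable borel"
  shows "(\<integral>\<^sup>+S. F S \<partial>lborel_herm) = (\<integral>\<^sup>+S. F S \<partial>herm_lebesgue UNIV)"
proof -
  let ?P = "{(i::'m, j). to_nat i < to_nat (j::'m)}"
  let ?f = "\<lambda>i::'m. (i, i, 1::'a)" and ?h = "\<lambda>((i::'m, j::'m), u::'a). (i, j, u)"
  let ?D = "\<Pi>\<^sub>M i\<in>(UNIV :: 'm set). (lborel :: real measure)"
  let ?U = "\<Pi>\<^sub>M p\<in>?P. (lborel :: 'a measure)"
  have [simp]: "finite ?P" by (rule finite)
  interpret U: sigma_finite_measure ?U by (rule lborel_prod.sigma_finite) simp
  note [measurable] = herm_of_measurable
  have idx: "herm_index UNIV = range ?f \<union> ?h ` (?P \<times> Basis)"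
    by (simp add: herm_index_def)
  have disj: "range ?f \<inter> ?h ` (?P \<times> Basis) = {}" by auto
  have f: "span_lebesgue (range ?f) herm_basis = span_lebesgue UNIV (\<lambda>i. unit_mat (i, i, 1 :: 'a))"
    by (subst span_lebesgue_reindex) (auto simp: inj_on_def o_def herm_basis_def)
  have h: "span_lebesgue (?h ` (?P \<times> Basis)) herm_basis = span_lebesgue (?P \<times> Basis) (\<lambda>(p, u). herm_unit (fst p) (snd p) u)"
  proof (subst span_lebesgue_reindex)
    show "span_lebesgue (?P \<times> Basis) (herm_basis \<circ> ?h) = span_lebesgue (?P \<times> Basis) (\<lambda>(p, u). herm_unit (fst p) (snd p) u)"
      by (rule span_lebesgue_cong) (auto simp: herm_basis_def)
  qed (auto simp: inj_on_def)
  have "(\<integral>\<^sup>+S. F S \<partial>lborel_herm) = (\<integral>\<^sup>+x. F (herm_of x) \<partial>(?D \<Otimes>\<^sub>M ?U))"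
    unfolding lborel_herm_def by (rule nn_integral_distr) measurable
  also have "\<dots> = (\<integral>\<^sup>+d. \<integral>\<^sup>+u. F (herm_of (d, u)) \<partial>?U \<partial>?D)"
    by (rule U.nn_integral_fst[symmetric]) measurable
  also have "\<dots> = (\<integral>\<^sup>+d. \<integral>\<^sup>+x. F ((\<Sum>i\<in>UNIV. d i *\<^sub>R unit_mat (i, i, 1)) + x)
      \<partial>span_lebesgue (?P \<times> Basis) (\<lambda>(p, u). herm_unit (fst p) (snd p) u) \<partial>?D)"
    unfolding herm_of_eq_sum
    by (intro nn_integral_cong nn_integral_PiM_linear linear_herm_unit) simp_all
  also have "\<dots> = (\<integral>\<^sup>+y. \<integral>\<^sup>+x. F (y + x) \<partial>span_lebesgue (?P \<times> Basis) (\<lambda>(p, u). herm_unit (fst p) (snd p) u)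
      \<partial>span_lebesgue UNIV (\<lambda>i. unit_mat (i, i, 1)))"
    by (rule nn_integral_span_lebesgue[symmetric]) (rule measurable_nn_integral_span_lebesgue; simp)
  also have "\<dots> = (\<integral>\<^sup>+S. F S \<partial>herm_lebesgue UNIV)"
    unfolding herm_lebesgue_def idx f[symmetric] h[symmetric]
    by (rule nn_integral_span_lebesgue_Un[OF _ _ disj, symmetric]) simp_all
  finally show ?thesis .
qed

text \<open>The Gamma factors agree up to a shift of the index by one. For the powers of
  \<open>pi\<close>, the sum of \<beta>(n-i)/2 over i < m, increased by m(m-1)\<beta>/4, is
  \<beta>mn/2.\<close>

lemma gram_const_eq:
  "gram_const \<beta> m n = pi powr (\<beta> * real m * real n / 2) / mv_gamma \<beta> m (\<beta> * real n / 2)"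
proof (induction m)
  case 0
  show ?case by (simp add: gram_const_def mv_gamma_def)
next
  case (Suc m)
  have "mv_gamma \<beta> (Suc m) (\<beta> * real n / 2)
      = mv_gamma \<beta> m (\<beta> * real n / 2) * (pi powr (real m * \<beta> / 2) * Gamma (\<beta> * (real n - real m) / 2))"
  proof -
    have "real (Suc m) * (real (Suc m) - 1) * \<beta> / 4 = real m * (real m - 1) * \<beta> / 4 + real m * \<beta> / 2"
      by (simp add: field_simps)
    moreover have "\<beta> * real n / 2 - (real (Suc m) - 1) * \<beta> / 2 = \<beta> * (real n - real m) / 2"
      by (simp add: field_simps)
    moreover have "(\<Prod>i=1..Suc m. Gamma (\<beta> * real n / 2 - (real i - 1) * \<beta> / 2))
        = (\<Prod>i=1..m. Gamma (\<beta> * real n / 2 - (real i - 1) * \<beta> / 2)) * Gamma (\<beta> * real n / 2 - (real (Suc m) - 1) * \<beta> / 2)"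
      by simp
    ultimately show ?thesis
      by (simp only: mv_gamma_def powr_add mult_ac)
  qed
  moreover have "gram_const \<beta> (Suc m) n = gram_const \<beta> m n * (pi powr (\<beta> * (real n - real m) / 2) / Gamma (\<beta> * (real n - real m) / 2))"
    by (simp add: gram_const_def)
  moreover have "pi powr (\<beta> * real (Suc m) * real n / 2)
      = pi powr (\<beta> * real m * real n / 2) * pi powr (\<beta> * (real n - real m) / 2) * pi powr (real m * \<beta> / 2)"
    by (simp add: powr_add[symmetric]) (simp add: field_simps)
  ultimately show ?case
    by (simp add: Suc)
qed

text \<open>For the change of variables a factor with \<open>T = A ** ctranspose A\<close> suffices;
  \<open>A\<close> is the unitary of the spectral decomposition times the diagonal of square roots,
  and \<open>B\<close> is its inverse. The rows are scaled by roots of eigenvalues, hence the half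
  in the exponent.\<close>

lemma pos_def_square_root_factor:
  fixes T :: "'a::{real_normed_div_algebra, euclidean_space}^'n^'n"
  assumes "pos_def T"
  shows "\<exists>A B. A ** B = mat 1 \<and> matrix_inv T = ctranspose B ** B \<and>
    scales_lborel (\<lambda>Z :: 'a^'m^'n. A ** Z) (hdet T powr (real DIM('a) * real CARD('m) / 2))"
proof -
  obtain W where W: "ctranspose W ** W = mat 1" "W ** ctranspose W = mat 1"
    "T = W ** diag_mat (\<lambda>i. of_real (eigvals T $ i)) ** ctranspose W" "\<And>i. eigvals T $ i > 0"
    using pos_def_spectrum[OF assms] by blast
  define r where "r i = sqrt (eigvals T $ i)" for i
  have r: "r i > 0" "r i * r i = eigvals T $ i" for i
    using W(4)[of i] by (simp_all add: r_def)
  let ?D = "diag_mat (\<lambda>i. of_real (r i)) :: 'a^'n^'n"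
  let ?E = "diag_mat (\<lambda>i. of_real (1 / r i)) :: 'a^'n^'n"
  define A where "A = W ** ?D"
  define B where "B = ?E ** ctranspose W"
  have nz: "r i \<noteq> 0" for i using r(1)[of i] by simp
  have DE: "?D ** ?E = mat 1"
    using nz by (simp add: diag_mat_mult flip: of_real_mult)
  have "A ** B = W ** (?D ** ?E) ** ctranspose W"
    by (simp only: A_def B_def matrix_mul_assoc)
  then have AB: "A ** B = mat 1" by (simp only: DE matrix_mul_rid W(2))
  have D: "ctranspose ?D = ?D"
    by (simp add: ctranspose_diag_mat)
  have DD: "?D ** ?D = diag_mat (\<lambda>i. of_real (eigvals T $ i))"
    by (simp only: diag_mat_mult of_real_mult[symmetric] r(2))
  have "A ** ctranspose A = W ** (?D ** ctranspose ?D) ** ctranspose W"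
    by (simp only: A_def ctranspose_mult matrix_mul_assoc)
  also have "\<dots> = T"
    unfolding D DD by (rule W(3)[symmetric])
  finally have TA: "T = A ** ctranspose A" ..
  have "T ** (ctranspose B ** B) = A ** ctranspose (B ** A) ** B"
    by (simp only: TA ctranspose_mult matrix_mul_assoc)
  also have "\<dots> = mat 1"
    by (simp add: matrix_left_inverse_imp_right[OF AB] AB)
  finally have "matrix_inv T = ctranspose B ** B"
    by (rule matrix_inv_eqI)
  moreover have "scales_lborel (\<lambda>Z :: 'a^'m^'n. A ** Z) (hdet T powr (real DIM('a) * real CARD('m) / 2))"
  proof -
    have "scales_lborel (\<lambda>Z :: 'a^'m^'n. W ** (?D ** Z)) (1 * (\<Prod>i\<in>UNIV. r i) ^ (CARD('m) * DIM('a)))"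
      by (rule scales_lborel_compose[OF scales_lborel_unitary[OF W(1)] scales_lborel_diag[OF r(1)]])
    moreover have "(\<Prod>i\<in>UNIV. r i) = hdet T powr (1 / 2)"
    proof -
      have "(\<Prod>i\<in>UNIV. r i)\<^sup>2 = hdet T"
        by (simp only: hdet_def power2_eq_square prod.distrib[symmetric] r(2))
      moreover have "0 \<le> (\<Prod>i\<in>UNIV. r i)"
        by (intro prod_nonneg ballI less_imp_le[OF r(1)])
      ultimately have "sqrt (hdet T) = (\<Prod>i\<in>UNIV. r i)"
        by (rule real_sqrt_unique)
      then show ?thesis
        using hdet_pos[OF assms] by (simp add: powr_half_sqrt)
    qed
    moreover have "(hdet T powr (1 / 2)) ^ (CARD('m) * DIM('a)) = hdet T powr (real DIM('a) * real CARD('m) / 2)"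
      using hdet_pos[OF assms] by (simp add: powr_powr mult.commute flip: powr_realpow)
    ultimately show ?thesis
      by (simp add: A_def matrix_mul_assoc)
  qed
  ultimately show ?thesis using AB by blast
qed

section \<open>From integrals to densities\<close>

lemma pd_power_UNIV:
  "pd_power e UNIV (S :: 'a::{real_normed_div_algebra, euclidean_space}^'m^'m) =
    (if pos_def S then ennreal (hdet S powr e) else 0)"
proof -
  have "S + id_off UNIV = S" by (simp add: vec_eq_iff id_off_nth)
  then show ?thesis by (auto simp: pd_power_def supported_def pos_def_iff)
qed

text \<open>Any dependence on a second scale matrix can be hidden in \<open>c\<close> and
  \<open>g\<close>, so both families of distributions are covered. Measurability of \<open>g\<close>
  on the cone is extracted from the density of \<open>X\<close>, with the help of a Borel choice of
  Gram roots.\<close>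

theorem distributed_gram:
  fixes M :: "'w measure"
    and X :: "'w \<Rightarrow> 'a::{real_normed_div_algebra, euclidean_space}^'m^'n"
    and T :: "'a^'n^'n" and g :: "'a^'m^'m \<Rightarrow> real"
  assumes mn: "CARD('m) \<le> CARD('n)" and T: "pos_def T" and c: "c > 0"
    and X: "distributed M lborel X (\<lambda>x. ennreal (c * hdet T powr (- (real DIM('a) * real CARD('m) / 2)) *
      g (ctranspose x ** matrix_inv T ** x)))"
  defines "e \<equiv> real DIM('a) * (real CARD('n) - real CARD('m) + 1) / 2 - 1"
  shows "distributed M lborel_herm (\<lambda>\<omega>. ctranspose (X \<omega>) ** matrix_inv T ** X \<omega>)
    (\<lambda>s. ennreal (indicator {s. pos_def s} s *
      (c * gram_const DIM('a) CARD('m) CARD('n) * hdet s powr e * g s)))"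
proof -
  define \<tau> where "\<tau> = hdet T powr (real DIM('a) * real CARD('m) / 2)"
  have \<tau>: "\<tau> > 0" using hdet_pos[OF T] by (simp add: \<tau>_def)
  define C where "C = gram_const DIM('a) CARD('m) CARD('n)"
  have C: "C \<ge> 0"
    unfolding C_def gram_const_def
  proof (intro prod_nonneg divide_nonneg_nonneg less_imp_le[OF Gamma_real_pos])
    fix i assume "i \<in> {..<CARD('m)}"
    with mn have "real i < real CARD('n)" by simp
    then show "real DIM('a) * (real CARD('n) - real i) / 2 > 0"
      by simp
  qed simp
  obtain A B :: "'a^'n^'n" where AB: "A ** B = mat 1" and inv: "matrix_inv T = ctranspose B ** B"
    and scales: "scales_lborel (\<lambda>Z :: 'a^'m^'n. A ** Z) \<tau>"
    using pos_def_square_root_factor[OF T, where 'm='m] unfolding \<tau>_def by blast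
  define \<phi> where "\<phi> x = ctranspose x ** matrix_inv T ** x" for x :: "'a^'m^'n"
  have [measurable]: "\<phi> \<in> borel_measurable borel" unfolding \<phi>_def by measurable
  have \<phi>: "\<phi> (A ** y) = gram y" for y
  proof -
    have "\<phi> (A ** y) = ctranspose y ** ctranspose (B ** A) ** (B ** A) ** y"
      by (simp only: \<phi>_def inv ctranspose_mult matrix_mul_assoc)
    then show ?thesis by (simp add: matrix_left_inverse_imp_right[OF AB])
  qed
  define f where "f x = ennreal (c / \<tau> * g (\<phi> x))" for x
  have "c / \<tau> = c * hdet T powr (- (real DIM('a) * real CARD('m) / 2))"
    by (simp only: \<tau>_def powr_minus divide_inverse[of c])
  then have "f = (\<lambda>x. ennreal (c * hdet T powr (- (real DIM('a) * real CARD('m) / 2)) *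
      g (ctranspose x ** matrix_inv T ** x)))"
    by (intro ext) (simp only: f_def \<phi>_def)
  then have X': "distributed M lborel X f"
    using X by (simp only:)
  have [measurable]: "f \<in> borel_measurable borel"
    using distributed_borel_measurable[OF X'] by simp
  have Xm: "X \<in> borel_measurable M"
    using distributed_measurable[OF X'] by simp
  \<comment> \<open>Dividing the positive constant out of the density leaves a Borel function that
    represents \<open>g\<close> along \<open>\<phi>\<close>.\<close>
  define G where "G x = ennreal (\<tau> / c) * f x" for x
  have [measurable]: "G \<in> borel_measurable borel" unfolding G_def by measurable
  have G: "G x = ennreal (g (\<phi> x))" for x
    using c \<tau> by (simp add: G_def f_def ennreal_mult'[symmetric])
  have f: "f x = ennreal (c / \<tau>) * G x" for x
    using c \<tau> by (simp add: G f_def ennreal_mult'[symmetric])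
  obtain root :: "'a^'m^'m \<Rightarrow> 'a^'m^'n" where [measurable]: "root \<in> borel_measurable borel"
    and root: "\<And>S. pos_def S \<Longrightarrow> gram (root S) = S"
  proof -
    have "\<exists>r :: 'a^'m^'m \<Rightarrow> 'a^'m^'n. r \<in> borel_measurable borel \<and>
        (\<forall>S i j. i \<notin> UNIV \<longrightarrow> r S $ i $ j = 0) \<and>
        (\<forall>S. hermitian S \<longrightarrow> supported UNIV S \<longrightarrow> pos_def (S + id_off UNIV) \<longrightarrow> gram (r S) = S)"
      by (rule exists_measurable_gram_root) (rule mn)
    then obtain r :: "'a^'m^'m \<Rightarrow> 'a^'m^'n" where r: "r \<in> borel_measurable borel"
      "\<forall>S. hermitian S \<longrightarrow> supported UNIV S \<longrightarrow> pos_def (S + id_off UNIV) \<longrightarrow> gram (r S) = S"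
      by blast
    have "S + id_off UNIV = S" for S :: "'a^'m^'m" by (simp add: vec_eq_iff id_off_nth)
    then have "gram (r S) = S" if "pos_def S" for S
      using r(2) that by (simp add: supported_def pos_def_iff)
    with r(1) show ?thesis by (rule that)
  qed
  \<comment> \<open>Since \<open>\<phi> (A ** root S) = S\<close> on the cone, evaluating
    \<open>G\<close> at this preimage gives a Borel function that agrees with \<open>g\<close>
    there.\<close>
  define g' where "g' S = G (A ** root S)" for S
  have [measurable]: "g' \<in> borel_measurable borel" unfolding g'_def by measurable
  have g': "g' S = ennreal (g S)" if "pos_def S" for S
    using that by (simp add: g'_def G \<phi> root)
  define D where "D S = ennreal (c * C) * (g' S * pd_power e UNIV S)" for S
  have [measurable]: "D \<in> borel_measurable borel" unfolding D_def by measurable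
  have D_eq: "(\<lambda>s. ennreal (indicator {s. pos_def s} s * (c * C * hdet s powr e * g s))) = D"
  proof
    fix s
    show "ennreal (indicator {s. pos_def s} s * (c * C * hdet s powr e * g s)) = D s"
    proof (cases "pos_def s")
      case True
      have cC: "0 \<le> c * C" using c C by simp
      have "indicator {s. pos_def s} s * (c * C * hdet s powr e * g s) = c * C * (hdet s powr e * g s)"
        using True by simp
      then show ?thesis
        by (simp only: ennreal_mult'[OF cC] ennreal_mult'[OF powr_ge_zero] D_def pd_power_UNIV True
            if_True g'[OF True] mult.commute[of "ennreal (g s)"])
    qed (simp add: D_def pd_power_UNIV)
  qed
  have e: "e = real DIM('a) * (real (card (UNIV :: 'n set)) - real (card (UNIV :: 'm set)) + 1) / 2 - 1"
    by (simp add: e_def)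
  have gram_formula: "(\<integral>\<^sup>+Z. F (gram Z) \<partial>(lborel :: ('a^'m^'n) measure))
      = ennreal C * (\<integral>\<^sup>+S. F S * pd_power e UNIV S \<partial>lborel_herm)"
    if [measurable]: "F \<in> borel_measurable borel" for F :: "'a^'m^'m \<Rightarrow> ennreal"
  proof -
    have "(\<integral>\<^sup>+S. F S * pd_power e UNIV S \<partial>lborel_herm) = (\<integral>\<^sup>+S. F S * pd_power e UNIV S \<partial>herm_lebesgue UNIV)"
      by (rule nn_integral_lborel_herm) measurable
    then show ?thesis
      using nn_integral_gram[OF that mn e]
      by (simp add: C_def block_lebesgue_UNIV)
  qed
  \<comment> \<open>Determinants are positive on the cone, so \<open>pd_power\<close> is nonzero
    exactly there, and its measurability carries over to the cone.\<close>
  have pd_pred [measurable]: "Measurable.pred borel (pos_def :: 'a^'m^'m \<Rightarrow> bool)"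
  proof -
    have "pos_def S \<longleftrightarrow> pd_power e UNIV S \<noteq> 0" for S :: "'a^'m^'m"
      using hdet_pos[of S] by (auto simp: pd_power_UNIV ennreal_eq_0_iff)
    then have "pos_def = (\<lambda>S :: 'a^'m^'m. pd_power e UNIV S \<noteq> 0)" by auto
    then show ?thesis by (rule ssubst) measurable
  qed
  \<comment> \<open>The Gram formula proves this itself: its right side assigns no mass to matrices
    outside the cone.\<close>
  have AE_pd: "AE y in (lborel :: ('a^'m^'n) measure). pos_def (gram y)"
  proof -
    have "(\<integral>\<^sup>+y. indicator {S. \<not> pos_def S} (gram y) \<partial>(lborel :: ('a^'m^'n) measure))
        = ennreal C * (\<integral>\<^sup>+S. indicator {S. \<not> pos_def S} S * pd_power e UNIV S \<partial>(lborel_herm :: ('a^'m^'m) measure))"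
      by (rule gram_formula) measurable
    also have "(\<lambda>S :: 'a^'m^'m. indicator {S. \<not> pos_def S} S * pd_power e UNIV S) = (\<lambda>_. 0)"
      by (auto simp: pd_power_UNIV indicator_def)
    finally have "(\<integral>\<^sup>+y. indicator {S. \<not> pos_def S} (gram y) \<partial>(lborel :: ('a^'m^'n) measure)) = 0"
      by simp
    then have "AE y in (lborel :: ('a^'m^'n) measure). (indicator {S. \<not> pos_def S} (gram y) :: ennreal) = 0"
      by (subst (asm) nn_integral_0_iff_AE) measurable
    then show ?thesis
      by eventually_elim (auto simp: indicator_def split: if_splits)
  qed
  have S_eq: "(\<lambda>\<omega>. ctranspose (X \<omega>) ** matrix_inv T ** X \<omega>) = (\<lambda>\<omega>. \<phi> (X \<omega>))"
    by (simp add: \<phi>_def)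
  have sets_herm: "sets lborel_herm = sets (borel :: ('a^'m^'m) measure)"
    by (simp add: lborel_herm_def)
  have "distr M lborel_herm (\<lambda>\<omega>. \<phi> (X \<omega>)) = density lborel_herm D"
  proof (rule measure_eqI_nn_integral)
    fix F :: "'a^'m^'m \<Rightarrow> ennreal" assume [measurable]: "F \<in> borel_measurable borel"
    note [measurable] = Xm
    note [measurable_cong] = sets_herm
    have "(\<integral>\<^sup>+S. F S \<partial>distr M lborel_herm (\<lambda>\<omega>. \<phi> (X \<omega>))) = (\<integral>\<^sup>+\<omega>. F (\<phi> (X \<omega>)) \<partial>M)"
      by (rule nn_integral_distr) measurable
    also have "\<dots> = (\<integral>\<^sup>+x. f x * F (\<phi> x) \<partial>lborel)"
      by (rule distributed_nn_integral[OF X', symmetric]) measurable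
    \<comment> \<open>The substitution \<open>x = A ** y\<close>. Its Jacobian \<open>\<tau>\<close>
      will cancel against the power of \<open>hdet T\<close> in the density.\<close>
    also have "\<dots> = ennreal \<tau> * (\<integral>\<^sup>+y. f (A ** y) * F (\<phi> (A ** y)) \<partial>lborel)"
      by (rule scales_lborelD[OF scales, symmetric]) measurable
    also have "\<dots> = ennreal \<tau> * (\<integral>\<^sup>+y. ennreal (c / \<tau>) * (g' (gram y) * F (gram y)) \<partial>(lborel :: ('a^'m^'n) measure))"
    proof -
      have "AE y in lborel. f (A ** y) * F (\<phi> (A ** y)) = ennreal (c / \<tau>) * (g' (gram y) * F (gram y))"
        using AE_pd by eventually_elim (simp add: f G \<phi> g' mult.assoc)
      then have "(\<integral>\<^sup>+y. f (A ** y) * F (\<phi> (A ** y)) \<partial>lborel)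
          = (\<integral>\<^sup>+y. ennreal (c / \<tau>) * (g' (gram y) * F (gram y)) \<partial>(lborel :: ('a^'m^'n) measure))"
        by (rule nn_integral_cong_AE)
      then show ?thesis by (rule arg_cong)
    qed
    also have "\<dots> = ennreal \<tau> * (ennreal (c / \<tau>) * (\<integral>\<^sup>+y. g' (gram y) * F (gram y) \<partial>(lborel :: ('a^'m^'n) measure)))"
      by (subst nn_integral_cmult) measurable
    also have "\<dots> = ennreal c * (\<integral>\<^sup>+y. g' (gram y) * F (gram y) \<partial>(lborel :: ('a^'m^'n) measure))"
      using c \<tau> by (simp add: ennreal_mult'[symmetric] flip: mult.assoc)
    also have "(\<integral>\<^sup>+y. g' (gram y) * F (gram y) \<partial>(lborel :: ('a^'m^'n) measure))
        = ennreal C * (\<integral>\<^sup>+S. g' S * F S * pd_power e UNIV S \<partial>lborel_herm)"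
      by (rule gram_formula) measurable
    also have "ennreal c * (ennreal C * (\<integral>\<^sup>+S. g' S * F S * pd_power e UNIV S \<partial>lborel_herm))
        = (\<integral>\<^sup>+S. D S * F S \<partial>lborel_herm)"
      unfolding D_def using c C
      by (subst (2) mult.assoc, subst nn_integral_cmult) (simp_all add: ennreal_mult' mult_ac)
    also have "\<dots> = (\<integral>\<^sup>+S. F S \<partial>density lborel_herm D)"
      by (rule nn_integral_density[symmetric]) measurable
    finally show "(\<integral>\<^sup>+S. F S \<partial>distr M lborel_herm (\<lambda>\<omega>. \<phi> (X \<omega>))) = (\<integral>\<^sup>+S. F S \<partial>density lborel_herm D)" .
  qed (simp_all add: sets_herm)
  moreover have "D \<in> borel_measurable lborel_herm"
    by (simp add: measurable_cong_sets[OF sets_herm refl])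
  moreover have "(\<lambda>\<omega>. \<phi> (X \<omega>)) \<in> measurable M lborel_herm"
    using Xm by (simp add: measurable_cong_sets[OF refl sets_herm])
  ultimately show ?thesis
    unfolding distributed_def S_eq C_def[symmetric] D_eq by blast
qed

theorem theorem4p2:
  fixes M :: "'w measure"
    and X :: "'w \<Rightarrow> 'a::{real_normed_div_algebra, euclidean_space}^'m^'n"
    and V :: "'a^'m^'m"
    and T :: "'a^'n^'n"
    and S :: "'w \<Rightarrow> 'a^'m^'m"
    and \<beta> m n :: nat
  assumes "prob_space M"
    and "\<beta> = DIM('a)" and "\<beta> \<in> {1, 2, 4}"
    and "m = CARD('m)" and "n = CARD('n)" and "m \<le> n"
    and "pos_def V" and "pos_def T"
    and "S = (\<lambda>\<omega>. ctranspose (X \<omega>) ** matrix_inv T ** X \<omega>)"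
  shows
    "(\<forall>(h :: real^'m \<Rightarrow> real) (d :: real).
      h \<in> borel_measurable (restrict_space borel nonneg_vecs) \<longrightarrow>
      (\<forall>l\<in>nonneg_vecs. 0 \<le> h l) \<longrightarrow>
      symmetric_on_nonneg h \<longrightarrow>
      integrable lborel (\<lambda>Z :: 'a^'m^'n. h (eigvals (ctranspose Z ** Z))) \<longrightarrow>
      0 < (LINT Z|(lborel :: ('a^'m^'n) measure). h (eigvals (ctranspose Z ** Z))) \<longrightarrow>
      d * (LINT Z|(lborel :: ('a^'m^'n) measure). h (eigvals (ctranspose Z ** Z))) = 1 \<longrightarrow>
      distributed M lborel X
        (\<lambda>x. ennreal (d * hdet V powr (- (\<beta> * n / 2)) * hdet T powr (- (\<beta> * m / 2)) *
          h (eigvals (whiten V (ctranspose x ** matrix_inv T ** x))))) \<longrightarrow>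
      distributed M lborel_herm S
        (\<lambda>s. ennreal (indicator {s. pos_def s} s *
          (d * pi powr (\<beta> * m * n / 2) / (mv_gamma \<beta> m (\<beta> * n / 2) * hdet V powr (\<beta> * n / 2)) *
           hdet s powr (\<beta> * (real n - real m + 1) / 2 - 1) * h (eigvals (whiten V s)))))) \<and>
     (\<forall>(h :: real \<Rightarrow> real) (c :: real).
      h \<in> borel_measurable (restrict_space borel {0..}) \<longrightarrow>
      (\<forall>u\<ge>0. 0 \<le> h u) \<longrightarrow>
      set_integrable lborel {0..} (\<lambda>u. u ^ (\<beta> * m * n - 1) * h (u\<^sup>2)) \<longrightarrow>
      0 < (LINT u:{0..}|lborel. u ^ (\<beta> * m * n - 1) * h (u\<^sup>2)) \<longrightarrow>
      c = Gamma (\<beta> * m * n / 2) / (2 * pi powr (\<beta> * m * n / 2)) *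
          inverse (LINT u:{0..}|lborel. u ^ (\<beta> * m * n - 1) * h (u\<^sup>2)) \<longrightarrow>
      distributed M lborel X
        (\<lambda>x. ennreal (c * hdet V powr (- (\<beta> * n / 2)) * hdet T powr (- (\<beta> * m / 2)) *
          h (htrace (whiten V (ctranspose x ** matrix_inv T ** x))))) \<longrightarrow>
      distributed M lborel_herm S
        (\<lambda>s. ennreal (indicator {s. pos_def s} s *
          (c * pi powr (\<beta> * m * n / 2) / (mv_gamma \<beta> m (\<beta> * n / 2) * hdet V powr (\<beta> * n / 2)) *
           hdet s powr (\<beta> * (real n - real m + 1) / 2 - 1) * h (htrace (whiten V s))))))"
proof -
  have dims: "CARD('m) \<le> CARD('n)" and \<beta>: "\<beta> = DIM('a)" and m: "m = CARD('m)" and n: "n = CARD('n)"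
    using assms(2,4,5,6) by auto
  have "0 < CARD('m)" "0 < CARD('n)"
    by simp_all
  then have pos: "real (\<beta> * m * n) / 2 > 0"
    by (simp add: \<beta> m n)
  have V: "hdet V > 0" by (rule hdet_pos) fact
  \<comment> \<open>Both parts at once: \<open>g\<close> stands for \<open>h\<close> applied to the
    eigenvalues or to the trace of the whitened matrix. Positivity of \<open>k\<close> is what the
    normalization supplies in each part.\<close>
  have key: "distributed M lborel_herm S
      (\<lambda>s. ennreal (indicator {s. pos_def s} s *
        (k * pi powr (\<beta> * m * n / 2) / (mv_gamma \<beta> m (\<beta> * n / 2) * hdet V powr (\<beta> * n / 2)) *
         hdet s powr (\<beta> * (real n - real m + 1) / 2 - 1) * g s)))"
    if k: "k > 0" and X: "distributed M lborel X
        (\<lambda>x. ennreal (k * hdet V powr (- (\<beta> * n / 2)) * hdet T powr (- (\<beta> * m / 2)) *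
          g (ctranspose x ** matrix_inv T ** x)))"
    for k :: real and g :: "'a^'m^'m \<Rightarrow> real"
  proof -
    \<comment> \<open>The power of \<open>hdet V\<close> does not vary with the matrix argument and
      joins the constant, while \<open>V\<close> itself remains inside \<open>g\<close>.\<close>
    define c where "c = k * hdet V powr (- (\<beta> * n / 2))"
    have c: "c > 0" using k V by (simp add: c_def)
    have "distributed M lborel X (\<lambda>x. ennreal (c * hdet T powr (- (real DIM('a) * real CARD('m) / 2)) *
        g (ctranspose x ** matrix_inv T ** x)))"
      using X by (simp only: c_def \<beta> m of_nat_mult)
    from distributed_gram[OF dims \<open>pos_def T\<close> c this]
    have "distributed M lborel_herm S
      (\<lambda>s. ennreal (indicator {s. pos_def s} s * (c * gram_const \<beta> m n *
        hdet s powr (\<beta> * (real n - real m + 1) / 2 - 1) * g s)))"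
      by (simp only: assms(9) \<beta> m n)
    moreover have "c * gram_const \<beta> m n
        = k * pi powr (\<beta> * m * n / 2) / (mv_gamma \<beta> m (\<beta> * n / 2) * hdet V powr (\<beta> * n / 2))"
      by (simp add: c_def gram_const_eq powr_minus divide_simps)
    ultimately show ?thesis by (simp only:)
  qed
  show ?thesis
  proof (intro conjI allI impI)
    fix h :: "real^'m \<Rightarrow> real" and d :: real
    assume I: "0 < (LINT Z|(lborel :: ('a^'m^'n) measure). h (eigvals (ctranspose Z ** Z)))"
      and d: "d * (LINT Z|(lborel :: ('a^'m^'n) measure). h (eigvals (ctranspose Z ** Z))) = 1"
      and X: "distributed M lborel X
        (\<lambda>x. ennreal (d * hdet V powr (- (\<beta> * n / 2)) * hdet T powr (- (\<beta> * m / 2)) *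
          h (eigvals (whiten V (ctranspose x ** matrix_inv T ** x)))))"
    have "d > 0"
      by (rule zero_less_mult_pos2[OF _ I]) (simp only: d zero_less_one)
    then show "distributed M lborel_herm S
        (\<lambda>s. ennreal (indicator {s. pos_def s} s *
          (d * pi powr (\<beta> * m * n / 2) / (mv_gamma \<beta> m (\<beta> * n / 2) * hdet V powr (\<beta> * n / 2)) *
           hdet s powr (\<beta> * (real n - real m + 1) / 2 - 1) * h (eigvals (whiten V s)))))"
      by (rule key[where g = "\<lambda>s. h (eigvals (whiten V s))"]) (rule X)
  next
    fix h :: "real \<Rightarrow> real" and c :: real
    assume I: "0 < (LINT u:{0..}|lborel. u ^ (\<beta> * m * n - 1) * h (u\<^sup>2))"
      and c: "c = Gamma (\<beta> * m * n / 2) / (2 * pi powr (\<beta> * m * n / 2)) *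
          inverse (LINT u:{0..}|lborel. u ^ (\<beta> * m * n - 1) * h (u\<^sup>2))"
      and X: "distributed M lborel X
        (\<lambda>x. ennreal (c * hdet V powr (- (\<beta> * n / 2)) * hdet T powr (- (\<beta> * m / 2)) *
          h (htrace (whiten V (ctranspose x ** matrix_inv T ** x)))))"
    have "c > 0"
      unfolding c using I Gamma_real_pos[OF pos]
      by (intro mult_pos_pos divide_pos_pos positive_imp_inverse_positive) simp_all
    then show "distributed M lborel_herm S
        (\<lambda>s. ennreal (indicator {s. pos_def s} s *
          (c * pi powr (\<beta> * m * n / 2) / (mv_gamma \<beta> m (\<beta> * n / 2) * hdet V powr (\<beta> * n / 2)) *
           hdet s powr (\<beta> * (real n - real m + 1) / 2 - 1) * h (htrace (whiten V s)))))"
      by (rule key[where g = "\<lambda>s. h (htrace (whiten V s))"]) (rule X)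
  qed
qed

end
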